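(* In the setting described in the context (with $\mathcal{G},\mathcal{X},\mathcal{Z},\mathcal{G}_0,\mathcal{H},\mathcal{L},\mathcal{H}_0,\mathcal{U},\mathcal{V},\lambda,\chi,\nu_{\mathcal{Z}}$ as there), suppose that $x$ is a random element of $\mathcal{X}$ distributed according to an extended decomposable distribution with respect to $(\mathcal{Z},\mathcal{V})$, $$f_{\mathcal{U}}(u(x))\,f_{\mathcal{V}}(v(x))\,f_{\mathcal{Z}}(z(x))\,\lambda(dx).$$ Then $u=u(x)=h\mathcal{H}_0$, $v=v(x)=l\mathcal{G}_0$ and $z=z(x)$ (where $x=hlz$, $h\in\mathcal{H}$, $l\in\mathcal{L}$, $z\in\mathcal{Z}$) are independently distributed with the joint distribution $$f_{\mathcal{U}}(u)\,\chi(u)\,\mu_{\mathcal{U}}(du)\;\times\; f_{\mathcal{V}}(v)\,\chi(v)\,\Delta^{\mathcal{G}}(v)\,\Delta^{\mathcal{L}}(v)^{-1}\mu_{\mathcal{V}}(dv)\;\times\; f_{\mathcal{Z}}(z)\,\nu_{\mathcal{Z}}(dz),$$ where $\Delta^{\mathcal{G}}$ (resp. $\Delta^{\mathcal{L}}$) is the right-hand modulus of $\mathcal{G}$ (resp. $\mathcal{L}$), and $\mu_{\mathcal{U}}$ (resp. $\mu_{\mathcal{V}}$) is a version (i.e., a suitable choice of the positive multiplicative constant) of the invariant measures on $\mathcal{U}=\mathcal{H}/\mathcal{H}_0$ (resp. $\mathcal{V}=\mathcal{L}/\mathcal{G}_0$).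
   Context: **Group actions.** For a group $G$ acting from the left on a set $X$: the isotropy subgroup at $x$ is $G_x=\{g\in G: gx=x\}$; a cross section is a subset of $X$ that intersects each orbit exactly once; a global cross section is a cross section all of whose points have the same isotropy subgroup. **Setting.** $\mathcal{G}$ is a group acting on $\mathcal{X}$ from the left, $\mathcal{Z}\subset\mathcal{X}$ is a global cross section for this action, with common isotropy subgroup $\mathcal{G}_0$, and $\mathcal{Y}=\mathcal{G}/\mathcal{G}_0$ is the left coset space, with $\pi:\mathcal{G}\to\mathcal{Y}$ the canonical map. Each $x\in\mathcal{X}$ corresponds bijectively to $(y,z)\in\mathcal{Y}\times\mathcal{Z}$ through $x=gz$, $y=\pi(g)=g\mathcal{G}_0$. It is assumed that: (a) $\mathcal{X}$ is a locally compact Hausdorff space; (b) $\mathcal{G}$ is a second countable, locally compact Hausdorff topological group acting continuously on $\mathcal{X}$; (c) $\mathcal{G}_0$ is compact; (d) $\mathcal{Z}$ is locally compact and the bijection $x\leftrightarrow(y,z)$ is bimeasurable. **Subgroups.** $\mathcal{H}$ is a subgroup of $\mathcal{G}$, acting on $\mathcal{G}/\mathcal{G}_0$ by $(h,g\mathcal{G}_0)\mapsto(hg)\mathcal{G}_0$. $\mathcal{L}$ is a subgroup of $\mathcal{G}$ of the form $\mathcal{L}=\mathcal{G}'\mathcal{G}_0=\{g_ig_0:i\in I,\ g_0\in\mathcal{G}_0\}$, where $\mathcal{G}'=\{g_i:i\in I\}$ contains the identity $e$ and is a complete set of representatives of the double cosets $\mathcal{H}g\mathcal{G}_0$, $g\in\mathcal{G}$,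 in $\mathcal{G}$ (i.e. $\mathcal{G}=\bigsqcup_{i\in I}\mathcal{H}g_i\mathcal{G}_0$), such that the isotropy subgroup $\mathcal{H}_{g_i\mathcal{G}_0}=\{h\in\mathcal{H}:hg_i\mathcal{G}_0=g_i\mathcal{G}_0\}$ does not depend on $i\in I$. It is assumed that $\mathcal{H}$ and $\mathcal{L}$ are closed subgroups of $\mathcal{G}$ and that $\mathcal{F}=\mathcal{H}\cap\mathcal{L}$ is compact. Put $\mathcal{H}_0=\mathcal{H}\cap\mathcal{G}_0$, $\mathcal{U}=\mathcal{H}/\mathcal{H}_0$, $\mathcal{V}=\mathcal{L}/\mathcal{G}_0=\{l\mathcal{G}_0:l\in\mathcal{L}\}=\{g_i\mathcal{G}_0:i\in I\}$; then $\mathcal{V}$ is a global cross section for the action of $\mathcal{H}$ on $\mathcal{G}/\mathcal{G}_0$ and there is a bijection $\mathcal{X}\leftrightarrow\mathcal{U}\times\mathcal{V}\times\mathcal{Z}$, $x\leftrightarrow(u,v,z)$, given by $x=hlz$, $u=h\mathcal{H}_0$, $v=l\mathcal{G}_0$ ($h\in\mathcal{H}$, $l\in\mathcal{L}$, $z\in\mathcal{Z}$); this defines $u(x),v(x),z(x)$. **Measures.** $\lambda$ is a dominating measure on $\mathcal{X}$, relatively invariant under $\mathcal{G}$ with multiplier $\chi$: $\lambda(d(gx))=\chi(g)\lambda(dx)$, $g\in\mathcal{G}$ ($\chi$ is a continuous homomorphism from $\mathcal{G}$ to the multiplicative group of positive reals). Let $\mu_{\mathcal{G}}$ be a left Haar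 measure on $\mathcal{G}$ and $\mu_{\mathcal{Y}}=\mu_{\mathcal{G}}\pi^{-1}$ the induced measure on $\mathcal{Y}$. Under the identification of $\mathcal{X}$ with $\mathcal{Y}\times\mathcal{Z}$, $\lambda$ factors as $\lambda(dx)=\chi(y)\mu_{\mathcal{Y}}(dy)\,\nu_{\mathcal{Z}}(dz)$, where $\chi(y):=\chi(g)$ for any $g\in\pi^{-1}(\{y\})$ (well defined because $\mathcal{G}_0$ is compact), and it is assumed that $\nu_{\mathcal{Z}}$ is standardized to be a probability measure on $\mathcal{Z}$ (with the version of $\mu_{\mathcal{Y}}$ chosen accordingly). **Conventions.** The right-hand modulus $\Delta^{G}$ of a locally compact group $G$ with left Haar measure $\mu_G$ is defined by $\mu_G(Bg)=\Delta^{G}(g)\mu_G(B)$. By compactness of $\mathcal{H}_0$ and $\mathcal{G}_0$ one may write $\chi(u)=\chi(h)$ for $u=h\mathcal{H}_0$, and $\chi(v)=\chi(l)$, $\Delta^{\mathcal{G}}(v)=\Delta^{\mathcal{G}}(l)$, $\Delta^{\mathcal{L}}(v)=\Delta^{\mathcal{L}}(l)$ for $v=l\mathcal{G}_0$. The invariant measures on $\mathcal{U}$ and $\mathcal{V}$ are invariant under left translation by $\mathcal{H}$ and $\mathcal{L}$, respectively. **Definition.** A distribution on $\mathcal{X}$ is an extended decomposable distribution with respect to the pair of global cross sections $(\mathcal{Z},\mathcal{V})$ if it is of the form $f(x)\lambda(dx)=f_{\mathcal{U}}(u(x))f_{\mathcal{V}}(v(x))f_{\mathcal{Z}}(z(x))\lambda(dx)$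 (with nonnegative measurable functions $f_{\mathcal{U}},f_{\mathcal{V}},f_{\mathcal{Z}}$ on $\mathcal{U},\mathcal{V},\mathcal{Z}$). *)

theory Defs
  imports "HOL-Probability.Probability" "HOL-Algebra.Group_Action"
begin

section \<open>Topology and Borel measures on abstract topological spaces\<close>

definition borel_of :: "'a topology \<Rightarrow> 'a measure" where
  "borel_of T = sigma (topspace T) {S. openin T S}"

lemma space_borel_of [simp]: "space (borel_of T) = topspace T"
  unfolding borel_of_def by (rule space_measure_of) (auto dest: openin_subset)

lemma sets_borel_of: "sets (borel_of T) = sigma_sets (topspace T) {S. openin T S}"
  unfolding borel_of_def by (rule sets_measure_of) (auto dest: openin_subset)

definition quotient_topology :: "('a \<Rightarrow> 'b) \<Rightarrow> 'a topology \<Rightarrow> 'b topology" where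
  "quotient_topology f T =
     topology (\<lambda>S. S \<subseteq> f ` topspace T \<and> openin T {x \<in> topspace T. f x \<in> S})"

lemma openin_quotient_topology:
  fixes f :: "'a \<Rightarrow> 'b"
  shows "openin (quotient_topology f T) S \<longleftrightarrow>
     S \<subseteq> f ` topspace T \<and> openin T {x \<in> topspace T. f x \<in> S}"
proof -
  have "istopology (\<lambda>S. S \<subseteq> f ` topspace T \<and> openin T {x \<in> topspace T. f x \<in> S})"
    unfolding istopology_def
  proof (intro conjI allI impI)
    fix A B :: "'b set"
    assume A: "A \<subseteq> f ` topspace T \<and> openin T {x \<in> topspace T. f x \<in> A}"
      and B: "B \<subseteq> f ` topspace T \<and> openin T {x \<in> topspace T. f x \<in> B}"
    have "{x \<in> topspace T. f x \<in> A \<inter> B} =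
        {x \<in> topspace T. f x \<in> A} \<inter> {x \<in> topspace T. f x \<in> B}" by auto
    then show "openin T {x \<in> topspace T. f x \<in> A \<inter> B}" using A B by auto
    show "A \<inter> B \<subseteq> f ` topspace T" using A by auto
  next
    fix K :: "'b set set"
    assume K: "\<forall>S\<in>K. S \<subseteq> f ` topspace T \<and> openin T {x \<in> topspace T. f x \<in> S}"
    have "{x \<in> topspace T. f x \<in> \<Union>K} = (\<Union>S\<in>K. {x \<in> topspace T. f x \<in> S})" by auto
    then show "openin T {x \<in> topspace T. f x \<in> \<Union>K}" using K by auto
    show "\<Union>K \<subseteq> f ` topspace T" using K by auto
  qed
  then show ?thesis
    unfolding quotient_topology_def by (simp add: topology_inverse')
qed

lemma topspace_quotient_topology [simp]:
  "topspace (quotient_topology f T) = f ` topspace T"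
proof
  show "topspace (quotient_topology f T) \<subseteq> f ` topspace T"
    using openin_quotient_topology[of f T "topspace (quotient_topology f T)"] by auto
  have "{x \<in> topspace T. f x \<in> f ` topspace T} = topspace T" by auto
  then have "openin (quotient_topology f T) (f ` topspace T)"
    by (simp add: openin_quotient_topology)
  then show "f ` topspace T \<subseteq> topspace (quotient_topology f T)"
    by (rule openin_subset)
qed

definition bimeasurable :: "('a \<Rightarrow> 'b) \<Rightarrow> 'a measure \<Rightarrow> 'b measure \<Rightarrow> bool" where
  "bimeasurable f M N \<longleftrightarrow>
     bij_betw f (space M) (space N) \<and> f \<in> measurable M N \<and>
     the_inv_into (space M) f \<in> measurable N M"


section \<open>Topological groups, coset spaces and invariant measures\<close>

locale topological_group = group G for G (structure) and T +
  assumes topspace_eq: "topspace T = carrier G"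
    and continuous_mult: "continuous_map (prod_topology T T) T (\<lambda>(x, y). x \<otimes> y)"
    and continuous_inv: "continuous_map T T (\<lambda>x. inv x)"

text \<open>The space of left cosets of \<open>K\<close> in the subgroup of \<open>G\<close> that underlies the topological
  space \<open>T\<close>, with the quotient topology. For a subgroup \<open>H\<close> of \<open>G\<close>, \<open>T\<close> will be the subspace
  topology of \<open>H\<close>.\<close>

definition coset_space :: "('g, 'm) monoid_scheme \<Rightarrow> 'g topology \<Rightarrow> 'g set \<Rightarrow> 'g set topology" where
  "coset_space G T K = quotient_topology (\<lambda>g. g <#\<^bsub>G\<^esub> K) T"

text \<open>The value on a coset of a function that is constant on that coset.\<close>

definition on_coset :: "('g \<Rightarrow> 'b) \<Rightarrow> 'g set \<Rightarrow> 'b" where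
  "on_coset f C = f (SOME g. g \<in> C)"

text \<open>Nonzero Radon measures invariant under the maps \<open>act h\<close>, \<open>h \<in> H\<close>. All spaces on which this
  is used are second countable, locally compact and Hausdorff; there every Borel measure that is
  finite on compact sets is regular, so regularity is not listed separately.\<close>

definition invariant_measure ::
    "'h set \<Rightarrow> ('h \<Rightarrow> 'a \<Rightarrow> 'a) \<Rightarrow> 'a topology \<Rightarrow> 'a measure \<Rightarrow> bool" where
  "invariant_measure H act T \<mu> \<longleftrightarrow>
     sets \<mu> = sets (borel_of T) \<and>
     (\<forall>h\<in>H. \<forall>B\<in>sets \<mu>. emeasure \<mu> (act h ` B) = emeasure \<mu> B) \<and>
     (\<forall>K. compactin T K \<longrightarrow> emeasure \<mu> K < \<infinity>) \<and>
     emeasure \<mu> (space \<mu>) \<noteq> 0"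

definition left_haar_measure ::
    "('g, 'm) monoid_scheme \<Rightarrow> 'g topology \<Rightarrow> 'g measure \<Rightarrow> bool" where
  "left_haar_measure G T \<mu> \<longleftrightarrow> invariant_measure (carrier G) (\<lambda>g x. g \<otimes>\<^bsub>G\<^esub> x) T \<mu>"

text \<open>The right-hand modulus, for a left Haar measure \<open>\<mu>\<close> on \<open>G\<close>. It does not depend on the choice
  of \<open>\<mu>\<close>, as left Haar measures are unique up to a positive constant.\<close>

definition right_modulus :: "('g, 'm) monoid_scheme \<Rightarrow> 'g measure \<Rightarrow> 'g \<Rightarrow> real" where
  "right_modulus G \<mu> g =
     (THE c. 0 < c \<and> (\<forall>B\<in>sets \<mu>. emeasure \<mu> (B #>\<^bsub>G\<^esub> g) = ennreal c * emeasure \<mu> B))"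


section \<open>Cross sections and the induced coordinates\<close>

definition cross_section ::
    "('g, 'm) monoid_scheme \<Rightarrow> 'x set \<Rightarrow> ('g \<Rightarrow> 'x \<Rightarrow> 'x) \<Rightarrow> 'x set \<Rightarrow> bool" where
  "cross_section G E \<phi> Z \<longleftrightarrow> Z \<subseteq> E \<and> (\<forall>Q\<in>orbits G E \<phi>. \<exists>!z. z \<in> Q \<inter> Z)"

definition global_cross_section ::
    "('g, 'm) monoid_scheme \<Rightarrow> 'x set \<Rightarrow> ('g \<Rightarrow> 'x \<Rightarrow> 'x) \<Rightarrow> 'x set \<Rightarrow> bool" where
  "global_cross_section G E \<phi> Z \<longleftrightarrow>
     cross_section G E \<phi> Z \<and>
     (\<forall>z\<in>Z. \<forall>z'\<in>Z. stabilizer G \<phi> z = stabilizer G \<phi> z')"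

text \<open>\<open>x \<mapsto> (y, z)\<close> where \<open>x = g z\<close> and \<open>y = g G\<^sub>0\<close>.\<close>

definition yz_coords ::
    "('g, 'm) monoid_scheme \<Rightarrow> ('g \<Rightarrow> 'x \<Rightarrow> 'x) \<Rightarrow> 'g set \<Rightarrow> 'x set \<Rightarrow> 'x \<Rightarrow> 'g set \<times> 'x" where
  "yz_coords G \<phi> G\<^sub>0 Z x =
     (THE p. \<exists>g\<in>carrier G. \<exists>z\<in>Z. x = \<phi> g z \<and> p = (g <#\<^bsub>G\<^esub> G\<^sub>0, z))"

text \<open>\<open>x \<mapsto> (u, v, z)\<close> where \<open>x = h l z\<close>, \<open>u = h (H \<inter> G\<^sub>0)\<close> and \<open>v = l G\<^sub>0\<close>.\<close>

definition uvz_coords ::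
    "('g, 'm) monoid_scheme \<Rightarrow> ('g \<Rightarrow> 'x \<Rightarrow> 'x) \<Rightarrow> 'g set \<Rightarrow> 'g set \<Rightarrow> 'g set \<Rightarrow> 'x set \<Rightarrow>
     'x \<Rightarrow> 'g set \<times> 'g set \<times> 'x" where
  "uvz_coords G \<phi> G\<^sub>0 H L Z x =
     (THE p. \<exists>h\<in>H. \<exists>l\<in>L. \<exists>z\<in>Z. x = \<phi> (h \<otimes>\<^bsub>G\<^esub> l) z \<and>
        p = (h <#\<^bsub>G\<^esub> (H \<inter> G\<^sub>0), l <#\<^bsub>G\<^esub> G\<^sub>0, z))"

definition u_coord where "u_coord G \<phi> G\<^sub>0 H L Z x = fst (uvz_coords G \<phi> G\<^sub>0 H L Z x)"
definition v_coord where "v_coord G \<phi> G\<^sub>0 H L Z x = fst (snd (uvz_coords G \<phi> G\<^sub>0 H L Z x))"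
definition z_coord where "z_coord G \<phi> G\<^sub>0 H L Z x = snd (snd (uvz_coords G \<phi> G\<^sub>0 H L Z x))"

text \<open>The form of an extended decomposable distribution, with the three factors made explicit.\<close>

definition extended_decomposable_distribution ::
    "('g, 'm) monoid_scheme \<Rightarrow> ('g \<Rightarrow> 'x \<Rightarrow> 'x) \<Rightarrow> 'g set \<Rightarrow> 'g set \<Rightarrow> 'g set \<Rightarrow> 'x set \<Rightarrow> 'x measure \<Rightarrow>
     ('g set \<Rightarrow> real) \<Rightarrow> ('g set \<Rightarrow> real) \<Rightarrow> ('x \<Rightarrow> real) \<Rightarrow> 'x measure" where
  "extended_decomposable_distribution G \<phi> G\<^sub>0 H L Z \<Lambda> f\<^sub>U f\<^sub>V f\<^sub>Z =
     density \<Lambda> (\<lambda>x. ennreal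
       (f\<^sub>U (u_coord G \<phi> G\<^sub>0 H L Z x) * f\<^sub>V (v_coord G \<phi> G\<^sub>0 H L Z x) * f\<^sub>Z (z_coord G \<phi> G\<^sub>0 H L Z x)))"


section \<open>Independence\<close>

text \<open>The library's \<open>indep_vars\<close> requires all variables of a family to take values in one type. This
  is the same condition (cf. \<open>indep_vars_def2\<close>) for three variables of different types.\<close>

definition independent_triple ::
    "'w measure \<Rightarrow> 'a measure \<Rightarrow> ('w \<Rightarrow> 'a) \<Rightarrow> 'b measure \<Rightarrow> ('w \<Rightarrow> 'b) \<Rightarrow> 'c measure \<Rightarrow> ('w \<Rightarrow> 'c) \<Rightarrow> bool"
  where
  "independent_triple M A a B b C c \<longleftrightarrow>
     a \<in> measurable M A \<and> b \<in> measurable M B \<and> c \<in> measurable M C \<and>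
     prob_space.indep_sets M
       (\<lambda>i. [{a -` S \<inter> space M | S. S \<in> sets A},
             {b -` S \<inter> space M | S. S \<in> sets B},
             {c -` S \<inter> space M | S. S \<in> sets C}] ! i) {..<3}"

end

theory Submission
  imports Defs
begin

text \<open>
  Write \<open>g = h l\<close> with \<open>h \<in> H\<close>, \<open>l \<in> L\<close>; then \<open>u = h H\<^sub>0\<close> and \<open>v = l G\<^sub>0\<close> depend on \<open>y = g G\<^sub>0\<close> only, and
  since \<open>\<lambda>\<close> is a product over \<open>Y \<times> Z\<close> and \<open>\<chi>(y) = \<chi>(u) \<chi>(v)\<close>, everything reduces to factoring \<open>\<mu>\<^sub>Y\<close>
  as \<open>\<mu>\<^sub>U(du) \<Delta>\<^sup>G(v) \<Delta>\<^sup>L(v)\<^sup>-\<^sup>1 \<mu>\<^sub>V(dv)\<close>. No Haar measure on \<open>H\<close> is needed for this: \<open>\<mu>\<^sub>V\<close> is the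
  image of the Haar measure of \<open>L\<close>, a Fubini argument on \<open>G \<times> L\<close> shows that
  \<open>\<mu>\<^sub>G{u \<in> A, v \<in> B}\<close> is a product of a function of \<open>A\<close> and \<open>\<integral>\<^sub>B \<Delta>\<^sup>G / \<Delta>\<^sup>L d\<mu>\<^sub>V\<close>, and the first
  factor is an invariant measure because left translation by \<open>H\<close> moves \<open>u\<close> and fixes \<open>v\<close>.
  Measurability of \<open>u\<close> and \<open>v\<close> comes from \<open>\<sigma>\<close>-compactness: preimages of closed sets are countable
  unions of images of compact sets.
\<close>

section \<open>Borel sets of second countable spaces\<close>

text \<open>The density Delta^G / Delta^L has two sources: replacing g by g l^-1 costs
  Delta^G(l)^-1, and inverting l under the Haar measure of L turns this into Delta^G(l)
  Delta^L(l)^-1. The resulting identity contains a further free set C; fixing one C with 0 <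
  \<open>mu_V\<close> (C) < infinity and dividing by that number is what defines the invariant
  measure on U. So the version of the measure on V is dictated by the given Haar measure of L, and
  the remaining constant sits in the measure on U. The modulus is a definite description, so it
  becomes usable only after Haar measure is known to be unique up to a constant; this is derived by
  exchanging a left invariant with a right invariant measure. Besides multiplicativity, two
  properties of the modulus carry the proof: it is Borel, because mu(E y) is a Borel function of y,
  and it is bounded on a compact set C, because E t lies in the compact set E C for t in C.
  Boundedness makes it trivial on compact subgroups and keeps the measure on U finite on compact
  sets. The three factors of the joint law are normalised only jointly, and independence is deduced
  from total mass one of their product.\<close>

lemma openin_in_borel_of: "openin T S \<Longrightarrow> S \<in> sets (borel_of T)"
  by (simp add: sets_borel_of)

lemma closedin_in_borel_of:
  assumes "closedin T S"
  shows "S \<in> sets (borel_of T)"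
proof -
  have "topspace T - (topspace T - S) \<in> sets (borel_of T)"
    using openin_in_borel_of[of T "topspace T - S"] assms
    by (metis closedin_def sets.compl_sets space_borel_of)
  then show ?thesis
    using closedin_subset[OF assms] by (simp add: double_diff)
qed

lemma measurable_borel_ofI_open:
  assumes "f \<in> space M \<rightarrow> topspace T"
    and "\<And>S. openin T S \<Longrightarrow> f -` S \<inter> space M \<in> sets M"
  shows "f \<in> measurable M (borel_of T)"
  unfolding borel_of_def using assms by (intro measurable_measure_of) (auto dest: openin_subset)

lemma measurable_borel_ofI_closed:
  assumes "f \<in> space M \<rightarrow> topspace T"
    and "\<And>S. closedin T S \<Longrightarrow> f -` S \<inter> space M \<in> sets M"
  shows "f \<in> measurable M (borel_of T)"
proof (rule measurable_borel_ofI_open)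
  fix S assume S: "openin T S"
  have "f -` S \<inter> space M = space M - (f -` (topspace T - S) \<inter> space M)"
    using assms(1) openin_subset[OF S] by auto
  then show "f -` S \<inter> space M \<in> sets M"
    using assms(2)[of "topspace T - S"] S by (metis openin_closedin_eq sets.compl_sets)
qed (rule assms(1))

lemma continuous_map_measurable:
  assumes "continuous_map S T f"
  shows "f \<in> measurable (borel_of S) (borel_of T)"
proof (rule measurable_borel_ofI_open)
  show "f \<in> space (borel_of S) \<rightarrow> topspace T"
    using assms by (auto simp: continuous_map_def)
  fix W assume "openin T W"
  then have "openin S {x \<in> topspace S. f x \<in> W}"
    using assms by (auto simp: continuous_map_def)
  moreover have "f -` W \<inter> space (borel_of S) = {x \<in> topspace S. f x \<in> W}" by auto
  ultimately show "f -` W \<inter> space (borel_of S) \<in> sets (borel_of S)"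
    by (simp add: openin_in_borel_of)
qed

lemma borel_of_euclidean: "borel_of (euclidean :: 'a::topological_space topology) = borel"
  by (auto simp: borel_of_def borel_def open_openin[symmetric])

lemma measurable_borel_of_real:
  "continuous_map T euclideanreal f \<Longrightarrow> f \<in> borel_measurable (borel_of T)"
  using continuous_map_measurable[of T euclideanreal f] by (simp add: borel_of_euclidean)

text \<open>A countable basis of one factor is enough: for each basic \<open>V\<close>, the union
  \<open>D V\<close> of all open \<open>U\<close> with \<open>U \<times> V \<subseteq> W\<close> is
  open, so \<open>W\<close> is a countable union of open rectangles. The other factor will also be a
  quotient space.\<close>

lemma openin_prod_in_borel_pair:
  assumes "second_countable T" and W: "openin (prod_topology S T) W"
  shows "W \<in> sets (borel_of S \<Otimes>\<^sub>M borel_of T)"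
proof -
  obtain \<B> where \<B>: "countable \<B>" "\<forall>V\<in>\<B>. openin T V"
      "\<forall>U x. openin T U \<and> x \<in> U \<longrightarrow> (\<exists>V\<in>\<B>. x \<in> V \<and> V \<subseteq> U)"
    using assms(1) unfolding second_countable_def by blast
  define D where "D V = \<Union>{U. openin S U \<and> U \<times> V \<subseteq> W}" for V
  have "W = (\<Union>V\<in>\<B>. D V \<times> V)"
  proof
    show "W \<subseteq> (\<Union>V\<in>\<B>. D V \<times> V)"
    proof
      fix p assume "p \<in> W"
      moreover obtain x y where xy: "p = (x, y)" by (cases p)
      ultimately have "\<exists>U V. openin S U \<and> openin T V \<and> x \<in> U \<and> y \<in> V \<and> U \<times> V \<subseteq> W"
        using W unfolding openin_prod_topology_alt by simp
      then obtain U V where UV: "openin S U" "openin T V" "x \<in> U" "y \<in> V" "U \<times> V \<subseteq> W"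
        by blast
      obtain V' where V': "V' \<in> \<B>" "y \<in> V'" "V' \<subseteq> V"
        using \<B>(3) UV by blast
      then have "U \<times> V' \<subseteq> W" using UV(5) by blast
      then have "x \<in> D V'" using UV unfolding D_def by blast
      then show "p \<in> (\<Union>V\<in>\<B>. D V \<times> V)" using V' xy by blast
    qed
    show "(\<Union>V\<in>\<B>. D V \<times> V) \<subseteq> W" unfolding D_def by blast
  qed
  moreover have "D V \<times> V \<in> sets (borel_of S \<Otimes>\<^sub>M borel_of T)" if "V \<in> \<B>" for V
    using \<B>(2) that unfolding D_def
    by (intro pair_measureI openin_in_borel_of openin_Union) auto
  ultimately show ?thesis using \<B>(1) by (simp add: sets.countable_UN'')
qed

lemma continuous_map_prod_measurable:
  assumes "second_countable T" and f: "continuous_map (prod_topology S T) R f"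
  shows "f \<in> measurable (borel_of S \<Otimes>\<^sub>M borel_of T) (borel_of R)"
proof (rule measurable_borel_ofI_open)
  show "f \<in> space (borel_of S \<Otimes>\<^sub>M borel_of T) \<rightarrow> topspace R"
    using f by (auto simp: continuous_map_def space_pair_measure)
  fix W assume "openin R W"
  then have "openin (prod_topology S T) {x \<in> topspace (prod_topology S T). f x \<in> W}"
    using f by (auto simp: continuous_map_def)
  moreover have "f -` W \<inter> space (borel_of S \<Otimes>\<^sub>M borel_of T) =
      {x \<in> topspace (prod_topology S T). f x \<in> W}"
    by (auto simp: space_pair_measure)
  ultimately show "f -` W \<inter> space (borel_of S \<Otimes>\<^sub>M borel_of T) \<in>
      sets (borel_of S \<Otimes>\<^sub>M borel_of T)"
    using openin_prod_in_borel_pair[OF assms(1)] by simp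
qed

text \<open>By local compactness the basic open sets that lie inside some compact set still cover
  the space; one enclosing compact set for each of them gives the countable cover.\<close>

lemma sigma_compact:
  assumes "second_countable T" "locally_compact_space T"
  obtains C :: "nat \<Rightarrow> 'a set" where "\<And>n. compactin T (C n)" "(\<Union>n. C n) = topspace T"
proof -
  obtain \<B> where \<B>: "countable \<B>" "\<forall>V\<in>\<B>. openin T V"
      "\<forall>U x. openin T U \<and> x \<in> U \<longrightarrow> (\<exists>V\<in>\<B>. x \<in> V \<and> V \<subseteq> U)"
    using assms(1) unfolding second_countable_def by blast
  define \<B>' where "\<B>' = {V\<in>\<B>. \<exists>K. compactin T K \<and> V \<subseteq> K}"
  have "\<forall>V\<in>\<B>'. \<exists>K. compactin T K \<and> V \<subseteq> K" by (auto simp: \<B>'_def)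
  then obtain K where K: "\<And>V. V \<in> \<B>' \<Longrightarrow> compactin T (K V) \<and> V \<subseteq> K V" by metis
  \<comment> \<open>The empty set makes the family nonempty, so that \<open>from_nat_into\<close>
    has exactly this family as its range.\<close>
  define \<K> where "\<K> = insert {} (K ` \<B>')"
  have cpt: "compactin T S" if "S \<in> \<K>" for S using that K by (auto simp: \<K>_def)
  have "countable \<K>" using \<B>(1) by (simp add: \<K>_def \<B>'_def)
  have "\<Union>\<K> = topspace T"
  proof
    show "\<Union>\<K> \<subseteq> topspace T" using cpt compactin_subset_topspace by blast
    show "topspace T \<subseteq> \<Union>\<K>"
    proof
      fix x assume "x \<in> topspace T"
      then obtain U C where UC: "openin T U" "compactin T C" "x \<in> U" "U \<subseteq> C"
        using assms(2) unfolding locally_compact_space_def by blast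
      then obtain V where V: "V \<in> \<B>" "x \<in> V" "V \<subseteq> U" using \<B>(3) by blast
      then have "V \<in> \<B>'" using UC unfolding \<B>'_def by blast
      then show "x \<in> \<Union>\<K>" using K V unfolding \<K>_def by blast
    qed
  qed
  have "range (from_nat_into \<K>) = \<K>"
    using \<open>countable \<K>\<close> by (simp add: \<K>_def)
  with \<open>\<Union>\<K> = topspace T\<close> have "(\<Union>n. from_nat_into \<K> n) = topspace T" by simp
  moreover have "compactin T (from_nat_into \<K> n)" for n
    using \<open>range (from_nat_into \<K>) = \<K>\<close> by (intro cpt) blast
  ultimately show thesis using that by blast
qed

section \<open>Locally compact second countable groups\<close>

locale lcsc_group = topological_group +
  assumes sc: "second_countable T" and lc: "locally_compact_space T" and hd: "Hausdorff_space T"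
begin

declare topspace_eq [simp]

abbreviation "borelG \<equiv> borel_of T"

lemma measurable_mult: "(\<lambda>(x, y). x \<otimes> y) \<in> measurable (borelG \<Otimes>\<^sub>M borelG) borelG"
  by (rule continuous_map_prod_measurable[OF sc continuous_mult])

lemma measurable_mult' [measurable (raw)]:
  "f \<in> measurable M borelG \<Longrightarrow> g \<in> measurable M borelG \<Longrightarrow> (\<lambda>x. f x \<otimes> g x) \<in> measurable M borelG"
  using measurable_compose[OF measurable_Pair measurable_mult, of f M g] by simp

lemma measurable_inv [measurable]: "(\<lambda>x. inv x) \<in> measurable borelG borelG"
  by (rule continuous_map_measurable[OF continuous_inv])

lemma continuous_mult_left:
  assumes "a \<in> carrier G"
  shows "continuous_map T T (\<lambda>x. a \<otimes> x)"
proof -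
  have "continuous_map T (prod_topology T T) (\<lambda>x. (a, x))"
    using assms by (intro continuous_map_pairedI) (auto simp: topspace_eq)
  from continuous_map_compose[OF this continuous_mult] show ?thesis by (simp add: o_def)
qed

lemma continuous_mult_right:
  assumes "a \<in> carrier G"
  shows "continuous_map T T (\<lambda>x. x \<otimes> a)"
proof -
  have "continuous_map T (prod_topology T T) (\<lambda>x. (x, a))"
    using assms by (intro continuous_map_pairedI) (auto simp: topspace_eq)
  from continuous_map_compose[OF this continuous_mult] show ?thesis by (simp add: o_def)
qed

lemma compactin_set_mult:
  assumes "compactin T A" "compactin T B"
  shows "compactin T (A <#> B)"
proof -
  have "compactin T ((\<lambda>(x, y). x \<otimes> y) ` (A \<times> B))"
    using assms by (intro image_compactin[OF _ continuous_mult]) (simp add: compactin_Times)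
  moreover have "(\<lambda>(x, y). x \<otimes> y) ` (A \<times> B) = A <#> B"
    by (auto simp: set_mult_def image_iff)
  ultimately show ?thesis by simp
qed

lemma compactin_inv:
  "compactin T A \<Longrightarrow> compactin T ((\<lambda>x. inv x) ` A)"
  by (rule image_compactin[OF _ continuous_inv])

lemma compactin_in_borelG: "compactin T A \<Longrightarrow> A \<in> sets borelG"
  by (intro closedin_in_borel_of compactin_imp_closedin hd)

lemma openin_r_coset:
  assumes "openin T S" "a \<in> carrier G"
  shows "openin T (S #> a)"
proof -
  have "S #> a = {x \<in> topspace T. x \<otimes> inv a \<in> S}"
  proof
    show "S #> a \<subseteq> {x \<in> topspace T. x \<otimes> inv a \<in> S}"
      using assms openin_subset[OF assms(1)] by (auto simp: r_coset_def topspace_eq m_assoc)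
    show "{x \<in> topspace T. x \<otimes> inv a \<in> S} \<subseteq> S #> a"
    proof
      fix x assume x: "x \<in> {x \<in> topspace T. x \<otimes> inv a \<in> S}"
      then have "x = (x \<otimes> inv a) \<otimes> a" using assms by (simp add: topspace_eq m_assoc)
      then show "x \<in> S #> a" using x unfolding r_coset_def by blast
    qed
  qed
  then show ?thesis
    using continuous_mult_right[of "inv a"] assms by (auto simp: continuous_map_def)
qed

text \<open>Closedness of \<open>H\<close> in a Hausdorff space is what passes local compactness on
  to the subspace; the other properties are inherited by restriction.\<close>

lemma lcsc_subgroup:
  assumes "subgroup H G" "closedin T H"
  shows "lcsc_group (G\<lparr>carrier := H\<rparr>) (subtopology T H)"
proof -
  interpret sub: group "G\<lparr>carrier := H\<rparr>" using assms(1) by (rule subgroup_imp_group)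
  have HG: "H \<subseteq> carrier G" using assms(1) by (rule subgroup.subset)
  show ?thesis
  proof
    show "topspace (subtopology T H) = carrier (G\<lparr>carrier := H\<rparr>)"
      using HG by (auto simp: topspace_eq)
    have "continuous_map (subtopology (prod_topology T T) (H \<times> H)) T (\<lambda>(x, y). x \<otimes> y)"
      using continuous_mult by (rule continuous_map_from_subtopology)
    then show "continuous_map (prod_topology (subtopology T H) (subtopology T H)) (subtopology T H)
        (\<lambda>(x, y). x \<otimes>\<^bsub>G\<lparr>carrier := H\<rparr>\<^esub> y)"
      using assms(1)
      by (auto simp: continuous_map_in_subtopology subtopology_Times[symmetric] subgroup.m_closed)
    have "continuous_map (subtopology T H) T (\<lambda>x. inv x)"
      using continuous_inv by (rule continuous_map_from_subtopology)
    then have "continuous_map (subtopology T H) (subtopology T H) (\<lambda>x. inv x)"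
      using assms(1) by (auto simp: continuous_map_in_subtopology subgroup.m_inv_closed)
    then show "continuous_map (subtopology T H) (subtopology T H)
        (\<lambda>x. inv\<^bsub>G\<lparr>carrier := H\<rparr>\<^esub> x)"
      by (rule continuous_map_eq) (use assms(1) in \<open>auto simp: m_inv_consistent\<close>)
    show "second_countable (subtopology T H)" using sc by (rule second_countable_subtopology)
    show "locally_compact_space (subtopology T H)"
      using lc assms(2) hd by (intro locally_compact_space_closed_subset) auto
    show "Hausdorff_space (subtopology T H)" using hd by (rule Hausdorff_space_subtopology)
  qed
qed

end

section \<open>Haar measure and the modular function\<close>

lemma sigma_finite_measureI_cover:
  fixes C :: "nat \<Rightarrow> 'a set"
  assumes "\<And>n. C n \<in> sets M" "(\<Union>n. C n) = space M" "\<And>n. emeasure M (C n) \<noteq> \<infinity>"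
  shows "sigma_finite_measure M"
  by (rule sigma_finite_measure.intro, rule exI[of _ "range C"]) (use assms in auto)

lemma (in group) r_coset_eq_vimage:
  assumes "E \<subseteq> carrier G" "y \<in> carrier G"
  shows "E #> y = {x \<in> carrier G. x \<otimes> inv y \<in> E}"
proof
  show "E #> y \<subseteq> {x \<in> carrier G. x \<otimes> inv y \<in> E}"
    using assms by (auto simp: r_coset_def m_assoc subset_eq)
  show "{x \<in> carrier G. x \<otimes> inv y \<in> E} \<subseteq> E #> y"
  proof
    fix x assume x: "x \<in> {x \<in> carrier G. x \<otimes> inv y \<in> E}"
    then have "x = (x \<otimes> inv y) \<otimes> y" using assms by (simp add: m_assoc)
    then show "x \<in> E #> y" using x unfolding r_coset_def by blast
  qed
qed

lemma (in group) translate_eq_vimage: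
  assumes "E \<subseteq> carrier G" "a \<in> carrier G"
  shows "(\<lambda>x. a \<otimes> x) ` E = {x \<in> carrier G. inv a \<otimes> x \<in> E}"
proof
  show "(\<lambda>x. a \<otimes> x) ` E \<subseteq> {x \<in> carrier G. inv a \<otimes> x \<in> E}"
    using assms by (auto simp: m_assoc[symmetric] subset_eq)
  show "{x \<in> carrier G. inv a \<otimes> x \<in> E} \<subseteq> (\<lambda>x. a \<otimes> x) ` E"
  proof
    fix x assume x: "x \<in> {x \<in> carrier G. inv a \<otimes> x \<in> E}"
    then have "x = a \<otimes> (inv a \<otimes> x)" using assms by (simp add: m_assoc[symmetric])
    then show "x \<in> (\<lambda>x. a \<otimes> x) ` E" using x by blast
  qed
qed

text \<open>A value above 1 would have unbounded powers, so \<open>f\<close> is at most 1 on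
  \<open>K\<close>; then \<open>f x * f (inv x) = 1\<close> leaves only the value 1. This serves for
  the modulus on a compact subgroup and for the multiplier on \<open>G\<^sub>0\<close>.\<close>

lemma (in group) bounded_multiplicative_eq_1:
  fixes f :: "'a \<Rightarrow> real"
  assumes K: "subgroup K G"
    and pos: "\<And>x. x \<in> K \<Longrightarrow> 0 < f x"
    and mult: "\<And>x y. x \<in> K \<Longrightarrow> y \<in> K \<Longrightarrow> f (x \<otimes> y) = f x * f y"
    and bdd: "\<And>x. x \<in> K \<Longrightarrow> f x \<le> M"
    and x: "x \<in> K"
  shows "f x = 1"
proof -
  have one: "f \<one> = 1"
  proof -
    have "f \<one> * f \<one> = f \<one>" using mult[of \<one> \<one>] subgroup.one_closed[OF K] by simp
    then show ?thesis using pos[OF subgroup.one_closed[OF K]] by simp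
  qed
  have le1: "f y \<le> 1" if y: "y \<in> K" for y
  proof (rule ccontr)
    assume "\<not> f y \<le> 1"
    then obtain n where n: "M < f y ^ n" using real_arch_pow[of "f y" M] by auto
    have "y [^] k \<in> K \<and> f (y [^] k) = f y ^ k" for k :: nat
      by (induction k) (use y K one mult in \<open>auto simp: subgroup.m_closed subgroup.one_closed\<close>)
    then show False using bdd[of "y [^] n"] n by auto
  qed
  have "f x * f (inv x) = 1"
    using mult[of x "inv x"] x one K by (simp add: subgroup.m_inv_closed subgroup.mem_carrier[OF K])
  moreover have "f (inv x) \<le> 1" "f x \<le> 1" "0 < f x"
    using le1 x K pos by (auto simp: subgroup.m_inv_closed)
  moreover from this have "f x * f (inv x) \<le> f x * 1" by (intro mult_left_mono) auto
  ultimately show ?thesis by simp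
qed

context lcsc_group
begin

lemma measurable_mult_left: "a \<in> carrier G \<Longrightarrow> (\<lambda>x. a \<otimes> x) \<in> measurable borelG borelG"
  by (rule continuous_map_measurable[OF continuous_mult_left])

lemma measurable_mult_right: "a \<in> carrier G \<Longrightarrow> (\<lambda>x. x \<otimes> a) \<in> measurable borelG borelG"
  by (rule continuous_map_measurable[OF continuous_mult_right])

lemma borelG_subset: "E \<in> sets borelG \<Longrightarrow> E \<subseteq> carrier G"
  using sets.sets_into_space[of E borelG] by simp

lemma r_coset_in_borelG:
  assumes "E \<in> sets borelG" "y \<in> carrier G"
  shows "E #> y \<in> sets borelG"
proof -
  have "(\<lambda>x. x \<otimes> inv y) -` E \<inter> space borelG \<in> sets borelG"
    using assms by (intro measurable_sets[OF measurable_mult_right]) auto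
  also have "(\<lambda>x. x \<otimes> inv y) -` E \<inter> space borelG = E #> y"
    using assms by (auto simp: r_coset_eq_vimage borelG_subset)
  finally show ?thesis .
qed

lemma sigma_finite_borelG:
  assumes "sets \<mu> = sets borelG" "\<And>C. compactin T C \<Longrightarrow> emeasure \<mu> C < \<infinity>"
  shows "sigma_finite_measure \<mu>"
proof -
  obtain C :: "nat \<Rightarrow> 'a set" where C: "\<And>n. compactin T (C n)" "(\<Union>n. C n) = topspace T"
    using sigma_compact[OF sc lc] by metis
  show ?thesis
    using C assms compactin_in_borelG sets_eq_imp_space_eq[OF assms(1)]
    by (intro sigma_finite_measureI_cover[of C]) (auto simp: less_top topspace_eq)
qed

section \<open>Integration against a fixed left Haar measure\<close>

context
  fixes \<mu> :: "'a measure"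
  assumes haar: "left_haar_measure G T \<mu>"
begin

lemma haar_sets: "sets \<mu> = sets borelG"
  using haar unfolding left_haar_measure_def invariant_measure_def by auto

lemma haar_space [simp]: "space \<mu> = carrier G"
  using sets_eq_imp_space_eq[OF haar_sets] by simp

lemma haar_compact: "compactin T C \<Longrightarrow> emeasure \<mu> C < \<infinity>"
  using haar unfolding left_haar_measure_def invariant_measure_def by auto

lemma haar_nonzero: "emeasure \<mu> (carrier G) \<noteq> 0"
  using haar unfolding left_haar_measure_def invariant_measure_def by auto

lemma haar_sigma_finite: "sigma_finite_measure \<mu>"
  by (rule sigma_finite_borelG[OF haar_sets haar_compact])

text \<open>Invariance is given for images of sets; since an image under a translation is a preimage
  under the inverse translation, the measure equals its own image measure.\<close>

lemma haar_nn_integral_left: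
  assumes "a \<in> carrier G" and [measurable]: "f \<in> borel_measurable borelG"
  shows "(\<integral>\<^sup>+x. f (a \<otimes> x) \<partial>\<mu>) = (\<integral>\<^sup>+x. f x \<partial>\<mu>)"
proof -
  note [measurable_cong] = haar_sets
  note [measurable] = measurable_mult_left[OF assms(1)]
  have "distr \<mu> borelG (\<lambda>x. a \<otimes> x) = \<mu>"
  proof (rule measure_eqI)
    fix A assume "A \<in> sets (distr \<mu> borelG (\<lambda>x. a \<otimes> x))"
    then have A: "A \<in> sets borelG" by simp
    have "emeasure (distr \<mu> borelG (\<lambda>x. a \<otimes> x)) A = emeasure \<mu> ((\<lambda>x. a \<otimes> x) -` A \<inter> carrier G)"
      using A by (subst emeasure_distr) auto
    also have "(\<lambda>x. a \<otimes> x) -` A \<inter> carrier G = (\<lambda>x. inv a \<otimes> x) ` A"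
      using assms(1) borelG_subset[OF A] by (subst translate_eq_vimage) auto
    also have "emeasure \<mu> \<dots> = emeasure \<mu> A"
      using haar A assms(1) haar_sets unfolding left_haar_measure_def invariant_measure_def by auto
    finally show "emeasure (distr \<mu> borelG (\<lambda>x. a \<otimes> x)) A = emeasure \<mu> A" .
  qed (simp add: haar_sets)
  then have "(\<integral>\<^sup>+x. f x \<partial>\<mu>) = (\<integral>\<^sup>+x. f x \<partial>distr \<mu> borelG (\<lambda>x. a \<otimes> x))" by simp
  also have "\<dots> = (\<integral>\<^sup>+x. f (a \<otimes> x) \<partial>\<mu>)" by (rule nn_integral_distr) measurable
  finally show ?thesis by simp
qed

lemma haar_compact_pos:
  obtains C where "compactin T C" "C \<in> sets borelG" "0 < emeasure \<mu> C" "emeasure \<mu> C < \<infinity>"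
proof -
  obtain C :: "nat \<Rightarrow> 'a set" where C: "\<And>n. compactin T (C n)" "(\<Union>n. C n) = topspace T"
    using sigma_compact[OF sc lc] by metis
  have "\<exists>n. emeasure \<mu> (C n) \<noteq> 0"
  proof (rule ccontr)
    assume "\<not> ?thesis"
    then have "emeasure \<mu> (\<Union>n. C n) = 0"
      using C compactin_in_borelG haar_sets by (intro emeasure_UN_eq_0) auto
    then show False using C haar_nonzero by (simp add: topspace_eq)
  qed
  then show thesis using that C compactin_in_borelG haar_compact by (metis not_gr_zero)
qed

lemma haar_emeasure_r_coset:
  assumes "E \<in> sets borelG" "y \<in> carrier G"
  shows "emeasure \<mu> (E #> y) = (\<integral>\<^sup>+x. indicator E (x \<otimes> inv y) \<partial>\<mu>)"
proof -
  have "(\<integral>\<^sup>+x. indicator E (x \<otimes> inv y) \<partial>\<mu>) = (\<integral>\<^sup>+x. indicator (E #> y) x \<partial>\<mu>)"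
    using assms borelG_subset
    by (intro nn_integral_cong) (auto simp: r_coset_eq_vimage indicator_def)
  also have "\<dots> = emeasure \<mu> (E #> y)"
    using r_coset_in_borelG[OF assms] by (simp add: haar_sets)
  finally show ?thesis by simp
qed

lemma haar_r_coset_measurable [measurable]:
  assumes [measurable]: "E \<in> sets borelG"
  shows "(\<lambda>y. emeasure \<mu> (E #> y)) \<in> borel_measurable borelG"
proof -
  note [measurable_cong] = haar_sets
  interpret sigma_finite_measure \<mu> by (rule haar_sigma_finite)
  have "(\<lambda>y. \<integral>\<^sup>+x. indicator E (x \<otimes> inv y) \<partial>\<mu>) \<in> borel_measurable borelG"
    by measurable
  then show ?thesis
    by (rule measurable_cong[THEN iffD1, rotated]) (simp add: haar_emeasure_r_coset assms)
qed

text \<open>Integrate \<open>f (y \<otimes> x) * g y\<close> over the product. For fixed y, left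
  invariance of \<open>\<mu>\<close> removes y from \<open>f\<close>; for fixed x, right invariance
  of \<open>\<rho>\<close> moves x from \<open>f\<close> over to \<open>g\<close>. Uniqueness of
  Haar measure and the inversion formula both come from this exchange.\<close>

lemma haar_right_invariant_swap:
  assumes \<rho> [measurable_cong]: "sets \<rho> = sets borelG" and "sigma_finite_measure \<rho>"
    and inv_\<rho>: "\<And>a h. a \<in> carrier G \<Longrightarrow> h \<in> borel_measurable borelG \<Longrightarrow>
        (\<integral>\<^sup>+x. h (x \<otimes> a) \<partial>\<rho>) = (\<integral>\<^sup>+x. h x \<partial>\<rho>)"
    and [measurable]: "f \<in> borel_measurable borelG" "g \<in> borel_measurable borelG"
  shows "(\<integral>\<^sup>+x. f x \<partial>\<mu>) * (\<integral>\<^sup>+y. g y \<partial>\<rho>) =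
    (\<integral>\<^sup>+y. f y * (\<integral>\<^sup>+x. g (y \<otimes> inv x) \<partial>\<mu>) \<partial>\<rho>)"
proof -
  note [measurable_cong] = haar_sets
  interpret M: sigma_finite_measure \<mu> by (rule haar_sigma_finite)
  interpret R: sigma_finite_measure \<rho> by fact
  interpret P: pair_sigma_finite \<mu> \<rho> ..
  have sp: "space \<rho> = carrier G" using sets_eq_imp_space_eq[OF \<rho>] by simp
  have "(\<integral>\<^sup>+x. f x \<partial>\<mu>) * (\<integral>\<^sup>+y. g y \<partial>\<rho>) = (\<integral>\<^sup>+y. (\<integral>\<^sup>+x. f x \<partial>\<mu>) * g y \<partial>\<rho>)"
    by (rule nn_integral_cmult[symmetric]) measurable
  also have "\<dots> = (\<integral>\<^sup>+y. (\<integral>\<^sup>+x. f (y \<otimes> x) * g y \<partial>\<mu>) \<partial>\<rho>)"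
  proof (rule nn_integral_cong)
    fix y assume "y \<in> space \<rho>"
    then have y: "y \<in> carrier G" by (simp add: sp)
    note [measurable] = measurable_mult_left[OF y]
    have "(\<integral>\<^sup>+x. f (y \<otimes> x) * g y \<partial>\<mu>) = (\<integral>\<^sup>+x. f (y \<otimes> x) \<partial>\<mu>) * g y"
      by (rule nn_integral_multc) measurable
    then show "(\<integral>\<^sup>+x. f x \<partial>\<mu>) * g y = (\<integral>\<^sup>+x. f (y \<otimes> x) * g y \<partial>\<mu>)"
      by (simp add: haar_nn_integral_left y)
  qed
  also have "\<dots> = (\<integral>\<^sup>+x. (\<integral>\<^sup>+y. f (y \<otimes> x) * g y \<partial>\<rho>) \<partial>\<mu>)"
    by (rule P.Fubini') measurable
  also have "\<dots> = (\<integral>\<^sup>+x. (\<integral>\<^sup>+y. f y * g (y \<otimes> inv x) \<partial>\<rho>) \<partial>\<mu>)"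
  proof (rule nn_integral_cong)
    fix x assume "x \<in> space \<mu>"
    then have x: "x \<in> carrier G" by simp
    then have "inv x \<in> carrier G" by simp
    note [measurable] = measurable_mult_right[OF this]
    have "(\<integral>\<^sup>+y. f y * g (y \<otimes> inv x) \<partial>\<rho>) = (\<integral>\<^sup>+y. f (y \<otimes> x) * g ((y \<otimes> x) \<otimes> inv x) \<partial>\<rho>)"
      by (rule inv_\<rho>[symmetric, OF x]) measurable
    also have "\<dots> = (\<integral>\<^sup>+y. f (y \<otimes> x) * g y \<partial>\<rho>)"
      using x by (intro nn_integral_cong) (simp add: sp m_assoc)
    finally show "(\<integral>\<^sup>+y. f (y \<otimes> x) * g y \<partial>\<rho>) = (\<integral>\<^sup>+y. f y * g (y \<otimes> inv x) \<partial>\<rho>)" ..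
  qed
  also have "\<dots> = (\<integral>\<^sup>+y. (\<integral>\<^sup>+x. f y * g (y \<otimes> inv x) \<partial>\<mu>) \<partial>\<rho>)"
    by (rule P.Fubini'[symmetric]) measurable
  also have "\<dots> = (\<integral>\<^sup>+y. f y * (\<integral>\<^sup>+x. g (y \<otimes> inv x) \<partial>\<mu>) \<partial>\<rho>)"
  proof (rule nn_integral_cong)
    fix y assume "y \<in> space \<rho>"
    then have y: "y \<in> carrier G" by (simp add: sp)
    note [measurable] = measurable_mult_left[OF y]
    show "(\<integral>\<^sup>+x. f y * g (y \<otimes> inv x) \<partial>\<mu>) = f y * (\<integral>\<^sup>+x. g (y \<otimes> inv x) \<partial>\<mu>)"
      by (rule nn_integral_cmult) measurable
  qed
  finally show ?thesis .
qed

text \<open>Inversion exchanges the two sides: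
  \<open>inv x \<otimes> a = inv (inv a \<otimes> x)\<close>, so left invariance of
  \<open>\<mu>\<close> becomes right invariance of its image.\<close>

lemma haar_inverse_right_invariant:
  assumes a: "a \<in> carrier G" and [measurable]: "h \<in> borel_measurable borelG"
  shows "(\<integral>\<^sup>+x. h (x \<otimes> a) \<partial>distr \<mu> borelG (\<lambda>x. inv x)) = (\<integral>\<^sup>+x. h x \<partial>distr \<mu> borelG (\<lambda>x. inv x))"
proof -
  note [measurable_cong] = haar_sets
  note [measurable] = measurable_mult_right[OF a] measurable_mult_left[of "inv a"]
  have "(\<integral>\<^sup>+x. h (x \<otimes> a) \<partial>distr \<mu> borelG (\<lambda>x. inv x)) = (\<integral>\<^sup>+x. h (inv x \<otimes> a) \<partial>\<mu>)"
    by (rule nn_integral_distr) measurable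
  also have "\<dots> = (\<integral>\<^sup>+x. h (inv (inv a \<otimes> x)) \<partial>\<mu>)"
    using a by (intro nn_integral_cong) (simp add: inv_mult_group)
  also have "\<dots> = (\<integral>\<^sup>+x. h (inv x) \<partial>\<mu>)"
    using a by (intro haar_nn_integral_left) measurable
  also have "\<dots> = (\<integral>\<^sup>+x. h x \<partial>distr \<mu> borelG (\<lambda>x. inv x))"
    by (rule nn_integral_distr[symmetric]) measurable
  finally show ?thesis .
qed

lemma haar_inverse_sigma_finite: "sigma_finite_measure (distr \<mu> borelG (\<lambda>x. inv x))"
proof (rule sigma_finite_borelG)
  note [measurable_cong] = haar_sets
  fix C assume C: "compactin T C"
  have "(\<lambda>x. inv x) -` C \<inter> carrier G = (\<lambda>x. inv x) ` C"
  proof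
    show "(\<lambda>x. inv x) ` C \<subseteq> (\<lambda>x. inv x) -` C \<inter> carrier G"
      using compactin_subset_topspace[OF C] by (auto simp: topspace_eq)
    show "(\<lambda>x. inv x) -` C \<inter> carrier G \<subseteq> (\<lambda>x. inv x) ` C"
    proof
      fix x assume "x \<in> (\<lambda>x. inv x) -` C \<inter> carrier G"
      then have "x = inv (inv x)" "inv x \<in> C" by auto
      then show "x \<in> (\<lambda>x. inv x) ` C" by blast
    qed
  qed
  then show "emeasure (distr \<mu> borelG (\<lambda>x. inv x)) C < \<infinity>"
    using C compactin_in_borelG[OF C] haar_compact[OF compactin_inv[OF C]]
    by (subst emeasure_distr) auto
qed simp

end

text \<open>The exchange with the right invariant image of \<open>\<mu>'\<close> under inversion and
  with g the indicator of the inverse of \<open>E\<close>: the inverse of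
  \<open>y \<otimes> inv x\<close> lies in \<open>E\<close> iff x lies in \<open>E #> y\<close>, so
  the inner integral is the measure of a right translate.\<close>

lemma haar_swap:
  assumes \<mu>: "left_haar_measure G T \<mu>" and \<mu>': "left_haar_measure G T \<mu>'"
    and [measurable]: "f \<in> borel_measurable borelG" "E \<in> sets borelG"
  shows "(\<integral>\<^sup>+x. f x \<partial>\<mu>) * emeasure \<mu>' E =
    (\<integral>\<^sup>+y. f y * emeasure \<mu> (E #> y) \<partial>distr \<mu>' borelG (\<lambda>x. inv x))"
proof -
  note [measurable_cong] = haar_sets[OF \<mu>] haar_sets[OF \<mu>']
  let ?\<rho> = "distr \<mu>' borelG (\<lambda>x. inv x)"
  have "emeasure \<mu>' E = (\<integral>\<^sup>+x. indicator E x \<partial>\<mu>')"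
    by simp
  also have "\<dots> = (\<integral>\<^sup>+x. indicator E (inv (inv x)) \<partial>\<mu>')"
    by (rule nn_integral_cong) (simp add: haar_space[OF \<mu>'])
  also have "\<dots> = (\<integral>\<^sup>+y. indicator E (inv y) \<partial>?\<rho>)"
    by (rule nn_integral_distr[where f="\<lambda>y. indicator E (inv y)", symmetric]) measurable
  finally have "(\<integral>\<^sup>+x. f x \<partial>\<mu>) * emeasure \<mu>' E =
      (\<integral>\<^sup>+x. f x \<partial>\<mu>) * (\<integral>\<^sup>+y. indicator E (inv y) \<partial>?\<rho>)" by simp
  also have "\<dots> = (\<integral>\<^sup>+y. f y * (\<integral>\<^sup>+x. indicator E (inv (y \<otimes> inv x)) \<partial>\<mu>) \<partial>?\<rho>)"
    by (rule haar_right_invariant_swap[OF \<mu> _ haar_inverse_sigma_finite[OF \<mu>']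
          haar_inverse_right_invariant[OF \<mu>']]) auto
  also have "\<dots> = (\<integral>\<^sup>+y. f y * emeasure \<mu> (E #> y) \<partial>?\<rho>)"
    by (auto intro!: nn_integral_cong arg_cong2[where f="(*)"]
        simp: haar_emeasure_r_coset[OF \<mu>] haar_space[OF \<mu>] inv_mult_group)
  finally show ?thesis .
qed

text \<open>The first factor is computed from \<open>\<mu>\<close> alone, so it is the same for
  every left Haar measure \<open>\<nu>\<close>. It arises by choosing f in \<open>haar_swap\<close>
  so that the factor \<open>emeasure \<mu> (E0 #> y)\<close> cancels, which requires that factor to
  be finite and almost everywhere nonzero.\<close>

lemma haar_ratio:
  assumes \<mu>: "left_haar_measure G T \<mu>" and E0: "compactin T E0" "0 < emeasure \<mu> E0"
    and \<nu>: "left_haar_measure G T \<nu>" and B [measurable]: "B \<in> sets borelG"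
  shows "emeasure \<nu> B = (\<integral>\<^sup>+x. indicator B (inv x) / emeasure \<mu> (E0 #> x) \<partial>\<mu>) * emeasure \<nu> E0"
proof -
  note [measurable_cong] = haar_sets[OF \<mu>] haar_sets[OF \<nu>]
  have E0m [measurable]: "E0 \<in> sets borelG" by (rule compactin_in_borelG[OF E0(1)])
  define h where "h y = emeasure \<mu> (E0 #> y)" for y
  have h_meas [measurable]: "h \<in> borel_measurable borelG"
    unfolding h_def by (rule haar_r_coset_measurable[OF \<mu> E0m])
  define N where "N = {y \<in> space borelG. h y = 0}"
  have N [measurable]: "N \<in> sets borelG" unfolding N_def by measurable
  have fin: "h y < \<infinity>" if "y \<in> carrier G" for y
  proof -
    have "E0 #> y = E0 <#> {y}" by (auto simp: r_coset_def set_mult_def)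
    then have "compactin T (E0 #> y)" using compactin_set_mult[OF E0(1)] that by simp
    then show ?thesis unfolding h_def by (rule haar_compact[OF \<mu>])
  qed
  let ?\<rho> = "\<lambda>\<kappa>. distr \<kappa> borelG (\<lambda>x. inv x)"
  \<comment> \<open>On \<open>N\<close> the factor \<open>h\<close> vanishes, so the exchange with f
    the indicator of \<open>N\<close> forces \<open>N\<close> to be a null set of
    \<open>\<mu>\<close>.\<close>
  have "emeasure \<mu> N * emeasure \<mu> E0 = (\<integral>\<^sup>+x. indicator N x \<partial>\<mu>) * emeasure \<mu> E0" by simp
  also have "\<dots> = (\<integral>\<^sup>+y. indicator N y * h y \<partial>?\<rho> \<mu>)"
    unfolding h_def by (rule haar_swap[OF \<mu> \<mu>]) measurable
  also have "\<dots> = (\<integral>\<^sup>+y. 0 \<partial>?\<rho> \<mu>)"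
    by (rule nn_integral_cong) (auto simp: N_def indicator_def)
  finally have N0: "emeasure \<mu> N = 0" using E0(2) by (simp add: zero_less_iff_neq_zero)
  have whole: "carrier G \<in> sets borelG" using sets.top[of borelG] by simp
  \<comment> \<open>The exchange with the whole group as the set carries nullity over from
    \<open>\<mu>\<close> to the inverted \<open>\<nu>\<close>. The total mass of
    \<open>\<nu>\<close> may be infinite; the product with 0 is still 0 in
    \<open>ennreal\<close>.\<close>
  have "emeasure \<mu> (carrier G) * emeasure (?\<rho> \<nu>) N =
      (\<integral>\<^sup>+y. emeasure \<mu> (carrier G) * indicator N y \<partial>?\<rho> \<nu>)"
    by (simp add: nn_integral_cmult_indicator)
  also have "\<dots> = (\<integral>\<^sup>+y. indicator N y * emeasure \<mu> (carrier G #> y) \<partial>?\<rho> \<nu>)"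
  proof (rule nn_integral_cong)
    fix y assume "y \<in> space (?\<rho> \<nu>)"
    then have "carrier G #> y = carrier G" by (auto simp: r_coset_eq_vimage)
    then show "emeasure \<mu> (carrier G) * indicator N y = indicator N y * emeasure \<mu> (carrier G #> y)"
      by (simp add: mult.commute)
  qed
  also have "\<dots> = (\<integral>\<^sup>+x. indicator N x \<partial>\<mu>) * emeasure \<nu> (carrier G)"
    by (rule haar_swap[OF \<mu> \<nu>, symmetric]) (use whole in measurable)
  also have "\<dots> = 0" using N0 by simp
  finally have "emeasure (?\<rho> \<nu>) N = 0" using haar_nonzero[OF \<mu>] by simp
  then have ae: "AE y in ?\<rho> \<nu>. h y \<noteq> 0"
    using N by (intro AE_I[of _ _ N]) (auto simp: N_def)
  have "(\<integral>\<^sup>+x. indicator B (inv x) / h x \<partial>\<mu>) * emeasure \<nu> E0 =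
      (\<integral>\<^sup>+y. indicator B (inv y) / h y * emeasure \<mu> (E0 #> y) \<partial>?\<rho> \<nu>)"
    by (rule haar_swap[OF \<mu> \<nu>]) measurable
  also have "\<dots> = (\<integral>\<^sup>+y. indicator B (inv y) \<partial>?\<rho> \<nu>)"
  proof (rule nn_integral_cong_AE)
    have "AE y in ?\<rho> \<nu>. h y < \<infinity>" by (rule AE_I2) (use fin in simp)
    with ae show "AE y in ?\<rho> \<nu>. indicator B (inv y) / h y * emeasure \<mu> (E0 #> y) =
        (indicator B (inv y) :: ennreal)"
    proof eventually_elim
      fix y assume "h y \<noteq> 0" "h y < \<infinity>"
      then show "indicator B (inv y) / h y * emeasure \<mu> (E0 #> y) = (indicator B (inv y) :: ennreal)"
        unfolding h_def[symmetric] by (simp add: ennreal_divide_times divide_eq_1_ennreal)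
    qed
  qed
  also have "\<dots> = (\<integral>\<^sup>+x. indicator B (inv (inv x)) \<partial>\<nu>)"
    by (rule nn_integral_distr) measurable
  also have "\<dots> = (\<integral>\<^sup>+x. indicator B x \<partial>\<nu>)"
    by (rule nn_integral_cong) (simp add: haar_space[OF \<nu>])
  also have "\<dots> = emeasure \<nu> B" by simp
  finally show ?thesis by (simp add: h_def)
qed

text \<open>By \<open>haar_ratio\<close>, used for \<open>\<nu>\<close> and for \<open>\<mu>\<close>
  itself, both measures of \<open>B\<close> are one and the same multiple \<open>R B\<close> of
  their values on \<open>E0\<close>; dividing eliminates \<open>R B\<close>.\<close>

theorem haar_measure_unique:
  assumes \<mu>: "left_haar_measure G T \<mu>" and \<nu>: "left_haar_measure G T \<nu>"
  obtains c :: real where "0 < c" "\<And>B. B \<in> sets \<nu> \<Longrightarrow> emeasure \<nu> B = ennreal c * emeasure \<mu> B"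
proof -
  obtain E0 where E0: "compactin T E0" "E0 \<in> sets borelG" "0 < emeasure \<mu> E0" "emeasure \<mu> E0 < \<infinity>"
    by (rule haar_compact_pos[OF \<mu>])
  define R where "R B = (\<integral>\<^sup>+x. indicator B (inv x) / emeasure \<mu> (E0 #> x) \<partial>\<mu>)" for B
  have R_nu: "emeasure \<nu> B = R B * emeasure \<nu> E0" and R_mu: "emeasure \<mu> B = R B * emeasure \<mu> E0"
    if "B \<in> sets borelG" for B
    unfolding R_def using haar_ratio[OF \<mu> E0(1) E0(3)] \<mu> \<nu> that by blast+
  have ratio: "emeasure \<nu> B = (emeasure \<nu> E0 / emeasure \<mu> E0) * emeasure \<mu> B" if "B \<in> sets borelG" for B
  proof -
    have "(emeasure \<nu> E0 / emeasure \<mu> E0) * emeasure \<mu> B =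
        (emeasure \<nu> E0 / emeasure \<mu> E0) * emeasure \<mu> E0 * R B"
      using R_mu[OF that] by (simp add: ac_simps)
    also have "\<dots> = emeasure \<nu> E0 * R B"
      using E0 by (simp add: ennreal_divide_times divide_eq_1_ennreal)
    finally show ?thesis using R_nu[OF that] by (simp add: ac_simps)
  qed
  have fin_nu: "emeasure \<nu> E0 < \<infinity>" by (rule haar_compact[OF \<nu> E0(1)])
  \<comment> \<open>Otherwise the ratio formula would make \<open>\<nu>\<close> vanish on the whole
    group.\<close>
  have "emeasure \<nu> E0 \<noteq> 0"
    using ratio[of "space borelG"] haar_nonzero[OF \<nu>] by fastforce
  then obtain a where a: "emeasure \<nu> E0 = ennreal a" "0 < a"
    using fin_nu by (cases "emeasure \<nu> E0") (auto simp: less_le)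
  obtain b where b: "emeasure \<mu> E0 = ennreal b" "0 < b"
    using E0 by (cases "emeasure \<mu> E0") (auto simp: less_le)
  have "emeasure \<nu> B = ennreal (a / b) * emeasure \<mu> B" if "B \<in> sets \<nu>" for B
    using ratio[of B] that haar_sets[OF \<nu>] a b by (simp add: divide_ennreal)
  then show thesis using that[of "a / b"] a b by simp
qed

text \<open>Left and right translations commute, so assigning the measure of \<open>B #> t\<close>
  to \<open>B\<close> is again left invariant. Uniqueness applied to this measure produces the
  modulus.\<close>

lemma left_haar_measure_right_translate:
  assumes \<mu>: "left_haar_measure G T \<mu>" and t: "t \<in> carrier G"
  shows "left_haar_measure G T (distr \<mu> borelG (\<lambda>x. x \<otimes> inv t))"
    and "B \<in> sets borelG \<Longrightarrow> emeasure (distr \<mu> borelG (\<lambda>x. x \<otimes> inv t)) B = emeasure \<mu> (B #> t)"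
proof -
  note [measurable_cong] = haar_sets[OF \<mu>]
  have it: "inv t \<in> carrier G" using t by simp
  note [measurable] = measurable_mult_right[OF it]
  let ?\<nu> = "distr \<mu> borelG (\<lambda>x. x \<otimes> inv t)"
  have em: "emeasure ?\<nu> B = emeasure \<mu> (B #> t)" if B: "B \<in> sets borelG" for B
  proof -
    have "emeasure ?\<nu> B = emeasure \<mu> ((\<lambda>x. x \<otimes> inv t) -` B \<inter> space \<mu>)"
      using B by (intro emeasure_distr) measurable
    also have "(\<lambda>x. x \<otimes> inv t) -` B \<inter> space \<mu> = B #> t"
      using r_coset_eq_vimage[OF borelG_subset[OF B] t] by (auto simp: haar_space[OF \<mu>])
    finally show ?thesis .
  qed
  show "B \<in> sets borelG \<Longrightarrow> emeasure ?\<nu> B = emeasure \<mu> (B #> t)" by (rule em)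
  show "left_haar_measure G T ?\<nu>"
    unfolding left_haar_measure_def invariant_measure_def
  proof (intro conjI ballI allI impI)
    show "sets ?\<nu> = sets borelG" by simp
  next
    fix a B assume a: "a \<in> carrier G" and "B \<in> sets ?\<nu>"
    then have B: "B \<in> sets borelG" by simp
    have "(\<lambda>x. a \<otimes> x) ` B = (\<lambda>x. inv a \<otimes> x) -` B \<inter> space borelG"
      using translate_eq_vimage[OF borelG_subset[OF B] a] by auto
    then have aB: "(\<lambda>x. a \<otimes> x) ` B \<in> sets borelG"
      using measurable_sets[OF measurable_mult_left B, of "inv a"] a by simp
    have "(\<lambda>x. a \<otimes> x) ` B #> t = (\<lambda>x. a \<otimes> x) ` (B #> t)"
      using a t borelG_subset[OF B] by (auto simp: r_coset_def m_assoc subset_eq image_iff)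
    then show "emeasure ?\<nu> ((\<lambda>x. a \<otimes> x) ` B) = emeasure ?\<nu> B"
      using em[OF aB] em[OF B] \<mu> a r_coset_in_borelG[OF B t]
      unfolding left_haar_measure_def invariant_measure_def by simp
  next
    fix K assume K: "compactin T K"
    have "K #> t = K <#> {t}" by (auto simp: r_coset_def set_mult_def)
    then have "compactin T (K #> t)" using compactin_set_mult[OF K] t by simp
    then show "emeasure ?\<nu> K < \<infinity>"
      using em[OF compactin_in_borelG[OF K]] haar_compact[OF \<mu>] by simp
  next
    have "carrier G #> t = carrier G" using t by (auto simp: r_coset_eq_vimage)
    then show "emeasure ?\<nu> (space ?\<nu>) \<noteq> 0"
      using em[OF sets.top] haar_nonzero[OF \<mu>] by simp
  qed
qed

section \<open>The modular function\<close>

context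
  fixes \<mu> :: "'a measure"
  assumes \<mu>: "left_haar_measure G T \<mu>"
begin

text \<open>Uniqueness of Haar measure supplies a scaling constant, and one set of finite positive
  measure determines it; hence the definite description in \<open>right_modulus\<close> denotes
  it.\<close>

lemma right_modulus_props:
  assumes t: "t \<in> carrier G"
  shows right_modulus_pos: "0 < right_modulus G \<mu> t"
    and emeasure_r_coset: "B \<in> sets borelG \<Longrightarrow>
      emeasure \<mu> (B #> t) = ennreal (right_modulus G \<mu> t) * emeasure \<mu> B"
proof -
  let ?P = "\<lambda>c::real. 0 < c \<and> (\<forall>B\<in>sets \<mu>. emeasure \<mu> (B #> t) = ennreal c * emeasure \<mu> B)"
  obtain c where c: "0 < c" "\<And>B. B \<in> sets (distr \<mu> borelG (\<lambda>x. x \<otimes> inv t)) \<Longrightarrow>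
      emeasure (distr \<mu> borelG (\<lambda>x. x \<otimes> inv t)) B = ennreal c * emeasure \<mu> B"
    using haar_measure_unique[OF \<mu> left_haar_measure_right_translate(1)[OF \<mu> t]] by metis
  have Pc: "?P c"
    using c left_haar_measure_right_translate(2)[OF \<mu> t] haar_sets[OF \<mu>] by simp
  obtain E0 where E0: "E0 \<in> sets borelG" "0 < emeasure \<mu> E0" "emeasure \<mu> E0 < \<infinity>"
    using haar_compact_pos[OF \<mu>] by metis
  obtain b where b: "emeasure \<mu> E0 = ennreal b" "0 < b"
    using E0 by (cases "emeasure \<mu> E0") (auto simp: less_le)
  have "d = c" if "?P d" for d
  proof -
    have "ennreal d * ennreal b = ennreal c * ennreal b"
      using that Pc E0(1) b haar_sets[OF \<mu>] by metis
    then have "ennreal (d * b) = ennreal (c * b)"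
      using that c b by (simp add: ennreal_mult)
    then show ?thesis using that c b by (simp add: ennreal_inj)
  qed
  with Pc have "?P (right_modulus G \<mu> t)"
    unfolding right_modulus_def by (rule theI)
  then show "0 < right_modulus G \<mu> t" "B \<in> sets borelG \<Longrightarrow>
      emeasure \<mu> (B #> t) = ennreal (right_modulus G \<mu> t) * emeasure \<mu> B"
    by (auto simp: haar_sets[OF \<mu>])
qed

lemma right_modulus_mult:
  assumes s: "s \<in> carrier G" and t: "t \<in> carrier G"
  shows "right_modulus G \<mu> (s \<otimes> t) = right_modulus G \<mu> s * right_modulus G \<mu> t"
proof -
  obtain E0 where E0: "E0 \<in> sets borelG" "0 < emeasure \<mu> E0" "emeasure \<mu> E0 < \<infinity>"
    using haar_compact_pos[OF \<mu>] by metis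
  obtain b where b: "emeasure \<mu> E0 = ennreal b" "0 < b"
    using E0 by (cases "emeasure \<mu> E0") (auto simp: less_le)
  note pos = right_modulus_pos[OF s] right_modulus_pos[OF t] right_modulus_pos[of "s \<otimes> t"]
  have "E0 #> (s \<otimes> t) = (E0 #> s) #> t"
    using s t borelG_subset[OF E0(1)] by (simp add: coset_mult_assoc)
  then have "ennreal (right_modulus G \<mu> (s \<otimes> t)) * ennreal b =
      ennreal (right_modulus G \<mu> t) * (ennreal (right_modulus G \<mu> s) * ennreal b)"
    using s t E0(1) b r_coset_in_borelG emeasure_r_coset by (metis m_closed)
  then have "ennreal (right_modulus G \<mu> (s \<otimes> t) * b) =
      ennreal (right_modulus G \<mu> t * (right_modulus G \<mu> s * b))"
    using pos s t b by (simp add: ennreal_mult)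
  then show ?thesis using pos s t b by (simp add: ennreal_inj)
qed

lemma right_modulus_one: "right_modulus G \<mu> \<one> = 1"
  using right_modulus_mult[of \<one> \<one>] right_modulus_pos[of \<one>] by simp

lemma right_modulus_inv:
  assumes "t \<in> carrier G"
  shows "right_modulus G \<mu> (inv t) = inverse (right_modulus G \<mu> t)"
  using right_modulus_mult[of t "inv t"] right_modulus_one right_modulus_pos[of t] assms
  by (simp add: field_simps)

text \<open>For t in \<open>C\<close> the translate \<open>E0 #> t\<close> lies in the compact set
  \<open>E0 <#> C\<close>, so the modulus is at most the quotient of the two measures.\<close>

lemma right_modulus_bounded:
  assumes C: "compactin T C"
  obtains M where "\<And>t. t \<in> C \<Longrightarrow> right_modulus G \<mu> t \<le> M"
proof -
  obtain E0 where E0: "compactin T E0" "E0 \<in> sets borelG" "0 < emeasure \<mu> E0" "emeasure \<mu> E0 < \<infinity>"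
    by (rule haar_compact_pos[OF \<mu>])
  obtain b where b: "emeasure \<mu> E0 = ennreal b" "0 < b"
    using E0 by (cases "emeasure \<mu> E0") (auto simp: less_le)
  have EC: "compactin T (E0 <#> C)" by (rule compactin_set_mult[OF E0(1) C])
  then obtain d where d: "emeasure \<mu> (E0 <#> C) = ennreal d" "0 \<le> d"
    using haar_compact[OF \<mu> EC] by (cases "emeasure \<mu> (E0 <#> C)") auto
  have "right_modulus G \<mu> t \<le> d / b" if t: "t \<in> C" for t
  proof -
    have tG: "t \<in> carrier G" using t compactin_subset_topspace[OF C] by auto
    have "E0 #> t \<subseteq> E0 <#> C" using t by (auto simp: r_coset_def set_mult_def)
    then have "emeasure \<mu> (E0 #> t) \<le> emeasure \<mu> (E0 <#> C)"
      using compactin_in_borelG[OF EC] haar_sets[OF \<mu>] by (intro emeasure_mono) auto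
    then have "ennreal (right_modulus G \<mu> t * b) \<le> ennreal d"
      using emeasure_r_coset[OF tG E0(2)] b d right_modulus_pos[OF tG] by (simp add: ennreal_mult)
    then show ?thesis using b d by (simp add: field_simps)
  qed
  then show thesis by (rule that)
qed

lemma right_modulus_compact_subgroup:
  assumes K: "subgroup K G" "compactin T K" and "x \<in> K"
  shows "right_modulus G \<mu> x = 1"
proof -
  obtain M where "\<And>t. t \<in> K \<Longrightarrow> right_modulus G \<mu> t \<le> M"
    using right_modulus_bounded[OF K(2)] by metis
  then show ?thesis
    using right_modulus_pos right_modulus_mult subgroup.mem_carrier[OF K(1)] \<open>x \<in> K\<close>
    by (intro bounded_multiplicative_eq_1[OF K(1)]) auto
qed

text \<open>The modulus is \<open>emeasure \<mu> (E0 #> y)\<close> divided by a constant, and that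
  measure is an integral depending measurably on y.\<close>

lemma right_modulus_measurable: "right_modulus G \<mu> \<in> borel_measurable borelG"
proof -
  obtain E0 where E0 [measurable]: "E0 \<in> sets borelG" and E0': "0 < emeasure \<mu> E0" "emeasure \<mu> E0 < \<infinity>"
    using haar_compact_pos[OF \<mu>] by metis
  obtain b where b: "emeasure \<mu> E0 = ennreal b" "0 < b"
    using E0' by (cases "emeasure \<mu> E0") (auto simp: less_le)
  note [measurable] = haar_r_coset_measurable[OF \<mu>]
  have "(\<lambda>y. enn2real (emeasure \<mu> (E0 #> y)) / b) \<in> borel_measurable borelG" by measurable
  moreover have "enn2real (emeasure \<mu> (E0 #> y)) / b = right_modulus G \<mu> y" if "y \<in> carrier G" for y
    using that E0 b right_modulus_pos[OF that] emeasure_r_coset[OF that E0]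
    by (simp add: enn2real_mult)
  ultimately show ?thesis
    by (subst measurable_cong[where g="\<lambda>y. enn2real (emeasure \<mu> (E0 #> y)) / b"]) auto
qed

text \<open>The image of \<open>\<mu>\<close> under right multiplication by t gives \<open>B\<close>
  the measure of \<open>B #> inv t\<close>; this is why the inverse of the modulus appears.\<close>

lemma haar_nn_integral_right:
  assumes t: "t \<in> carrier G" and [measurable]: "f \<in> borel_measurable borelG"
  shows "(\<integral>\<^sup>+x. f (x \<otimes> t) \<partial>\<mu>) = ennreal (inverse (right_modulus G \<mu> t)) * (\<integral>\<^sup>+x. f x \<partial>\<mu>)"
proof -
  note [measurable_cong] = haar_sets[OF \<mu>]
  note [measurable] = measurable_mult_right[OF t]
  have it: "inv t \<in> carrier G" using t by simp
  have "distr \<mu> borelG (\<lambda>x. x \<otimes> t) = scale_measure (ennreal (right_modulus G \<mu> (inv t))) \<mu>"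
  proof (rule measure_eqI)
    fix B assume "B \<in> sets (distr \<mu> borelG (\<lambda>x. x \<otimes> t))"
    then have B: "B \<in> sets borelG" by simp
    show "emeasure (distr \<mu> borelG (\<lambda>x. x \<otimes> t)) B =
        emeasure (scale_measure (ennreal (right_modulus G \<mu> (inv t))) \<mu>) B"
      using left_haar_measure_right_translate(2)[OF \<mu> it B] emeasure_r_coset[OF it B] t by simp
  qed (simp add: haar_sets[OF \<mu>])
  then have "(\<integral>\<^sup>+x. f x \<partial>distr \<mu> borelG (\<lambda>x. x \<otimes> t)) =
      ennreal (right_modulus G \<mu> (inv t)) * (\<integral>\<^sup>+x. f x \<partial>\<mu>)"
    by (simp add: nn_integral_scale_measure)
  moreover have "(\<integral>\<^sup>+x. f x \<partial>distr \<mu> borelG (\<lambda>x. x \<otimes> t)) = (\<integral>\<^sup>+x. f (x \<otimes> t) \<partial>\<mu>)"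
    by (rule nn_integral_distr) measurable
  ultimately show ?thesis using right_modulus_inv[OF t] by simp
qed

text \<open>In \<open>haar_swap\<close> the translate of \<open>E0\<close> contributes the modulus
  at y; weighting f by the inverse modulus beforehand cancels it, and the common finite positive
  factor is divided out.\<close>

lemma haar_nn_integral_inverse:
  assumes [measurable]: "f \<in> borel_measurable borelG"
  shows "(\<integral>\<^sup>+x. f (inv x) \<partial>\<mu>) = (\<integral>\<^sup>+x. f x * ennreal (inverse (right_modulus G \<mu> x)) \<partial>\<mu>)"
proof -
  note [measurable_cong] = haar_sets[OF \<mu>]
  note [measurable] = right_modulus_measurable
  let ?\<Delta> = "right_modulus G \<mu>"
  obtain E0 where E0 [measurable]: "E0 \<in> sets borelG" and E0': "0 < emeasure \<mu> E0" "emeasure \<mu> E0 < \<infinity>"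
    using haar_compact_pos[OF \<mu>] by metis
  let ?\<rho> = "distr \<mu> borelG (\<lambda>x. inv x)"
  have "(\<integral>\<^sup>+x. f x * ennreal (inverse (?\<Delta> x)) \<partial>\<mu>) * emeasure \<mu> E0 =
      (\<integral>\<^sup>+y. f y * ennreal (inverse (?\<Delta> y)) * emeasure \<mu> (E0 #> y) \<partial>?\<rho>)"
    by (rule haar_swap[OF \<mu> \<mu>]) measurable
  also have "\<dots> = (\<integral>\<^sup>+y. f y * emeasure \<mu> E0 \<partial>?\<rho>)"
  proof (rule nn_integral_cong)
    fix y assume "y \<in> space ?\<rho>"
    then have y: "y \<in> carrier G" by simp
    have "ennreal (inverse (?\<Delta> y)) * ennreal (?\<Delta> y) = 1"
      using right_modulus_pos[OF y] by (simp add: ennreal_mult[symmetric])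
    then show "f y * ennreal (inverse (?\<Delta> y)) * emeasure \<mu> (E0 #> y) = f y * emeasure \<mu> E0"
      using emeasure_r_coset[OF y E0] by (metis mult.assoc mult.left_neutral)
  qed
  also have "\<dots> = (\<integral>\<^sup>+y. f y \<partial>?\<rho>) * emeasure \<mu> E0" by (rule nn_integral_multc) measurable
  also have "(\<integral>\<^sup>+y. f y \<partial>?\<rho>) = (\<integral>\<^sup>+x. f (inv x) \<partial>\<mu>)" by (rule nn_integral_distr) measurable
  finally show ?thesis
    using E0' by (auto simp: zero_less_iff_neq_zero mult.commute[of _ "emeasure \<mu> E0"] ennreal_mult_cancel_left)
qed

end

end

section \<open>Coset spaces of compact subgroups\<close>

locale compact_coset_space = lcsc_group +
  fixes K
  assumes subgroup_K: "subgroup K G" and compact_K: "compactin T K"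
begin

abbreviation "Q \<equiv> coset_space G T K"

lemma K_subset: "K \<subseteq> carrier G"
  by (rule subgroup.subset[OF subgroup_K])

lemma topspace_Q [simp]: "topspace Q = (\<lambda>g. g <# K) ` carrier G"
  by (simp add: coset_space_def)

lemma openin_Q: "openin Q S \<longleftrightarrow> S \<subseteq> topspace Q \<and> openin T {x \<in> carrier G. x <# K \<in> S}"
  by (simp add: coset_space_def openin_quotient_topology)

lemma continuous_proj: "continuous_map T Q (\<lambda>g. g <# K)"
  unfolding continuous_map_def by (auto simp: openin_Q)

lemma measurable_proj: "(\<lambda>g. g <# K) \<in> measurable borelG (borel_of Q)"
  by (rule continuous_map_measurable[OF continuous_proj])

lemma coset_self: "x \<in> carrier G \<Longrightarrow> x \<in> x <# K"
  using subgroup.one_closed[OF subgroup_K] by (force simp: l_coset_def)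

lemma coset_eqD:
  assumes "x <# K = y <# K" "x \<in> carrier G" "y \<in> carrier G"
  obtains k where "k \<in> K" "x = y \<otimes> k"
  using coset_self[OF assms(2)] assms(1) by (auto simp: l_coset_def)

lemma coset_mult_K:
  assumes "x \<in> carrier G" "k \<in> K"
  shows "(x \<otimes> k) <# K = x <# K"
  using assms by (intro l_repr_independence[symmetric, OF _ _ subgroup_K]) (auto simp: l_coset_def)

lemma coset_translate:
  "a \<in> carrier G \<Longrightarrow> x \<in> carrier G \<Longrightarrow> a <# (x <# K) = (a \<otimes> x) <# K"
  by (rule lcos_m_assoc[OF K_subset])

text \<open>\<open>C <#> K\<close> is the saturation of \<open>C\<close>. Since \<open>K\<close> is
  compact it stays compact for compact \<open>C\<close>, and this is how sets of cosets are
  controlled from within the group.\<close>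

lemma vimage_proj_image:
  assumes "C \<subseteq> carrier G"
  shows "{x \<in> carrier G. x <# K \<in> (\<lambda>g. g <# K) ` C} = C <#> K"
proof
  show "{x \<in> carrier G. x <# K \<in> (\<lambda>g. g <# K) ` C} \<subseteq> C <#> K"
  proof
    fix x assume "x \<in> {x \<in> carrier G. x <# K \<in> (\<lambda>g. g <# K) ` C}"
    then obtain c where c: "x \<in> carrier G" "c \<in> C" "x <# K = c <# K" by auto
    then obtain k where "k \<in> K" "x = c \<otimes> k" using coset_eqD[OF c(3)] assms by blast
    then show "x \<in> C <#> K" using c(2) by (auto simp: set_mult_def)
  qed
  show "C <#> K \<subseteq> {x \<in> carrier G. x <# K \<in> (\<lambda>g. g <# K) ` C}"
  proof
    fix x assume "x \<in> C <#> K"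
    then obtain c k where ck: "c \<in> C" "k \<in> K" "x = c \<otimes> k" by (auto simp: set_mult_def)
    then have "x \<in> carrier G" "x <# K = c <# K"
      using assms K_subset coset_mult_K[of c k] by auto
    then show "x \<in> {x \<in> carrier G. x <# K \<in> (\<lambda>g. g <# K) ` C}" using ck by auto
  qed
qed

text \<open>The saturation of \<open>S\<close> is a union of right translates of \<open>S\<close>,
  each of them open.\<close>

lemma openin_proj_image:
  assumes "openin T S"
  shows "openin Q ((\<lambda>g. g <# K) ` S)"
proof -
  have S: "S \<subseteq> carrier G" using openin_subset[OF assms] by simp
  have "S <#> K = (\<Union>k\<in>K. S #> k)" by (auto simp: set_mult_def r_coset_def)
  also have "openin T \<dots>"
    using openin_r_coset[OF assms] K_subset by (intro openin_Union) auto
  finally show ?thesis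
    using S by (auto simp: openin_Q vimage_proj_image)
qed

text \<open>The saturation \<open>C <#> K\<close> is compact, hence closed in the Hausdorff space
  \<open>T\<close>, and the quotient topology transfers this to the image.\<close>

lemma closedin_proj_image:
  assumes C: "compactin T C"
  shows "closedin Q ((\<lambda>g. g <# K) ` C)"
proof -
  have CG: "C \<subseteq> carrier G" using compactin_subset_topspace[OF C] by simp
  have "closedin T (C <#> K)"
    using compactin_set_mult[OF C compact_K] hd by (intro compactin_imp_closedin)
  then have "openin T (topspace T - (C <#> K))" by (rule openin_diff[OF openin_topspace])
  also have "topspace T - (C <#> K) =
      {x \<in> carrier G. x <# K \<in> topspace Q - (\<lambda>g. g <# K) ` C}"
    using vimage_proj_image[OF CG] by auto
  finally have "openin Q (topspace Q - (\<lambda>g. g <# K) ` C)"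
    unfolding openin_Q by blast
  moreover have "(\<lambda>g. g <# K) ` C \<subseteq> topspace Q" using CG by auto
  ultimately show ?thesis by (simp add: closedin_def)
qed

lemma compactin_proj_image: "compactin T C \<Longrightarrow> compactin Q ((\<lambda>g. g <# K) ` C)"
  by (rule image_compactin[OF _ continuous_proj])

text \<open>The projections of open sets with compact enclosure form an open cover downstairs; the
  enclosing compact sets of a finite subcover have the required union.\<close>

lemma compact_subset_proj_image:
  assumes S: "compactin Q S"
  obtains C where "compactin T C" "S \<subseteq> (\<lambda>g. g <# K) ` C"
proof -
  define \<U> where "\<U> = {(\<lambda>g. g <# K) ` U |U. openin T U \<and> (\<exists>C. compactin T C \<and> U \<subseteq> C)}"
  have "openin Q W" if "W \<in> \<U>" for W using that openin_proj_image unfolding \<U>_def by auto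
  moreover have "S \<subseteq> \<Union>\<U>"
  proof
    fix s assume "s \<in> S"
    then obtain x where x: "x \<in> topspace T" "s = x <# K"
      using compactin_subset_topspace[OF S] by auto
    then obtain U C where "openin T U" "compactin T C" "x \<in> U" "U \<subseteq> C"
      using lc unfolding locally_compact_space_def by blast
    then have "(\<lambda>g. g <# K) ` U \<in> \<U>" "s \<in> (\<lambda>g. g <# K) ` U"
      unfolding \<U>_def x(2) by auto
    then show "s \<in> \<Union>\<U>" by (rule UnionI)
  qed
  ultimately obtain \<F> where \<F>: "finite \<F>" "\<F> \<subseteq> \<U>" "S \<subseteq> \<Union>\<F>"
    using S unfolding compactin_def by meson
  have "\<exists>C. compactin T C \<and> W \<subseteq> (\<lambda>g. g <# K) ` C" if "W \<in> \<F>" for W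
  proof -
    have "W \<in> \<U>" using \<F>(2) that by blast
    then obtain U C where "W = (\<lambda>g. g <# K) ` U" "compactin T C" "U \<subseteq> C"
      unfolding \<U>_def by auto
    then show ?thesis by (intro exI[of _ C]) auto
  qed
  then obtain c where c: "\<And>W. W \<in> \<F> \<Longrightarrow> compactin T (c W) \<and> W \<subseteq> (\<lambda>g. g <# K) ` c W" by metis
  show thesis
  proof (rule that)
    show "compactin T (\<Union>(c ` \<F>))" using \<F>(1) c by (intro compactin_Union) auto
    show "S \<subseteq> (\<lambda>g. g <# K) ` \<Union>(c ` \<F>)" using \<F>(3) c by blast
  qed
qed

text \<open>The closed preimage is cut by a compact exhaustion of the group. Closed sets of cosets
  thereby acquire compact lifts, which can be multiplied inside the group.\<close>

lemma closedin_Q_sigma_compact: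
  assumes S: "closedin Q S"
  obtains D :: "nat \<Rightarrow> 'a set" where "\<And>n. compactin T (D n)" "S = (\<Union>n. (\<lambda>g. g <# K) ` D n)"
proof -
  obtain C :: "nat \<Rightarrow> 'a set" where C: "\<And>n. compactin T (C n)" "(\<Union>n. C n) = topspace T"
    using sigma_compact[OF sc lc] by metis
  let ?P = "{x \<in> topspace T. x <# K \<in> S}"
  have P: "closedin T ?P" by (rule closedin_continuous_map_preimage[OF continuous_proj S])
  show thesis
  proof (rule that)
    show "compactin T (?P \<inter> C n)" for n by (rule closed_Int_compactin[OF P C(1)])
    have "S \<subseteq> topspace Q" by (rule closedin_subset[OF S])
    then have "S = (\<lambda>g. g <# K) ` (?P \<inter> topspace T)" by auto
    then show "S = (\<Union>n. (\<lambda>g. g <# K) ` (?P \<inter> C n))"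
      unfolding C(2)[symmetric] by (simp only: Int_UN_distrib image_UN)
  qed
qed

lemma sigma_finite_borelQ:
  assumes "sets \<mu> = sets (borel_of Q)" "\<And>C. compactin Q C \<Longrightarrow> emeasure \<mu> C < \<infinity>"
  shows "sigma_finite_measure \<mu>"
proof -
  obtain D :: "nat \<Rightarrow> 'a set" where D: "\<And>n. compactin T (D n)" "topspace Q = (\<Union>n. (\<lambda>g. g <# K) ` D n)"
    using closedin_Q_sigma_compact[OF closedin_topspace] by metis
  show ?thesis
  proof (rule sigma_finite_measureI_cover)
    show "(\<lambda>g. g <# K) ` D n \<in> sets \<mu>" for n
      unfolding assms(1) by (intro closedin_in_borel_of closedin_proj_image D)
    show "(\<Union>n. (\<lambda>g. g <# K) ` D n) = space \<mu>"
      using D(2) sets_eq_imp_space_eq[OF assms(1)] by simp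
    show "emeasure \<mu> ((\<lambda>g. g <# K) ` D n) \<noteq> \<infinity>" for n
      using assms(2)[OF compactin_proj_image[OF D(1)]] by (simp add: less_top)
  qed
qed

lemma continuous_translate_Q:
  assumes a: "a \<in> carrier G"
  shows "continuous_map Q Q (\<lambda>C. a <# C)"
  unfolding continuous_map_def
proof (intro conjI allI impI funcsetI)
  fix C assume "C \<in> topspace Q"
  then show "a <# C \<in> topspace Q" using a by (auto simp: coset_translate)
next
  fix U assume "openin Q U"
  then have "openin T {x \<in> topspace T. x <# K \<in> U}" by (simp add: openin_Q)
  then have "openin T {y \<in> topspace T. a \<otimes> y \<in> {x \<in> topspace T. x <# K \<in> U}}"
    using continuous_mult_left[OF a] by (intro openin_continuous_map_preimage)
  also have "{y \<in> topspace T. a \<otimes> y \<in> {x \<in> topspace T. x <# K \<in> U}} =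
      {x \<in> carrier G. x <# K \<in> {C \<in> topspace Q. a <# C \<in> U}}"
    using a by (auto simp: coset_translate)
  finally show "openin Q {C \<in> topspace Q. a <# C \<in> U}"
    unfolding openin_Q by blast
qed

text \<open>\<open>invariant_measure\<close> speaks of images of Borel sets; writing such an image
  as a preimage under the inverse translation shows that it is Borel.\<close>

lemma translate_image_borelQ:
  assumes a: "a \<in> carrier G" and B: "B \<in> sets (borel_of Q)"
  shows "(\<lambda>C. a <# C) ` B \<in> sets (borel_of Q)"
    and "(\<lambda>C. a <# C) ` B = (\<lambda>C. inv a <# C) -` B \<inter> topspace Q"
proof -
  have sub: "B \<subseteq> topspace Q" using sets.sets_into_space[OF B] by simp
  show eq: "(\<lambda>C. a <# C) ` B = (\<lambda>C. inv a <# C) -` B \<inter> topspace Q"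
  proof
    show "(\<lambda>C. a <# C) ` B \<subseteq> (\<lambda>C. inv a <# C) -` B \<inter> topspace Q"
    proof
      fix D assume "D \<in> (\<lambda>C. a <# C) ` B"
      then obtain x where x: "x \<in> carrier G" "x <# K \<in> B" "D = a <# (x <# K)" using sub by auto
      then have "inv a <# D = x <# K" using a by (simp add: coset_translate m_assoc[symmetric])
      then show "D \<in> (\<lambda>C. inv a <# C) -` B \<inter> topspace Q"
        using x a by (auto simp: coset_translate)
    qed
    show "(\<lambda>C. inv a <# C) -` B \<inter> topspace Q \<subseteq> (\<lambda>C. a <# C) ` B"
    proof
      fix D assume D: "D \<in> (\<lambda>C. inv a <# C) -` B \<inter> topspace Q"
      then obtain x where x: "x \<in> carrier G" "D = x <# K" by auto
      then have "D = a <# (inv a <# D)" using a by (simp add: coset_translate m_assoc[symmetric])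
      then show "D \<in> (\<lambda>C. a <# C) ` B" using D by blast
    qed
  qed
  have "(\<lambda>C. inv a <# C) -` B \<inter> space (borel_of Q) \<in> sets (borel_of Q)"
    by (rule measurable_sets[OF continuous_map_measurable[OF continuous_translate_Q] B]) (use a in simp)
  then show "(\<lambda>C. a <# C) ` B \<in> sets (borel_of Q)" using eq by simp
qed

lemma on_coset_eq:
  assumes "\<And>k. k \<in> K \<Longrightarrow> f (x \<otimes> k) = f x" "x \<in> carrier G"
  shows "on_coset f (x <# K) = f x"
proof -
  have "(SOME g. g \<in> x <# K) \<in> x <# K" using coset_self[OF assms(2)] by (rule someI)
  then show ?thesis using assms(1) by (auto simp: on_coset_def l_coset_def)
qed

lemma continuous_on_coset:
  assumes f: "continuous_map T R f" and eq: "\<And>x k. x \<in> carrier G \<Longrightarrow> k \<in> K \<Longrightarrow> f (x \<otimes> k) = f x"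
  shows "continuous_map Q R (on_coset f)"
  unfolding continuous_map_def
proof (intro conjI allI impI funcsetI)
  fix C assume "C \<in> topspace Q"
  then obtain x where "x \<in> carrier G" "C = x <# K" by auto
  then show "on_coset f C \<in> topspace R"
    using on_coset_eq[of f x] eq f by (auto simp: continuous_map_def)
next
  fix U assume "openin R U"
  then have "openin T {x \<in> topspace T. f x \<in> U}" by (rule openin_continuous_map_preimage[OF f])
  also have "{x \<in> topspace T. f x \<in> U} = {x \<in> carrier G. x <# K \<in> {C \<in> topspace Q. on_coset f C \<in> U}}"
    using on_coset_eq[of f] eq by auto
  finally show "openin Q {C \<in> topspace Q. on_coset f C \<in> U}" unfolding openin_Q by blast
qed

section \<open>Haar measure and its modulus on the coset space\<close>

context
  fixes \<mu> :: "'a measure"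
  assumes \<mu>: "left_haar_measure G T \<mu>"
begin

lemma right_modulus_mult_K:
  assumes "x \<in> carrier G" "k \<in> K"
  shows "right_modulus G \<mu> (x \<otimes> k) = right_modulus G \<mu> x"
  using assms right_modulus_mult[OF \<mu>, of x k] right_modulus_compact_subgroup[OF \<mu> subgroup_K compact_K]
    K_subset by auto

lemma on_coset_right_modulus:
  "x \<in> carrier G \<Longrightarrow> on_coset (right_modulus G \<mu>) (x <# K) = right_modulus G \<mu> x"
  by (rule on_coset_eq) (auto intro: right_modulus_mult_K)

text \<open>On \<open>g K\<close> the modulus is read off from \<open>\<mu> {x. x g \<in> E}\<close>, where \<open>E = E K\<close> is compact: the
  condition on \<open>x\<close> depends on the coset only and defines a closed subset of the product space.\<close>

lemma on_coset_right_modulus_measurable: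
  "on_coset (right_modulus G \<mu>) \<in> borel_measurable (borel_of Q)"
proof -
  interpret sigma_finite_measure \<mu> by (rule haar_sigma_finite[OF \<mu>])
  obtain E0 where E0: "compactin T E0" "E0 \<in> sets borelG" "0 < emeasure \<mu> E0"
    using haar_compact_pos[OF \<mu>] by metis
  define E where "E = E0 <#> K"
  have cE: "compactin T E" unfolding E_def by (rule compactin_set_mult[OF E0(1) compact_K])
  have Em: "E \<in> sets borelG" by (rule compactin_in_borelG[OF cE])
  have E0G: "E0 \<subseteq> carrier G" by (rule borelG_subset[OF E0(2)])
  have E_iff: "x <# K \<in> (\<lambda>g. g <# K) ` E0 \<longleftrightarrow> x \<in> E" if "x \<in> carrier G" for x
    using vimage_proj_image[OF E0G] that unfolding E_def by blast
  have "E0 \<subseteq> E"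
    using E_iff E0G by blast
  then have "emeasure \<mu> E0 \<le> emeasure \<mu> E"
    using Em haar_sets[OF \<mu>] by (intro emeasure_mono) auto
  with E0(3) have "0 < emeasure \<mu> E" by (rule less_le_trans)
  then obtain b where b: "emeasure \<mu> E = ennreal b" "0 < b"
    using haar_compact[OF \<mu> cE] by (cases "emeasure \<mu> E") (auto simp: less_le)
  define W where "W = {p \<in> topspace Q \<times> carrier G. snd p <# fst p \<notin> (\<lambda>g. g <# K) ` E0}"
  have W_iff: "(l <# K, x) \<in> W \<longleftrightarrow> x \<in> carrier G \<and> x \<otimes> l \<notin> E" if "l \<in> carrier G" for l x
    unfolding W_def using that E_iff[of "x \<otimes> l"] by (auto simp: coset_translate)
  have "openin (prod_topology Q T) W"
    unfolding openin_prod_topology_alt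
  proof (intro allI impI)
    fix v x assume vx: "(v, x) \<in> W"
    then obtain l where l: "l \<in> carrier G" "v = l <# K" by (auto simp: W_def)
    have x: "x \<in> carrier G" "x \<otimes> l \<notin> E" using W_iff[OF l(1)] vx l(2) by auto
    \<comment> \<open>Openness is checked in the group at the representative \<open>l\<close>, where
      multiplication is continuous, and is then brought down by the open projection.\<close>
    have "openin T (topspace T - E)"
      using compactin_imp_closedin[OF hd cE] by (rule openin_diff[OF openin_topspace])
    then have "openin (prod_topology T T)
        {p \<in> topspace (prod_topology T T). (case p of (x, y) \<Rightarrow> x \<otimes> y) \<in> topspace T - E}"
      by (rule openin_continuous_map_preimage[OF continuous_mult])
    moreover have "(x, l) \<in> {p \<in> topspace (prod_topology T T).
        (case p of (x, y) \<Rightarrow> x \<otimes> y) \<in> topspace T - E}"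
      using x l by simp
    ultimately obtain U V where UV: "openin T U" "openin T V" "x \<in> U" "l \<in> V"
        "U \<times> V \<subseteq> {p \<in> topspace (prod_topology T T). (case p of (x, y) \<Rightarrow> x \<otimes> y) \<in> topspace T - E}"
      unfolding openin_prod_topology_alt by meson
    have "(\<lambda>g. g <# K) ` V \<times> U \<subseteq> W"
    proof clarify
      fix m y assume "m \<in> V" "y \<in> U"
      then have "m \<in> carrier G \<and> y \<in> carrier G \<and> y \<otimes> m \<notin> E" using UV(5) by auto
      then show "(m <# K, y) \<in> W" using W_iff by blast
    qed
    then show "\<exists>U V. openin Q U \<and> openin T V \<and> v \<in> U \<and> x \<in> V \<and> U \<times> V \<subseteq> W"
      using openin_proj_image[OF UV(2)] UV(1,3,4) l(2) by blast
  qed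
  then have "W \<in> sets (borel_of Q \<Otimes>\<^sub>M borelG)" by (rule openin_prod_in_borel_pair[OF sc])
  then have "topspace Q \<times> carrier G - W \<in> sets (borel_of Q \<Otimes>\<^sub>M borelG)"
    using sets.compl_sets[of W "borel_of Q \<Otimes>\<^sub>M borelG"] by (simp add: space_pair_measure)
  also have "sets (borel_of Q \<Otimes>\<^sub>M borelG) = sets (borel_of Q \<Otimes>\<^sub>M \<mu>)"
    by (intro sets_pair_measure_cong refl haar_sets[OF \<mu>, symmetric])
  finally have [measurable]: "(\<lambda>v. emeasure \<mu> (Pair v -` (topspace Q \<times> carrier G - W)))
      \<in> borel_measurable (borel_of Q)"
    by (rule measurable_emeasure_Pair)
  \<comment> \<open>The slice over \<open>l <# K\<close> is \<open>E #> inv l\<close>, of measure b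
    divided by the modulus at l, so this quotient returns the modulus.\<close>
  have "(\<lambda>v. b / enn2real (emeasure \<mu> (Pair v -` (topspace Q \<times> carrier G - W))))
      \<in> borel_measurable (borel_of Q)"
    by measurable
  moreover have "b / enn2real (emeasure \<mu> (Pair v -` (topspace Q \<times> carrier G - W))) =
      on_coset (right_modulus G \<mu>) v" if v: "v \<in> topspace Q" for v
  proof -
    obtain l where l: "l \<in> carrier G" "v = l <# K" using v by auto
    have "Pair v -` (topspace Q \<times> carrier G - W) = E #> inv l"
      using l W_iff[OF l(1)] v borelG_subset[OF Em] by (auto simp: r_coset_eq_vimage)
    then have "emeasure \<mu> (Pair v -` (topspace Q \<times> carrier G - W)) =
        ennreal (inverse (right_modulus G \<mu> l)) * ennreal b"
      using emeasure_r_coset[OF \<mu> _ Em, of "inv l"] l b right_modulus_inv[OF \<mu> l(1)] by simp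
    then show ?thesis
      using on_coset_right_modulus[OF l(1)] right_modulus_pos[OF \<mu> l(1)] b l
      by (simp add: enn2real_mult inverse_eq_divide)
  qed
  ultimately show ?thesis
    by (subst measurable_cong[where g="\<lambda>v. b / enn2real (emeasure \<mu> (Pair v -` (topspace Q \<times> carrier G - W)))"])
      auto
qed

text \<open>The projection commutes with left translations, and the preimage of a compact set of
  cosets lies in a compact \<open>C <#> K\<close>, where \<open>\<mu>\<close> is finite. The
  measures on Y and on V both arise this way.\<close>

lemma invariant_measure_proj:
  "invariant_measure (carrier G) (\<lambda>g C. g <# C) Q (distr \<mu> (borel_of Q) (\<lambda>g. g <# K))"
  unfolding invariant_measure_def
proof (intro conjI ballI allI impI)
  let ?\<nu> = "distr \<mu> (borel_of Q) (\<lambda>g. g <# K)"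
  have meas: "(\<lambda>g. g <# K) \<in> measurable \<mu> (borel_of Q)"
    using measurable_proj measurable_cong_sets[OF haar_sets[OF \<mu>] refl] by blast
  have em: "emeasure ?\<nu> B = emeasure \<mu> {x \<in> carrier G. x <# K \<in> B}" if "B \<in> sets (borel_of Q)" for B
    using that haar_space[OF \<mu>] by (subst emeasure_distr[OF meas]) (auto intro!: arg_cong[where f="emeasure \<mu>"])
  show "sets ?\<nu> = sets (borel_of Q)" by simp
  {
    fix a B assume a: "a \<in> carrier G" and "B \<in> sets ?\<nu>"
    then have B: "B \<in> sets (borel_of Q)" by simp
    let ?P = "{x \<in> carrier G. x <# K \<in> B}"
    have "?P = (\<lambda>g. g <# K) -` B \<inter> space borelG" by auto
    then have P: "?P \<in> sets \<mu>" using measurable_sets[OF measurable_proj B] haar_sets[OF \<mu>] by simp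
    have "{x \<in> carrier G. x <# K \<in> (\<lambda>C. a <# C) ` B} = {x \<in> carrier G. inv a \<otimes> x \<in> ?P}"
      using a by (auto simp: translate_image_borelQ(2)[OF a B] coset_translate)
    also have "\<dots> = (\<lambda>x. a \<otimes> x) ` ?P" using a by (intro translate_eq_vimage[symmetric]) auto
    finally have "emeasure ?\<nu> ((\<lambda>C. a <# C) ` B) = emeasure \<mu> ((\<lambda>x. a \<otimes> x) ` ?P)"
      using em[OF translate_image_borelQ(1)[OF a B]] by simp
    also have "\<dots> = emeasure \<mu> ?P"
      using \<mu> a P unfolding left_haar_measure_def invariant_measure_def by blast
    finally show "emeasure ?\<nu> ((\<lambda>C. a <# C) ` B) = emeasure ?\<nu> B" using em[OF B] by simp
  next
    fix S assume S: "compactin Q S"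
    show "emeasure ?\<nu> S < \<infinity>"
    \<comment> \<open>The case split avoids showing that compact sets of cosets are Borel: outside
      the sigma-algebra \<open>emeasure\<close> has the default value 0.\<close>
    proof (cases "S \<in> sets (borel_of Q)")
      case True
      obtain C where C: "compactin T C" "S \<subseteq> (\<lambda>g. g <# K) ` C"
        by (rule compact_subset_proj_image[OF S])
      have CG: "C \<subseteq> carrier G" using compactin_subset_topspace[OF C(1)] by simp
      have "{x \<in> carrier G. x <# K \<in> S} \<subseteq> C <#> K"
        using vimage_proj_image[OF CG] C(2) by blast
      moreover have "compactin T (C <#> K)" by (rule compactin_set_mult[OF C(1) compact_K])
      ultimately have "emeasure \<mu> {x \<in> carrier G. x <# K \<in> S} \<le> emeasure \<mu> (C <#> K)"
        using compactin_in_borelG haar_sets[OF \<mu>] by (intro emeasure_mono) auto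
      then show ?thesis
        using em[OF True] haar_compact[OF \<mu> \<open>compactin T (C <#> K)\<close>] by (metis le_less_trans)
    qed (simp add: emeasure_notin_sets)
  next
    have "{x \<in> carrier G. x <# K \<in> topspace Q} = carrier G" by auto
    then show "emeasure ?\<nu> (space ?\<nu>) \<noteq> 0"
      using em[OF sets.top] haar_nonzero[OF \<mu>] by simp
  }
qed

end

end

section \<open>The coordinates u and v on the coset space\<close>

lemma l_coset_carrier_update [simp]: "x <#\<^bsub>G\<lparr>carrier := H\<rparr>\<^esub> C = x <#\<^bsub>G\<^esub> C"
  by (simp add: l_coset_def)

lemma coset_space_carrier_update [simp]: "coset_space (G\<lparr>carrier := H\<rparr>) T K = coset_space G T K"
  by (simp add: coset_space_def)

text \<open>This records what the factorization uses of the double coset data.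
  \<open>product_coset_eq_iff\<close> says that u and v are well defined on Y and jointly determine
  y; the construction of \<open>L\<close> from representatives enters only in
  \<open>double_coset_section\<close>.\<close>

locale coset_cross_section = lcsc_group +
  fixes K H L
  assumes subgroups: "subgroup K G" "subgroup H G" "subgroup L G"
    and compact_K: "compactin T K" and closed_H: "closedin T H" and closed_L: "closedin T L"
    and K_subset_L: "K \<subseteq> L"
    and decomposition: "\<And>g. g \<in> carrier G \<Longrightarrow> \<exists>h\<in>H. \<exists>l\<in>L. g = h \<otimes> l"
    and product_coset_eq_iff: "\<And>h h' l l'. \<lbrakk>h \<in> H; h' \<in> H; l \<in> L; l' \<in> L\<rbrakk> \<Longrightarrow>
      (h \<otimes> l) <# K = (h' \<otimes> l') <# K \<longleftrightarrow> h <# (H \<inter> K) = h' <# (H \<inter> K) \<and> l <# K = l' <# K"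
begin

abbreviation "TY \<equiv> coset_space G T K"
abbreviation "TU \<equiv> coset_space G (subtopology T H) (H \<inter> K)"
abbreviation "TV \<equiv> coset_space G (subtopology T L) K"

lemma H_carrier: "h \<in> H \<Longrightarrow> h \<in> carrier G"
  by (rule subgroup.mem_carrier[OF subgroups(2)])

lemma L_carrier: "l \<in> L \<Longrightarrow> l \<in> carrier G"
  by (rule subgroup.mem_carrier[OF subgroups(3)])

lemma closed_subgroup_coset_space:
  assumes "subgroup S G" "closedin T S" "subgroup C G" "C \<subseteq> S" "compactin T C"
  shows "compact_coset_space (G\<lparr>carrier := S\<rparr>) (subtopology T S) C"
proof (rule compact_coset_space.intro)
  show "lcsc_group (G\<lparr>carrier := S\<rparr>) (subtopology T S)"
    using assms(1,2) by (rule lcsc_subgroup)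
  have "subgroup C (G\<lparr>carrier := S\<rparr>)"
    using assms by (intro subgroup_incl) auto
  then show "compact_coset_space_axioms (G\<lparr>carrier := S\<rparr>) (subtopology T S) C"
    using assms(4,5) by (simp add: compact_coset_space_axioms_def compactin_subtopology)
qed

sublocale Y: compact_coset_space G T K
  by (intro compact_coset_space.intro compact_coset_space_axioms.intro lcsc_group_axioms
      subgroups(1) compact_K)

text \<open>The rewrites let all facts about the quotient of \<open>H\<close> be read with the
  operations of \<open>G\<close>. The inverse is not rewritten and is converted where it
  occurs.\<close>

sublocale U: compact_coset_space "G\<lparr>carrier := H\<rparr>" "subtopology T H" "H \<inter> K"
  rewrites "carrier (G\<lparr>carrier := H\<rparr>) = H"
    and "\<And>x C. x <#\<^bsub>G\<lparr>carrier := H\<rparr>\<^esub> C = x <# C"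
    and "\<And>x y. x \<otimes>\<^bsub>G\<lparr>carrier := H\<rparr>\<^esub> y = x \<otimes> y"
    and "\<And>T K. coset_space (G\<lparr>carrier := H\<rparr>) T K = coset_space G T K"
proof -
  have "subgroup (H \<inter> K) G" using subgroups by (intro subgroups_Inter_pair)
  moreover have "compactin T (H \<inter> K)" by (rule closed_Int_compactin[OF closed_H compact_K])
  ultimately show "compact_coset_space (G\<lparr>carrier := H\<rparr>) (subtopology T H) (H \<inter> K)"
    using subgroups closed_H by (intro closed_subgroup_coset_space) auto
qed auto

sublocale V: compact_coset_space "G\<lparr>carrier := L\<rparr>" "subtopology T L" K
  rewrites "carrier (G\<lparr>carrier := L\<rparr>) = L"
    and "\<And>x C. x <#\<^bsub>G\<lparr>carrier := L\<rparr>\<^esub> C = x <# C"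
    and "\<And>x y. x \<otimes>\<^bsub>G\<lparr>carrier := L\<rparr>\<^esub> y = x \<otimes> y"
    and "\<And>T K. coset_space (G\<lparr>carrier := L\<rparr>) T K = coset_space G T K"
proof -
  show "compact_coset_space (G\<lparr>carrier := L\<rparr>) (subtopology T L) K"
    using subgroups closed_L K_subset_L compact_K by (intro closed_subgroup_coset_space) auto
qed auto

definition u_of :: "'a set \<Rightarrow> 'a set" where
  "u_of y = (THE C. \<exists>h\<in>H. \<exists>l\<in>L. y = (h \<otimes> l) <# K \<and> C = h <# (H \<inter> K))"

definition v_of :: "'a set \<Rightarrow> 'a set" where
  "v_of y = (THE C. \<exists>h\<in>H. \<exists>l\<in>L. y = (h \<otimes> l) <# K \<and> C = l <# K)"

lemma u_of_eq: "h \<in> H \<Longrightarrow> l \<in> L \<Longrightarrow> u_of ((h \<otimes> l) <# K) = h <# (H \<inter> K)"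
  unfolding u_of_def using product_coset_eq_iff by (intro the_equality) blast+

lemma v_of_eq: "h \<in> H \<Longrightarrow> l \<in> L \<Longrightarrow> v_of ((h \<otimes> l) <# K) = l <# K"
  unfolding v_of_def using product_coset_eq_iff by (intro the_equality) blast+

lemma topspace_TY_cases:
  assumes "y \<in> topspace TY"
  obtains h l where "h \<in> H" "l \<in> L" "y = (h \<otimes> l) <# K"
proof -
  obtain g where g: "g \<in> carrier G" "y = g <# K" using assms by auto
  then show thesis using decomposition[OF g(1)] that by blast
qed

text \<open>The coset of \<open>h \<otimes> l\<close> belongs to the preimage iff h may be replaced
  by an element of some \<open>D n\<close>, with l arbitrary in \<open>L\<close>. Exhausting
  \<open>L\<close> by the compact \<open>C m\<close> leaves the projections of the compact products
  \<open>D n <#> C m\<close>, which are closed.\<close>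

lemma measurable_u_of: "u_of \<in> measurable (borel_of TY) (borel_of TU)"
proof (rule measurable_borel_ofI_closed)
  show "u_of \<in> space (borel_of TY) \<rightarrow> topspace TU"
  proof
    fix y assume "y \<in> space (borel_of TY)"
    then have "y \<in> topspace TY" by simp
    then obtain h l where "h \<in> H" "l \<in> L" "y = (h \<otimes> l) <# K" by (rule topspace_TY_cases)
    then show "u_of y \<in> topspace TU" by (simp add: u_of_eq del: Int_iff)
  qed
  fix S assume S: "closedin TU S"
  obtain D :: "nat \<Rightarrow> 'a set" where D: "\<And>n. compactin (subtopology T H) (D n)"
      "S = (\<Union>n. (\<lambda>g. g <# (H \<inter> K)) ` D n)"
    using U.closedin_Q_sigma_compact[OF S] by metis
  obtain C :: "nat \<Rightarrow> 'a set" where C: "\<And>n. compactin (subtopology T L) (C n)"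
      "(\<Union>n. C n) = topspace (subtopology T L)"
    using sigma_compact[OF V.sc V.lc] by metis
  have D': "compactin T (D n)" "D n \<subseteq> H" for n using D(1) by (auto simp: compactin_subtopology)
  have C': "compactin T (C n)" "C n \<subseteq> L" for n using C(1) by (auto simp: compactin_subtopology)
  have "u_of -` S \<inter> space (borel_of TY) = (\<Union>n. \<Union>m. (\<lambda>g. g <# K) ` (D n <#> C m))"
  proof
    show "u_of -` S \<inter> space (borel_of TY) \<subseteq> (\<Union>n. \<Union>m. (\<lambda>g. g <# K) ` (D n <#> C m))"
    proof
      fix y assume y: "y \<in> u_of -` S \<inter> space (borel_of TY)"
      then have "y \<in> topspace TY" by simp
      then obtain h l where hl: "h \<in> H" "l \<in> L" "y = (h \<otimes> l) <# K" by (rule topspace_TY_cases)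
      then have "h <# (H \<inter> K) \<in> S" using y u_of_eq by auto
      then obtain n d where d: "d \<in> D n" "h <# (H \<inter> K) = d <# (H \<inter> K)" using D(2) by auto
      obtain m where m: "l \<in> C m" using C(2) hl(2) V.topspace_eq by blast
      have "y = (d \<otimes> l) <# K" using hl d D'(2) product_coset_eq_iff by blast
      moreover have "d \<otimes> l \<in> D n <#> C m" using d m by (auto simp: set_mult_def)
      ultimately show "y \<in> (\<Union>n. \<Union>m. (\<lambda>g. g <# K) ` (D n <#> C m))" by blast
    qed
    show "(\<Union>n. \<Union>m. (\<lambda>g. g <# K) ` (D n <#> C m)) \<subseteq> u_of -` S \<inter> space (borel_of TY)"
    proof clarify
      fix n m g assume "g \<in> D n <#> C m"
      then obtain d l where dl: "d \<in> D n" "l \<in> C m" "g = d \<otimes> l" by (auto simp: set_mult_def)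
      then have "d \<in> H" "l \<in> L" using D'(2) C'(2) by blast+
      then have "u_of (g <# K) \<in> S" "g <# K \<in> topspace TY"
        using dl D(2) u_of_eq H_carrier L_carrier by auto
      then show "g <# K \<in> u_of -` S \<inter> space (borel_of TY)" by simp
    qed
  qed
  moreover have "(\<lambda>g. g <# K) ` (D n <#> C m) \<in> sets (borel_of TY)" for n m
    by (intro closedin_in_borel_of Y.closedin_proj_image compactin_set_mult D' C')
  ultimately show "u_of -` S \<inter> space (borel_of TY) \<in> sets (borel_of TY)" by auto
qed

text \<open>Here the roles are exchanged: \<open>D\<close> lifts the closed set to \<open>L\<close>,
  and \<open>C\<close> exhausts \<open>H\<close>.\<close>

lemma measurable_v_of: "v_of \<in> measurable (borel_of TY) (borel_of TV)"
proof (rule measurable_borel_ofI_closed)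
  show "v_of \<in> space (borel_of TY) \<rightarrow> topspace TV"
  proof
    fix y assume "y \<in> space (borel_of TY)"
    then have "y \<in> topspace TY" by simp
    then obtain h l where "h \<in> H" "l \<in> L" "y = (h \<otimes> l) <# K" by (rule topspace_TY_cases)
    then show "v_of y \<in> topspace TV" by (simp add: v_of_eq)
  qed
  fix S assume S: "closedin TV S"
  obtain D :: "nat \<Rightarrow> 'a set" where D: "\<And>n. compactin (subtopology T L) (D n)"
      "S = (\<Union>n. (\<lambda>g. g <# K) ` D n)"
    using V.closedin_Q_sigma_compact[OF S] by metis
  obtain C :: "nat \<Rightarrow> 'a set" where C: "\<And>n. compactin (subtopology T H) (C n)"
      "(\<Union>n. C n) = topspace (subtopology T H)"
    using sigma_compact[OF U.sc U.lc] by metis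
  have D': "compactin T (D n)" "D n \<subseteq> L" for n using D(1) by (auto simp: compactin_subtopology)
  have C': "compactin T (C n)" "C n \<subseteq> H" for n using C(1) by (auto simp: compactin_subtopology)
  have "v_of -` S \<inter> space (borel_of TY) = (\<Union>n. \<Union>m. (\<lambda>g. g <# K) ` (C m <#> D n))"
  proof
    show "v_of -` S \<inter> space (borel_of TY) \<subseteq> (\<Union>n. \<Union>m. (\<lambda>g. g <# K) ` (C m <#> D n))"
    proof
      fix y assume y: "y \<in> v_of -` S \<inter> space (borel_of TY)"
      then have "y \<in> topspace TY" by simp
      then obtain h l where hl: "h \<in> H" "l \<in> L" "y = (h \<otimes> l) <# K" by (rule topspace_TY_cases)
      then have "l <# K \<in> S" using y v_of_eq by auto
      then obtain n d where d: "d \<in> D n" "l <# K = d <# K" using D(2) by auto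
      obtain m where m: "h \<in> C m" using C(2) hl(1) U.topspace_eq by blast
      have "y = (h \<otimes> d) <# K" using hl d D'(2) product_coset_eq_iff by blast
      moreover have "h \<otimes> d \<in> C m <#> D n" using d m by (auto simp: set_mult_def)
      ultimately show "y \<in> (\<Union>n. \<Union>m. (\<lambda>g. g <# K) ` (C m <#> D n))" by blast
    qed
    show "(\<Union>n. \<Union>m. (\<lambda>g. g <# K) ` (C m <#> D n)) \<subseteq> v_of -` S \<inter> space (borel_of TY)"
    proof clarify
      fix n m g assume "g \<in> C m <#> D n"
      then obtain h d where dl: "h \<in> C m" "d \<in> D n" "g = h \<otimes> d" by (auto simp: set_mult_def)
      then have "h \<in> H" "d \<in> L" using D'(2) C'(2) by blast+
      then have "v_of (g <# K) \<in> S" "g <# K \<in> topspace TY"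
        using dl D(2) v_of_eq H_carrier L_carrier by auto
      then show "g <# K \<in> v_of -` S \<inter> space (borel_of TY)" by simp
    qed
  qed
  moreover have "(\<lambda>g. g <# K) ` (C m <#> D n) \<in> sets (borel_of TY)" for n m
    by (intro closedin_in_borel_of Y.closedin_proj_image compactin_set_mult D' C')
  ultimately show "v_of -` S \<inter> space (borel_of TY) \<in> sets (borel_of TY)" by auto
qed

section \<open>Behaviour of u and v under translations\<close>

abbreviation "u g \<equiv> u_of (g <# K)"
abbreviation "v g \<equiv> v_of (g <# K)"

lemma measurable_u: "(\<lambda>g. u g) \<in> measurable borelG (borel_of TU)"
  using measurable_compose[OF Y.measurable_proj measurable_u_of] .

lemma measurable_v: "(\<lambda>g. v g) \<in> measurable borelG (borel_of TV)"
  using measurable_compose[OF Y.measurable_proj measurable_v_of] .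

text \<open>Right multiplication by \<open>L\<close> can be absorbed into the \<open>L\<close> part
  of g. With the next two lemmas this expresses how \<open>H\<close> acting on the left and
  \<open>L\<close> acting on the right affect the two coordinates.\<close>

lemma u_mult_right:
  assumes "g \<in> carrier G" "l \<in> L"
  shows "u (g \<otimes> l) = u g"
proof -
  obtain h l0 where g: "h \<in> H" "l0 \<in> L" "g = h \<otimes> l0" using decomposition[OF assms(1)] by blast
  then have "g \<otimes> l = h \<otimes> (l0 \<otimes> l)" using assms H_carrier L_carrier by (simp add: m_assoc)
  then show ?thesis
    using g assms subgroup.m_closed[OF subgroups(3)] by (simp add: u_of_eq del: Int_iff)
qed

lemma v_mult_right:
  assumes "h \<in> H" "l0 \<in> L" "l \<in> L"
  shows "v (h \<otimes> l0 \<otimes> l) = (l0 \<otimes> l) <# K"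
proof -
  have "h \<otimes> l0 \<otimes> l = h \<otimes> (l0 \<otimes> l)" using assms H_carrier L_carrier by (simp add: m_assoc)
  then show ?thesis
    using assms subgroup.m_closed[OF subgroups(3)] by (simp add: v_of_eq)
qed

lemma uv_mult_left:
  assumes "g \<in> carrier G" "a \<in> H"
  shows "u (a \<otimes> g) = a <# u g" and "v (a \<otimes> g) = v g"
proof -
  obtain h l where g: "h \<in> H" "l \<in> L" "g = h \<otimes> l" using decomposition[OF assms(1)] by blast
  then have ag: "a \<otimes> g = (a \<otimes> h) \<otimes> l" using assms H_carrier L_carrier by (simp add: m_assoc)
  have ah: "a \<otimes> h \<in> H" using assms g subgroup.m_closed[OF subgroups(2)] by simp
  show "v (a \<otimes> g) = v g" unfolding ag using v_of_eq[OF ah g(2)] g by (simp add: v_of_eq)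
  show "u (a \<otimes> g) = a <# u g"
    unfolding ag using u_of_eq[OF ah g(2)] g assms by (simp add: u_of_eq U.coset_translate del: Int_iff)
qed

end

section \<open>The factorization of the invariant measure\<close>

context coset_cross_section
begin

context
  fixes \<mu> \<kappa> :: "'a measure"
  assumes \<mu>: "left_haar_measure G T \<mu>"
    and \<kappa>: "left_haar_measure (G\<lparr>carrier := L\<rparr>) (subtopology T L) \<kappa>"
begin

text \<open>This is Delta^G / Delta^L read on cosets. Both moduli are trivial on the compact group
  \<open>K\<close>, and the quotient is multiplicative in the representative.\<close>

definition weight :: "'a set \<Rightarrow> real" where
  "weight C = on_coset (right_modulus G \<mu>) C * inverse (on_coset (right_modulus (G\<lparr>carrier := L\<rparr>) \<kappa>) C)"

definition mu_V :: "'a set measure" where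
  "mu_V = distr \<kappa> (borel_of TV) (\<lambda>l. l <# K)"

lemma weight_eq:
  assumes "l \<in> L"
  shows "weight (l <# K) = right_modulus G \<mu> l * inverse (right_modulus (G\<lparr>carrier := L\<rparr>) \<kappa> l)"
  using assms Y.on_coset_right_modulus[OF \<mu>] V.on_coset_right_modulus[OF \<kappa>] L_carrier
  by (simp add: weight_def)

lemma weight_pos: "l \<in> L \<Longrightarrow> 0 < weight (l <# K)"
  using right_modulus_pos[OF \<mu>] V.right_modulus_pos[OF \<kappa>] L_carrier by (simp add: weight_eq)

lemma weight_mult:
  assumes "l \<in> L" "m \<in> L"
  shows "weight ((l \<otimes> m) <# K) = weight (l <# K) * weight (m <# K)"
  using assms right_modulus_mult[OF \<mu>] V.right_modulus_mult[OF \<kappa>] L_carrier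
    subgroup.m_closed[OF subgroups(3)]
  by (simp add: weight_eq)

lemma weight_inv:
  assumes "l \<in> L"
  shows "weight (inv l <# K) = inverse (weight (l <# K))"
proof -
  have "weight (\<one> <# K) = weight (\<one> <# K) * weight (\<one> <# K)"
    using weight_mult[of \<one> \<one>] subgroup.one_closed[OF subgroups(3)] by simp
  then have "weight (\<one> <# K) = 1"
    using weight_pos[OF subgroup.one_closed[OF subgroups(3)]] by simp
  moreover have "weight ((l \<otimes> inv l) <# K) = weight (l <# K) * weight (inv l <# K)"
    using assms subgroup.m_inv_closed[OF subgroups(3)] by (intro weight_mult) auto
  ultimately have "weight (l <# K) * weight (inv l <# K) = 1"
    using L_carrier[OF assms] by simp
  then show ?thesis using weight_pos[OF assms] by (simp add: field_simps)
qed

text \<open>A point of V is also a point of Y, with another topology. Continuity of the inclusion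
  carries measurability of Delta^G on cosets from Y to V.\<close>

lemma continuous_TV_TY: "continuous_map TV TY (\<lambda>C. C)"
  unfolding continuous_map_def
proof (intro conjI allI impI funcsetI)
  fix C assume "C \<in> topspace TV"
  then show "C \<in> topspace TY" using L_carrier by auto
next
  fix S assume "openin TY S"
  then have S: "openin T {x \<in> carrier G. x <# K \<in> S}" by (simp add: Y.openin_Q)
  have "{x \<in> L. x <# K \<in> {C \<in> topspace TV. C \<in> S}} = {x \<in> carrier G. x <# K \<in> S} \<inter> L"
    using L_carrier by auto
  also have "openin (subtopology T L) \<dots>"
    using S by (rule openin_subtopology_Int)
  finally show "openin TV {C \<in> topspace TV. C \<in> S}"
    unfolding V.openin_Q by auto
qed

lemma weight_measurable [measurable]: "weight \<in> borel_measurable (borel_of TV)"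
proof -
  have [measurable]: "on_coset (right_modulus G \<mu>) \<in> borel_measurable (borel_of TV)"
    using measurable_compose[OF continuous_map_measurable[OF continuous_TV_TY]
        Y.on_coset_right_modulus_measurable[OF \<mu>]] .
  note [measurable] = V.on_coset_right_modulus_measurable[OF \<kappa>]
  show ?thesis unfolding weight_def by measurable
qed

lemma nn_integral_mu_V:
  assumes "f \<in> borel_measurable (borel_of TV)"
  shows "(\<integral>\<^sup>+x. f x \<partial>mu_V) = (\<integral>\<^sup>+l. f (l <# K) \<partial>\<kappa>)"
  unfolding mu_V_def
  using assms V.measurable_proj measurable_cong_sets[OF V.haar_sets[OF \<kappa>] refl]
  by (intro nn_integral_distr) auto

lemma sets_mu_V: "sets mu_V = sets (borel_of TV)"
  by (simp add: mu_V_def)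

lemma invariant_mu_V: "invariant_measure L (\<lambda>l C. l <# C) TV mu_V"
  using V.invariant_measure_proj[OF \<kappa>] by (simp add: mu_V_def)

lemma sigma_finite_mu_V: "sigma_finite_measure mu_V"
  using invariant_mu_V unfolding invariant_measure_def by (intro V.sigma_finite_borelQ) auto

lemma measurable_inclusion_L: "(\<lambda>l. l) \<in> measurable (borel_of (subtopology T L)) borelG"
  by (rule continuous_map_measurable) (simp add: continuous_map_from_subtopology)

text \<open>Integrate \<open>1\<^sub>A(u(g)) 1\<^sub>B(v(g)) 1\<^sub>C(v(g l))\<close> over \<open>(g, l) \<in> G \<times> L\<close>. Left invariance of the
  measure on \<open>L\<close> makes the integral over \<open>l\<close> a constant; substituting \<open>g l\<^sup>-\<^sup>1\<close> for \<open>g\<close> and then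
  inverting \<open>l\<close> separates \<open>B\<close> from \<open>A\<close> and \<open>C\<close> instead.\<close>

lemma factorization:
  assumes A [measurable]: "A \<in> sets (borel_of TU)" and B [measurable]: "B \<in> sets (borel_of TV)"
    and C [measurable]: "C \<in> sets (borel_of TV)"
  shows "(\<integral>\<^sup>+g. indicator A (u g) * indicator B (v g) \<partial>\<mu>) * emeasure mu_V C =
    (\<integral>\<^sup>+g. indicator A (u g) * indicator C (v g) * ennreal (inverse (weight (v g))) \<partial>\<mu>) *
    (\<integral>\<^sup>+y. indicator B y * ennreal (weight y) \<partial>mu_V)"
proof -
  interpret M: sigma_finite_measure \<mu> by (rule haar_sigma_finite[OF \<mu>])
  interpret L: sigma_finite_measure \<kappa> by (rule V.haar_sigma_finite[OF \<kappa>])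
  interpret P: pair_sigma_finite \<kappa> \<mu> ..
  have sp: "space \<mu> = carrier G" "space \<kappa> = L"
    using haar_space[OF \<mu>] V.haar_space[OF \<kappa>] by auto
  note [measurable_cong] = haar_sets[OF \<mu>] V.haar_sets[OF \<kappa>]
  note [measurable] = measurable_u measurable_v right_modulus_measurable[OF \<mu>]
    V.right_modulus_measurable[OF \<kappa>]
  note [measurable (raw)] = measurable_inclusion_L
  \<comment> \<open>Elements of \<open>L\<close> are also multiplied inside \<open>G\<close>; the
    continuous inclusion makes this second reading of the first coordinate measurable.\<close>
  have [measurable (raw)]: "fst \<in> measurable (\<kappa> \<Otimes>\<^sub>M \<mu>) borelG"
    using measurable_compose[OF measurable_fst measurable_inclusion_L, of "\<mu>"]
    by (simp add: measurable_cong_sets[OF sets_pair_measure_cong[OF V.haar_sets[OF \<kappa>] refl] refl])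
  let ?D = "right_modulus G \<mu>" and ?DL = "right_modulus (G\<lparr>carrier := L\<rparr>) \<kappa>"
  have muV_C: "emeasure mu_V C = (\<integral>\<^sup>+l. indicator C (l <# K) \<partial>\<kappa>)"
    using nn_integral_mu_V[of "indicator C"] by (simp add: sets_mu_V)
  have [measurable]: "(\<lambda>l. inv l) \<in> measurable (borel_of (subtopology T L)) borelG"
    by measurable
  have int_l: "(\<integral>\<^sup>+l. indicator C (v (g \<otimes> l)) \<partial>\<kappa>) = emeasure mu_V C" if g: "g \<in> carrier G" for g
  proof -
    obtain h l0 where hl: "h \<in> H" "l0 \<in> L" "g = h \<otimes> l0" using decomposition[OF g] by blast
    note [measurable] = V.measurable_proj
    have "(\<integral>\<^sup>+l. indicator C (v (g \<otimes> l)) \<partial>\<kappa>) = (\<integral>\<^sup>+l. indicator C ((l0 \<otimes> l) <# K) \<partial>\<kappa>)"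
      using hl by (intro nn_integral_cong) (simp add: sp v_mult_right)
    also have "\<dots> = (\<integral>\<^sup>+l. indicator C (l <# K) \<partial>\<kappa>)"
      by (rule V.haar_nn_integral_left[OF \<kappa> hl(2)]) measurable
    finally show ?thesis by (simp add: muV_C)
  qed
  have inner: "(\<integral>\<^sup>+l. ennreal (inverse (?D l)) * indicator B (v (g \<otimes> inv l)) \<partial>\<kappa>) =
      ennreal (inverse (weight (v g))) * (\<integral>\<^sup>+y. indicator B y * ennreal (weight y) \<partial>mu_V)"
    if g: "g \<in> carrier G" for g
  proof -
    obtain h l0 where hl: "h \<in> H" "l0 \<in> L" "g = h \<otimes> l0" using decomposition[OF g] by blast
    have vg: "v g = l0 <# K" using hl by (simp add: v_of_eq)
    note [measurable] = measurable_mult_left[OF g] V.measurable_proj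
    have "(\<integral>\<^sup>+l. ennreal (inverse (?D l)) * indicator B (v (g \<otimes> inv l)) \<partial>\<kappa>) =
        (\<integral>\<^sup>+l. ennreal (?D (inv\<^bsub>G\<lparr>carrier := L\<rparr>\<^esub> l)) *
            indicator B (v (g \<otimes> inv\<^bsub>G\<lparr>carrier := L\<rparr>\<^esub> l)) \<partial>\<kappa>)"
      using subgroups(3) L_carrier
      by (intro nn_integral_cong) (simp add: sp right_modulus_inv[OF \<mu>])
    also have "\<dots> = (\<integral>\<^sup>+l. ennreal (?D l) * indicator B (v (g \<otimes> l)) * ennreal (inverse (?DL l)) \<partial>\<kappa>)"
      by (rule V.haar_nn_integral_inverse[OF \<kappa>]) measurable
    \<comment> \<open>Put \<open>m = l0 \<otimes> l\<close>: then \<open>v (g \<otimes> l)\<close>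
      is the coset of m, and the two moduli combine to the weight at
      \<open>inv l0 \<otimes> m\<close>. Multiplicativity will split off the inverse of the weight
      at \<open>v g\<close>.\<close>
    also have "\<dots> = (\<integral>\<^sup>+l. (\<lambda>m. ennreal (weight ((inv l0 \<otimes> m) <# K)) * indicator B (m <# K)) (l0 \<otimes> l) \<partial>\<kappa>)"
    proof (rule nn_integral_cong)
      fix l assume "l \<in> space \<kappa>"
      then have l: "l \<in> L" by (simp add: sp)
      have i: "inv l0 \<otimes> (l0 \<otimes> l) = l"
        using hl(2) l L_carrier by (simp add: m_assoc[symmetric])
      have w: "ennreal (?D l) * ennreal (inverse (?DL l)) = ennreal (weight (l <# K))"
        using right_modulus_pos[OF \<mu> L_carrier[OF l]] V.right_modulus_pos[OF \<kappa> l] l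
        by (simp add: weight_eq ennreal_mult)
      have "ennreal (?D l) * indicator B (v (g \<otimes> l)) * ennreal (inverse (?DL l)) =
          (ennreal (?D l) * ennreal (inverse (?DL l))) * indicator B (v (g \<otimes> l))"
        by (simp only: ac_simps)
      then show "ennreal (?D l) * indicator B (v (g \<otimes> l)) * ennreal (inverse (?DL l)) =
          (\<lambda>m. ennreal (weight ((inv l0 \<otimes> m) <# K)) * indicator B (m <# K)) (l0 \<otimes> l)"
        unfolding w using hl l i v_mult_right by simp
    qed
    also have "\<dots> = (\<integral>\<^sup>+m. ennreal (weight ((inv l0 \<otimes> m) <# K)) * indicator B (m <# K) \<partial>\<kappa>)"
    proof (rule V.haar_nn_integral_left[OF \<kappa> hl(2)])
      have "inv l0 \<in> L" using hl(2) subgroup.m_inv_closed[OF subgroups(3)] by simp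
      note [measurable] = V.measurable_mult_left[OF this]
      show "(\<lambda>m. ennreal (weight ((inv l0 \<otimes> m) <# K)) * indicator B (m <# K))
          \<in> borel_measurable (borel_of (subtopology T L))" by measurable
    qed
    also have "\<dots> = (\<integral>\<^sup>+m. ennreal (inverse (weight (v g))) *
        (indicator B (m <# K) * ennreal (weight (m <# K))) \<partial>\<kappa>)"
    proof (rule nn_integral_cong)
      fix m assume "m \<in> space \<kappa>"
      then have m: "m \<in> L" by (simp add: sp)
      have "inv l0 \<in> L" using hl(2) subgroup.m_inv_closed[OF subgroups(3)] by simp
      then have "weight ((inv l0 \<otimes> m) <# K) = inverse (weight (v g)) * weight (m <# K)"
        using m hl(2) by (simp add: weight_mult weight_inv vg)
      then show "ennreal (weight ((inv l0 \<otimes> m) <# K)) * indicator B (m <# K) =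
          ennreal (inverse (weight (v g))) * (indicator B (m <# K) * ennreal (weight (m <# K)))"
        using weight_pos[OF hl(2)] weight_pos[OF m] vg
        by (simp add: ennreal_mult ac_simps)
    qed
    also have "\<dots> = ennreal (inverse (weight (v g))) *
        (\<integral>\<^sup>+m. indicator B (m <# K) * ennreal (weight (m <# K)) \<partial>\<kappa>)"
      by (rule nn_integral_cmult) measurable
    also have "(\<integral>\<^sup>+m. indicator B (m <# K) * ennreal (weight (m <# K)) \<partial>\<kappa>) =
        (\<integral>\<^sup>+y. indicator B y * ennreal (weight y) \<partial>mu_V)"
      by (rule nn_integral_mu_V[symmetric]) measurable
    finally show ?thesis .
  qed
  have "(\<integral>\<^sup>+g. indicator A (u g) * indicator B (v g) \<partial>\<mu>) * emeasure mu_V C =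
      (\<integral>\<^sup>+g. indicator A (u g) * indicator B (v g) * emeasure mu_V C \<partial>\<mu>)"
    by (intro nn_integral_multc[symmetric]) (simp add: measurable_cong_sets[OF haar_sets[OF \<mu>] refl]
        measurable_compose[OF measurable_u borel_measurable_indicator[OF A]]
        measurable_compose[OF measurable_v borel_measurable_indicator[OF B]])
  also have "\<dots> = (\<integral>\<^sup>+g. (\<integral>\<^sup>+l. indicator A (u g) * indicator B (v g) * indicator C (v (g \<otimes> l)) \<partial>\<kappa>) \<partial>\<mu>)"
  proof (rule nn_integral_cong)
    fix g assume "g \<in> space \<mu>"
    then have g: "g \<in> carrier G" by (simp add: sp)
    note [measurable] = measurable_mult_left[OF g]
    have "(\<integral>\<^sup>+l. indicator A (u g) * indicator B (v g) * indicator C (v (g \<otimes> l)) \<partial>\<kappa>) =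
        indicator A (u g) * indicator B (v g) * (\<integral>\<^sup>+l. indicator C (v (g \<otimes> l)) \<partial>\<kappa>)"
      by (rule nn_integral_cmult) measurable
    then show "indicator A (u g) * indicator B (v g) * emeasure mu_V C =
        (\<integral>\<^sup>+l. indicator A (u g) * indicator B (v g) * indicator C (v (g \<otimes> l)) \<partial>\<kappa>)"
      by (simp only: int_l[OF g])
  qed
  also have "\<dots> = (\<integral>\<^sup>+l. (\<integral>\<^sup>+g. indicator A (u g) * indicator B (v g) * indicator C (v (g \<otimes> l)) \<partial>\<mu>) \<partial>\<kappa>)"
    by (rule P.Fubini') measurable
  also have "\<dots> = (\<integral>\<^sup>+l. (\<integral>\<^sup>+g. ennreal (inverse (?D l)) *
      (indicator A (u g) * indicator B (v (g \<otimes> inv l)) * indicator C (v g)) \<partial>\<mu>) \<partial>\<kappa>)"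
  proof (rule nn_integral_cong)
    fix l assume "l \<in> space \<kappa>"
    then have l: "l \<in> L" "l \<in> carrier G" by (auto simp: sp L_carrier)
    then have "inv l \<in> carrier G" by simp
    note [measurable] = measurable_mult_right[OF this]
    have "(\<integral>\<^sup>+g. indicator A (u g) * indicator B (v g) * indicator C (v (g \<otimes> l)) \<partial>\<mu>) =
        (\<integral>\<^sup>+g. (\<lambda>x. indicator A (u x) * indicator B (v (x \<otimes> inv l)) * indicator C (v x)) (g \<otimes> l) \<partial>\<mu>)"
      \<comment> \<open>Right multiplication by an element of \<open>L\<close> fixes u, so only the
        arguments belonging to \<open>B\<close> and \<open>C\<close> are shifted.\<close>
      using l by (intro nn_integral_cong) (simp add: sp u_mult_right m_assoc)
    also have "\<dots> = ennreal (inverse (?D l)) *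
        (\<integral>\<^sup>+x. indicator A (u x) * indicator B (v (x \<otimes> inv l)) * indicator C (v x) \<partial>\<mu>)"
      by (rule haar_nn_integral_right[OF \<mu> l(2)]) measurable
    also have "\<dots> = (\<integral>\<^sup>+x. ennreal (inverse (?D l)) *
        (indicator A (u x) * indicator B (v (x \<otimes> inv l)) * indicator C (v x)) \<partial>\<mu>)"
      by (rule nn_integral_cmult[symmetric]) measurable
    finally show "(\<integral>\<^sup>+g. indicator A (u g) * indicator B (v g) * indicator C (v (g \<otimes> l)) \<partial>\<mu>) = \<dots>" .
  qed
  also have "\<dots> = (\<integral>\<^sup>+g. (\<integral>\<^sup>+l. ennreal (inverse (?D l)) *
      (indicator A (u g) * indicator B (v (g \<otimes> inv l)) * indicator C (v g)) \<partial>\<kappa>) \<partial>\<mu>)"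
    by (rule P.Fubini'[symmetric]) measurable
  also have "\<dots> = (\<integral>\<^sup>+g. indicator A (u g) * indicator C (v g) * ennreal (inverse (weight (v g))) *
      (\<integral>\<^sup>+y. indicator B y * ennreal (weight y) \<partial>mu_V) \<partial>\<mu>)"
  proof (rule nn_integral_cong)
    fix g assume "g \<in> space \<mu>"
    then have g: "g \<in> carrier G" by (simp add: sp)
    note [measurable] = measurable_mult_left[OF g]
    have "(\<integral>\<^sup>+l. ennreal (inverse (?D l)) *
        (indicator A (u g) * indicator B (v (g \<otimes> inv l)) * indicator C (v g)) \<partial>\<kappa>) =
        (\<integral>\<^sup>+l. indicator A (u g) * indicator C (v g) *
          (ennreal (inverse (?D l)) * indicator B (v (g \<otimes> inv l))) \<partial>\<kappa>)"
      by (simp only: ac_simps)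
    also have "\<dots> = indicator A (u g) * indicator C (v g) *
        (\<integral>\<^sup>+l. ennreal (inverse (?D l)) * indicator B (v (g \<otimes> inv l)) \<partial>\<kappa>)"
      by (rule nn_integral_cmult) measurable
    finally show "(\<integral>\<^sup>+l. ennreal (inverse (?D l)) *
        (indicator A (u g) * indicator B (v (g \<otimes> inv l)) * indicator C (v g)) \<partial>\<kappa>) =
        indicator A (u g) * indicator C (v g) * ennreal (inverse (weight (v g))) *
        (\<integral>\<^sup>+y. indicator B y * ennreal (weight y) \<partial>mu_V)"
      by (simp only: inner[OF g] mult.assoc)
  qed
  also have "\<dots> = (\<integral>\<^sup>+g. indicator A (u g) * indicator C (v g) * ennreal (inverse (weight (v g))) \<partial>\<mu>) *
      (\<integral>\<^sup>+y. indicator B y * ennreal (weight y) \<partial>mu_V)"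
    by (rule nn_integral_multc) measurable
  finally show ?thesis .
qed

text \<open>The compact set is delivered in \<open>L\<close> and not only as a set of cosets,
  because finiteness of the measure on U will require multiplying it inside
  \<open>G\<close>.\<close>

lemma mu_V_compact_pos:
  obtains D where "compactin (subtopology T L) D"
    "0 < emeasure mu_V ((\<lambda>l. l <# K) ` D)" "emeasure mu_V ((\<lambda>l. l <# K) ` D) < \<infinity>"
proof -
  obtain D where D: "compactin (subtopology T L) D" "D \<in> sets (borel_of (subtopology T L))"
      "0 < emeasure \<kappa> D"
    using V.haar_compact_pos[OF \<kappa>] by metis
  let ?C = "(\<lambda>l. l <# K) ` D"
  have DL: "D \<subseteq> L" using D(1) by (simp add: compactin_subtopology)
  have C: "?C \<in> sets (borel_of TV)" by (intro closedin_in_borel_of V.closedin_proj_image D)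
  have meas: "(\<lambda>l. l <# K) \<in> measurable \<kappa> (borel_of TV)"
    using V.measurable_proj measurable_cong_sets[OF V.haar_sets[OF \<kappa>] refl] by blast
  have "emeasure \<kappa> D \<le> emeasure \<kappa> ((\<lambda>l. l <# K) -` ?C \<inter> space \<kappa>)"
    using DL V.haar_space[OF \<kappa>] by (intro emeasure_mono measurable_sets[OF meas C]) auto
  then have "0 < emeasure mu_V ?C"
    using D(3) by (simp add: mu_V_def emeasure_distr[OF meas C])
  moreover have "emeasure mu_V ?C < \<infinity>"
    using invariant_mu_V V.compactin_proj_image[OF D(1)] unfolding invariant_measure_def by blast
  ultimately show thesis using that D(1) by blast
qed

text \<open>The inverse of Delta^G at l is Delta^G at \<open>inv l\<close>, so the bounds needed are
  one for Delta^L on \<open>D\<close> and one for Delta^G on the compact set of inverses.\<close>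

lemma inverse_weight_bounded:
  assumes D: "compactin (subtopology T L) D"
  obtains M where "\<And>l. l \<in> D \<Longrightarrow> inverse (weight (l <# K)) \<le> M"
proof -
  have D': "compactin T D" "D \<subseteq> L" using D by (auto simp: compactin_subtopology)
  obtain M1 where M1: "\<And>t. t \<in> D \<Longrightarrow> right_modulus (G\<lparr>carrier := L\<rparr>) \<kappa> t \<le> M1"
    using V.right_modulus_bounded[OF \<kappa> D] by metis
  obtain M2 where M2: "\<And>t. t \<in> (\<lambda>x. inv x) ` D \<Longrightarrow> right_modulus G \<mu> t \<le> M2"
    using right_modulus_bounded[OF \<mu> compactin_inv[OF D'(1)]] by metis
  have "inverse (weight (l <# K)) \<le> M1 * M2" if l: "l \<in> D" for l
  proof -
    have lL: "l \<in> L" using l D' by auto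
    have "inverse (weight (l <# K)) = right_modulus (G\<lparr>carrier := L\<rparr>) \<kappa> l * right_modulus G \<mu> (inv l)"
      using weight_eq[OF lL] right_modulus_inv[OF \<mu> L_carrier[OF lL]] by (simp add: mult.commute)
    also have "\<dots> \<le> M1 * M2"
    proof (rule mult_mono)
      show "right_modulus (G\<lparr>carrier := L\<rparr>) \<kappa> l \<le> M1" by (rule M1[OF l])
      show "right_modulus G \<mu> (inv l) \<le> M2" using l by (intro M2) auto
      show "0 \<le> M1" using M1[OF l] V.right_modulus_pos[OF \<kappa> lL] by simp
      show "0 \<le> right_modulus G \<mu> (inv l)"
        using right_modulus_pos[OF \<mu>, of "inv l"] L_carrier[OF lL] by simp
    qed
    finally show ?thesis .
  qed
  then show thesis by (rule that)
qed

text \<open>In \<open>factorization\<close> the set \<open>C\<close> is arbitrary. For one fixed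
  \<open>C\<close> of finite positive measure, division by that measure exhibits the factor
  depending on \<open>A\<close>, as the image under u of a measure with density.\<close>

lemma exists_invariant_factor:
  obtains mu_U where "invariant_measure H (\<lambda>h C. h <# C) TU mu_U"
    and "\<And>A B. A \<in> sets (borel_of TU) \<Longrightarrow> B \<in> sets (borel_of TV) \<Longrightarrow>
      (\<integral>\<^sup>+g. indicator A (u g) * indicator B (v g) \<partial>\<mu>) =
      emeasure mu_U A * (\<integral>\<^sup>+y. indicator B y * ennreal (weight y) \<partial>mu_V)"
proof -
  note [measurable_cong] = haar_sets[OF \<mu>]
  note [measurable] = measurable_u measurable_v
  have sp: "space \<mu> = carrier G" by (rule haar_space[OF \<mu>])
  obtain D where D: "compactin (subtopology T L) D"
    "0 < emeasure mu_V ((\<lambda>l. l <# K) ` D)" "emeasure mu_V ((\<lambda>l. l <# K) ` D) < \<infinity>"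
    by (rule mu_V_compact_pos)
  have D': "compactin T D" "D \<subseteq> L" using D by (auto simp: compactin_subtopology)
  define C where "C = (\<lambda>l. l <# K) ` D"
  have C [measurable]: "C \<in> sets (borel_of TV)"
    unfolding C_def by (intro closedin_in_borel_of V.closedin_proj_image D)
  obtain b where b: "emeasure mu_V C = ennreal b" "0 < b"
    using D(2,3) unfolding C_def
    by (cases "emeasure mu_V ((\<lambda>l. l <# K) ` D)") (auto simp: less_le)
  \<comment> \<open>This is the \<open>C\<close> part of the integrand in
    \<open>factorization\<close>, divided by the measure b of \<open>C\<close>. It depends on g
    through \<open>v g\<close> only, so left translation by \<open>H\<close> preserves it.\<close>
  define d where "d g = ennreal (inverse b) * (indicator C (v g) * ennreal (inverse (weight (v g))))" for g
  have d [measurable]: "d \<in> borel_measurable borelG" unfolding d_def by measurable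
  define mu_U where "mu_U = distr (density \<mu> d) (borel_of TU) (\<lambda>g. u g)"
  have em: "emeasure mu_U A = (\<integral>\<^sup>+g. indicator A (u g) * d g \<partial>\<mu>)"
    if [measurable]: "A \<in> sets (borel_of TU)" for A
  proof -
    have "emeasure mu_U A = emeasure (density \<mu> d) ((\<lambda>g. u g) -` A \<inter> space \<mu>)"
      unfolding mu_U_def by (subst emeasure_distr) auto
    also have "\<dots> = (\<integral>\<^sup>+g. d g * indicator ((\<lambda>g. u g) -` A \<inter> space \<mu>) g \<partial>\<mu>)"
      by (rule emeasure_density) measurable
    also have "\<dots> = (\<integral>\<^sup>+g. indicator A (u g) * d g \<partial>\<mu>)"
      by (rule nn_integral_cong) (auto simp: indicator_def)
    finally show ?thesis .
  qed
  have fac: "(\<integral>\<^sup>+g. indicator A (u g) * indicator B (v g) \<partial>\<mu>) =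
      emeasure mu_U A * (\<integral>\<^sup>+y. indicator B y * ennreal (weight y) \<partial>mu_V)"
    if A [measurable]: "A \<in> sets (borel_of TU)" and B: "B \<in> sets (borel_of TV)" for A B
  proof -
    let ?I = "\<integral>\<^sup>+g. indicator A (u g) * indicator B (v g) \<partial>\<mu>"
    let ?W = "\<integral>\<^sup>+y. indicator B y * ennreal (weight y) \<partial>mu_V"
    let ?J = "\<integral>\<^sup>+g. indicator A (u g) * indicator C (v g) * ennreal (inverse (weight (v g))) \<partial>\<mu>"
    have "emeasure mu_U A = (\<integral>\<^sup>+g. ennreal (inverse b) *
        (indicator A (u g) * indicator C (v g) * ennreal (inverse (weight (v g)))) \<partial>\<mu>)"
      unfolding em[OF A] d_def by (simp only: ac_simps)
    also have "\<dots> = ennreal (inverse b) * ?J" by (rule nn_integral_cmult) measurable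
    finally have "emeasure mu_U A * ?W = ennreal (inverse b) * (?J * ?W)" by (simp only: ac_simps)
    also have "\<dots> = ennreal (inverse b) * (?I * ennreal b)"
      by (simp only: factorization[OF A B C, unfolded b(1)])
    also have "\<dots> = ?I * (ennreal (inverse b) * ennreal b)" by (simp only: ac_simps)
    also have "ennreal (inverse b) * ennreal b = 1" using b(2) by (simp add: ennreal_mult[symmetric])
    finally show ?thesis by simp
  qed
  have "invariant_measure H (\<lambda>h C. h <# C) TU mu_U"
    unfolding invariant_measure_def
  proof (intro conjI ballI allI impI)
    show "sets mu_U = sets (borel_of TU)" by (simp add: mu_U_def)
  next
    fix a A assume a: "a \<in> H" and "A \<in> sets mu_U"
    then have A [measurable]: "A \<in> sets (borel_of TU)" by (simp add: mu_U_def)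
    note aA = U.translate_image_borelQ[OF a A]
    note [measurable] = aA(1)
    have ia: "inv\<^bsub>G\<lparr>carrier := H\<rparr>\<^esub> a = inv a" using subgroups(2) a by simp
    have "emeasure mu_U ((\<lambda>C. a <# C) ` A) =
        (\<integral>\<^sup>+g. indicator ((\<lambda>C. a <# C) ` A) (u g) * d g \<partial>\<mu>)"
      by (rule em[OF aA(1)])
    also have "\<dots> = (\<integral>\<^sup>+g. indicator ((\<lambda>C. a <# C) ` A) (u (a \<otimes> g)) * d (a \<otimes> g) \<partial>\<mu>)"
      by (rule haar_nn_integral_left[OF \<mu> H_carrier[OF a], symmetric]) measurable
    also have "\<dots> = (\<integral>\<^sup>+g. indicator A (u g) * d g \<partial>\<mu>)"
    proof (rule nn_integral_cong)
      fix g assume "g \<in> space \<mu>"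
      then have g: "g \<in> carrier G" by (simp add: sp)
      have iaH: "inv a \<in> H" using subgroup.m_inv_closed[OF subgroups(2) a] .
      have "u (a \<otimes> g) \<in> topspace TU"
        using measurable_space[OF measurable_u, of "a \<otimes> g"] g H_carrier[OF a] by auto
      then have "u (a \<otimes> g) \<in> (\<lambda>C. a <# C) ` A \<longleftrightarrow> inv a <# u (a \<otimes> g) \<in> A"
        unfolding aA(2) ia by simp
      also have "inv a <# u (a \<otimes> g) = u (inv a \<otimes> (a \<otimes> g))"
        using g a H_carrier[OF a] iaH by (intro uv_mult_left(1)[symmetric]) auto
      also have "inv a \<otimes> (a \<otimes> g) = g"
        using g H_carrier[OF a] by (simp add: m_assoc[symmetric])
      finally have "u (a \<otimes> g) \<in> (\<lambda>C. a <# C) ` A \<longleftrightarrow> u g \<in> A" .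
      then show "indicator ((\<lambda>C. a <# C) ` A) (u (a \<otimes> g)) * d (a \<otimes> g) = indicator A (u g) * d g"
        unfolding d_def uv_mult_left(2)[OF g a] by (simp add: indicator_def)
    qed
    finally show "emeasure mu_U ((\<lambda>C. a <# C) ` A) = emeasure mu_U A" by (simp only: em[OF A])
  next
    fix S assume S: "compactin TU S"
    show "emeasure mu_U S < \<infinity>"
    proof (cases "S \<in> sets (borel_of TU)")
      case True
      obtain E where E: "compactin (subtopology T H) E" "S \<subseteq> (\<lambda>g. g <# (H \<inter> K)) ` E"
        by (rule U.compact_subset_proj_image[OF S])
      have E': "compactin T E" "E \<subseteq> H" using E by (auto simp: compactin_subtopology)
      \<comment> \<open>If \<open>u g\<close> lies in \<open>S\<close> and \<open>v g\<close> in
        \<open>C\<close>, then g lies in \<open>E <#> D <#> K\<close>; there d is at most M / b, so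
        the integral is bounded by a constant times the Haar measure of a compact set.\<close>
      have cpt: "compactin T (E <#> D <#> K)"
        by (intro compactin_set_mult E' D' compact_K)
      obtain M where M: "\<And>l. l \<in> D \<Longrightarrow> inverse (weight (l <# K)) \<le> M"
        using inverse_weight_bounded[OF D(1)] by metis
      have "emeasure mu_U S = (\<integral>\<^sup>+g. indicator S (u g) * d g \<partial>\<mu>)" by (rule em[OF True])
      also have "\<dots> \<le> (\<integral>\<^sup>+g. (ennreal (inverse b) * ennreal M) * indicator (E <#> D <#> K) g \<partial>\<mu>)"
      proof (rule nn_integral_mono)
        fix g assume "g \<in> space \<mu>"
        then have g: "g \<in> carrier G" by (simp add: sp)
        show "indicator S (u g) * d g \<le> (ennreal (inverse b) * ennreal M) * indicator (E <#> D <#> K) g"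
        proof (cases "u g \<in> S \<and> v g \<in> C")
          case True
          obtain h l where hl: "h \<in> H" "l \<in> L" "g = h \<otimes> l" using decomposition[OF g] by blast
          have "h <# (H \<inter> K) \<in> S" "l <# K \<in> C" using True hl by (auto simp: u_of_eq v_of_eq)
          then obtain e c where ec: "e \<in> E" "c \<in> D" "h <# (H \<inter> K) = e <# (H \<inter> K)" "l <# K = c <# K"
            using E(2) unfolding C_def by auto
          have ec': "e \<in> H" "c \<in> L" using ec E' D' by auto
          have "g <# K = (e \<otimes> c) <# K"
            using product_coset_eq_iff[OF hl(1) ec'(1) hl(2) ec'(2)] ec hl(3) by simp
          then obtain k where k: "k \<in> K" "g = (e \<otimes> c) \<otimes> k"
            using Y.coset_eqD[of g "e \<otimes> c"] g ec' H_carrier L_carrier by auto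
          then have "g \<in> E <#> D <#> K" using ec by (auto simp: set_mult_def)
          moreover have "ennreal (inverse (weight (v g))) \<le> ennreal M"
            using M[OF ec(2)] hl ec(4) by (intro ennreal_leI) (simp add: v_of_eq)
          ultimately show ?thesis
            using True by (simp add: d_def mult_left_mono)
        next
          case False
          then show ?thesis by (auto simp: d_def indicator_def)
        qed
      qed
      also have "\<dots> = (ennreal (inverse b) * ennreal M) * emeasure \<mu> (E <#> D <#> K)"
        using compactin_in_borelG[OF cpt] by (intro nn_integral_cmult_indicator) (simp add: haar_sets[OF \<mu>])
      also have "\<dots> < \<infinity>"
        using haar_compact[OF \<mu> cpt] by (simp add: ennreal_mult_less_top)
      finally show ?thesis .
    qed (simp add: emeasure_notin_sets mu_U_def)
  next
    \<comment> \<open>The factorization for the full sets U and V reads off the Haar measure of the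
      whole group, which would be 0 if the measure on U were.\<close>
    have "indicator (topspace TU) (u g) * indicator (topspace TV) (v g) = (1 :: ennreal)"
      if "g \<in> carrier G" for g
      using measurable_space[OF measurable_u, of g] measurable_space[OF measurable_v, of g] that
      by (simp del: U.topspace_Q V.topspace_Q)
    then have "(\<integral>\<^sup>+g. indicator (topspace TU) (u g) * indicator (topspace TV) (v g) \<partial>\<mu>) =
        (\<integral>\<^sup>+g. 1 \<partial>\<mu>)"
      by (intro nn_integral_cong) (simp only: sp)
    also have "\<dots> \<noteq> 0" using haar_nonzero[OF \<mu>] by (simp add: sp)
    finally show "emeasure mu_U (space mu_U) \<noteq> 0"
      using fac[OF sets.top sets.top] by (auto simp: mu_U_def simp del: U.topspace_Q V.topspace_Q)
  qed
  then show thesis using fac by (rule that)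
qed

end

end

context coset_cross_section
begin

text \<open>Both factors are sigma-finite (the weight has finite values), so the factorization on
  rectangles determines the joint image measure.\<close>

lemma distr_uv_eq_pair_measure:
  assumes \<mu>: "left_haar_measure G T \<mu>"
    and \<kappa>: "left_haar_measure (G\<lparr>carrier := L\<rparr>) (subtopology T L) \<kappa>"
  obtains mu_U where "invariant_measure H (\<lambda>h C. h <# C) TU mu_U" "sigma_finite_measure mu_U"
    and "distr (distr \<mu> (borel_of TY) (\<lambda>g. g <# K)) (borel_of TU \<Otimes>\<^sub>M borel_of TV) (\<lambda>y. (u_of y, v_of y)) =
      mu_U \<Otimes>\<^sub>M density (mu_V \<kappa>) (\<lambda>y. ennreal (weight \<mu> \<kappa> y))"
proof -
  note [measurable] = weight_measurable[OF \<mu> \<kappa>] measurable_u_of measurable_v_of Y.measurable_proj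
  note [measurable_cong] = haar_sets[OF \<mu>] sets_mu_V[OF \<mu> \<kappa>]
  obtain mu_U where mu_U: "invariant_measure H (\<lambda>h C. h <# C) TU mu_U"
    and fac: "\<And>A B. A \<in> sets (borel_of TU) \<Longrightarrow> B \<in> sets (borel_of TV) \<Longrightarrow>
      (\<integral>\<^sup>+g. indicator A (u g) * indicator B (v g) \<partial>\<mu>) =
      emeasure mu_U A * (\<integral>\<^sup>+y. indicator B y * ennreal (weight \<mu> \<kappa> y) \<partial>mu_V \<kappa>)"
    by (rule exists_invariant_factor[OF \<mu> \<kappa>]) blast
  have sU: "sets mu_U = sets (borel_of TU)" using mu_U by (simp add: invariant_measure_def)
  have sfU: "sigma_finite_measure mu_U"
    using mu_U unfolding invariant_measure_def by (intro U.sigma_finite_borelQ) auto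
  interpret W: sigma_finite_measure "mu_V \<kappa>" by (rule sigma_finite_mu_V[OF \<mu> \<kappa>])
  have sfV: "sigma_finite_measure (density (mu_V \<kappa>) (\<lambda>y. ennreal (weight \<mu> \<kappa> y)))"
    by (subst W.sigma_finite_iff_density_finite) auto
  let ?Y = "distr \<mu> (borel_of TY) (\<lambda>g. g <# K)"
  let ?D = "distr ?Y (borel_of TU \<Otimes>\<^sub>M borel_of TV) (\<lambda>y. (u_of y, v_of y))"
  have "mu_U \<Otimes>\<^sub>M density (mu_V \<kappa>) (\<lambda>y. ennreal (weight \<mu> \<kappa> y)) = ?D"
  proof (rule pair_measure_eqI[OF sfU sfV])
    show "sets (mu_U \<Otimes>\<^sub>M density (mu_V \<kappa>) (\<lambda>y. ennreal (weight \<mu> \<kappa> y))) = sets ?D"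
      using sU sets_mu_V[OF \<mu> \<kappa>] by (simp cong: sets_pair_measure_cong)
  next
    fix A B assume "A \<in> sets mu_U" "B \<in> sets (density (mu_V \<kappa>) (\<lambda>y. ennreal (weight \<mu> \<kappa> y)))"
    then have A [measurable]: "A \<in> sets (borel_of TU)" and B [measurable]: "B \<in> sets (borel_of TV)"
      using sU sets_mu_V[OF \<mu> \<kappa>] by auto
    have "emeasure ?D (A \<times> B) = (\<integral>\<^sup>+p. indicator (A \<times> B) p \<partial>?D)" by simp
    also have "\<dots> = (\<integral>\<^sup>+y. indicator (A \<times> B) (u_of y, v_of y) \<partial>?Y)"
      by (rule nn_integral_distr) measurable
    also have "\<dots> = (\<integral>\<^sup>+g. indicator (A \<times> B) (u g, v g) \<partial>\<mu>)"
      by (rule nn_integral_distr) measurable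
    also have "\<dots> = (\<integral>\<^sup>+g. indicator A (u g) * indicator B (v g) \<partial>\<mu>)"
      by (simp add: indicator_times)
    also have "\<dots> = emeasure mu_U A * (\<integral>\<^sup>+y. indicator B y * ennreal (weight \<mu> \<kappa> y) \<partial>mu_V \<kappa>)"
      by (rule fac[OF A B])
    also have "(\<integral>\<^sup>+y. indicator B y * ennreal (weight \<mu> \<kappa> y) \<partial>mu_V \<kappa>) =
        emeasure (density (mu_V \<kappa>) (\<lambda>y. ennreal (weight \<mu> \<kappa> y))) B"
      by (subst emeasure_density) (simp_all add: mult.commute, measurable)
    finally show "emeasure mu_U A * emeasure (density (mu_V \<kappa>) (\<lambda>y. ennreal (weight \<mu> \<kappa> y))) B =
        emeasure ?D (A \<times> B)" ..
  qed
  then show thesis using that[OF mu_U sfU] by simp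
qed

end

section \<open>Products of three measures\<close>

text \<open>The hypothesis \<open>uv\<close> says that N, seen through (u, v), is already a product;
  densities in separate variables preserve this, and z is independent of y from the start. The last
  two factors are kept together, so a single test on sets \<open>A \<times> B\<close> with
  \<open>B\<close> measurable in the pair suffices.\<close>

lemma distr_density_product3:
  assumes "sigma_finite_measure N" and \<nu>: "sigma_finite_measure \<nu>"
    and "sigma_finite_measure P" and "sigma_finite_measure R"
    and u [measurable]: "u \<in> measurable N P" and v [measurable]: "v \<in> measurable N R"
    and uv: "distr N (P \<Otimes>\<^sub>M R) (\<lambda>y. (u y, v y)) = P \<Otimes>\<^sub>M R"
    and [measurable]: "a \<in> borel_measurable P" "b \<in> borel_measurable R" "c \<in> borel_measurable \<nu>"
    and fin: "\<And>x. a x \<noteq> \<infinity>" "\<And>x. b x \<noteq> \<infinity>" "\<And>x. c x \<noteq> \<infinity>"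
  shows "distr (density (N \<Otimes>\<^sub>M \<nu>) (\<lambda>(y, z). a (u y) * b (v y) * c z)) (P \<Otimes>\<^sub>M (R \<Otimes>\<^sub>M \<nu>))
      (\<lambda>(y, z). (u y, v y, z)) =
    density P a \<Otimes>\<^sub>M (density R b \<Otimes>\<^sub>M density \<nu> c)"
proof -
  interpret N: sigma_finite_measure N by fact
  interpret \<nu>: sigma_finite_measure \<nu> by fact
  interpret P: sigma_finite_measure P by fact
  interpret R: sigma_finite_measure R by fact
  have sa: "sigma_finite_measure (density P a)"
    using fin by (subst P.sigma_finite_iff_density_finite) auto
  have sb: "sigma_finite_measure (density R b)"
    using fin by (subst R.sigma_finite_iff_density_finite) auto
  have sc: "sigma_finite_measure (density \<nu> c)"
    using fin by (subst \<nu>.sigma_finite_iff_density_finite) auto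
  interpret N\<nu>: pair_sigma_finite N \<nu> ..
  interpret bc: pair_sigma_finite "density R b" "density \<nu> c"
    using sb sc by (rule pair_sigma_finite.intro)
  let ?D = "distr (density (N \<Otimes>\<^sub>M \<nu>) (\<lambda>(y, z). a (u y) * b (v y) * c z)) (P \<Otimes>\<^sub>M (R \<Otimes>\<^sub>M \<nu>))
      (\<lambda>(y, z). (u y, v y, z))"
  have "density P a \<Otimes>\<^sub>M (density R b \<Otimes>\<^sub>M density \<nu> c) = ?D"
  proof (rule pair_measure_eqI[OF sa])
    show "sigma_finite_measure (density R b \<Otimes>\<^sub>M density \<nu> c)" ..
    show "sets (density P a \<Otimes>\<^sub>M (density R b \<Otimes>\<^sub>M density \<nu> c)) = sets ?D"
      by (simp cong: sets_pair_measure_cong)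
  next
    fix A B assume "A \<in> sets (density P a)" "B \<in> sets (density R b \<Otimes>\<^sub>M density \<nu> c)"
    then have A [measurable]: "A \<in> sets P" and B [measurable]: "B \<in> sets (R \<Otimes>\<^sub>M \<nu>)"
      by (simp_all cong: sets_pair_measure_cong)
    \<comment> \<open>For fixed z the integrand depends on y only through (u, v); it is moved to P
      and R, where the part with A separates from the section of B at z.\<close>
    have inner: "(\<integral>\<^sup>+y. a (u y) * b (v y) * indicator A (u y) * indicator B (v y, z) \<partial>N) =
        emeasure (density P a) A * (\<integral>\<^sup>+s. b s * indicator B (s, z) \<partial>R)" if z: "z \<in> space \<nu>" for z
    proof -
      have [measurable]: "(\<lambda>s. indicator B (s, z) :: ennreal) \<in> borel_measurable R"
        using z by measurable
      have "(\<integral>\<^sup>+y. a (u y) * b (v y) * indicator A (u y) * indicator B (v y, z) \<partial>N) =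
          (\<integral>\<^sup>+y. (\<lambda>(r, s). a r * b s * indicator A r * indicator B (s, z)) (u y, v y) \<partial>N)"
        by simp
      also have "\<dots> = (\<integral>\<^sup>+p. (\<lambda>(r, s). a r * b s * indicator A r * indicator B (s, z)) p
          \<partial>distr N (P \<Otimes>\<^sub>M R) (\<lambda>y. (u y, v y)))"
        by (rule nn_integral_distr[symmetric]) measurable
      also have "\<dots> = (\<integral>\<^sup>+r. (\<integral>\<^sup>+s. a r * b s * indicator A r * indicator B (s, z) \<partial>R) \<partial>P)"
        unfolding uv by (subst R.nn_integral_fst[symmetric]) (simp_all, measurable)
      also have "\<dots> = (\<integral>\<^sup>+r. (\<integral>\<^sup>+s. (a r * indicator A r) * (b s * indicator B (s, z)) \<partial>R) \<partial>P)"
        by (simp only: ac_simps)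
      also have "\<dots> = (\<integral>\<^sup>+r. a r * indicator A r * (\<integral>\<^sup>+s. b s * indicator B (s, z) \<partial>R) \<partial>P)"
        by (intro nn_integral_cong nn_integral_cmult) measurable
      also have "\<dots> = (\<integral>\<^sup>+r. a r * indicator A r \<partial>P) * (\<integral>\<^sup>+s. b s * indicator B (s, z) \<partial>R)"
        by (rule nn_integral_multc) measurable
      also have "(\<integral>\<^sup>+r. a r * indicator A r \<partial>P) = emeasure (density P a) A"
        by (rule emeasure_density[symmetric]) measurable
      finally show ?thesis .
    qed
    have "emeasure ?D (A \<times> B) = (\<integral>\<^sup>+p. indicator (A \<times> B) p \<partial>?D)" by simp
    also have "\<dots> = (\<integral>\<^sup>+p. indicator (A \<times> B) ((\<lambda>(y, z). (u y, v y, z)) p)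
        \<partial>density (N \<Otimes>\<^sub>M \<nu>) (\<lambda>(y, z). a (u y) * b (v y) * c z))"
      by (rule nn_integral_distr) measurable
    also have "\<dots> = (\<integral>\<^sup>+p. (\<lambda>(y, z). a (u y) * b (v y) * c z) p *
        indicator (A \<times> B) ((\<lambda>(y, z). (u y, v y, z)) p) \<partial>(N \<Otimes>\<^sub>M \<nu>))"
      by (rule nn_integral_density) measurable
    also have "\<dots> = (\<integral>\<^sup>+p. (\<lambda>(y, z). a (u y) * b (v y) * indicator A (u y) * indicator B (v y, z) * c z) p
        \<partial>(N \<Otimes>\<^sub>M \<nu>))"
      by (intro nn_integral_cong) (auto simp: indicator_times ac_simps)
    also have "\<dots> = (\<integral>\<^sup>+z. (\<integral>\<^sup>+y. a (u y) * b (v y) * indicator A (u y) * indicator B (v y, z) * c z \<partial>N) \<partial>\<nu>)"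
      by (subst N\<nu>.nn_integral_snd[symmetric]) (simp_all, measurable)
    also have "\<dots> = (\<integral>\<^sup>+z. (\<integral>\<^sup>+y. a (u y) * b (v y) * indicator A (u y) * indicator B (v y, z) \<partial>N) * c z \<partial>\<nu>)"
      by (intro nn_integral_cong nn_integral_multc) measurable
    also have "\<dots> = (\<integral>\<^sup>+z. emeasure (density P a) A * (c z * (\<integral>\<^sup>+s. b s * indicator B (s, z) \<partial>R)) \<partial>\<nu>)"
    proof (rule nn_integral_cong)
      fix z assume z: "z \<in> space \<nu>"
      show "(\<integral>\<^sup>+y. a (u y) * b (v y) * indicator A (u y) * indicator B (v y, z) \<partial>N) * c z =
          emeasure (density P a) A * (c z * (\<integral>\<^sup>+s. b s * indicator B (s, z) \<partial>R))"
        by (simp only: inner[OF z]) (simp only: ac_simps)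
    qed
    also have "\<dots> = emeasure (density P a) A * (\<integral>\<^sup>+z. c z * (\<integral>\<^sup>+s. b s * indicator B (s, z) \<partial>R) \<partial>\<nu>)"
      by (rule nn_integral_cmult) measurable
    also have "(\<integral>\<^sup>+z. c z * (\<integral>\<^sup>+s. b s * indicator B (s, z) \<partial>R) \<partial>\<nu>) =
        (\<integral>\<^sup>+z. (\<integral>\<^sup>+s. indicator B (s, z) \<partial>density R b) \<partial>density \<nu> c)"
    proof -
      have "(\<integral>\<^sup>+z. (\<integral>\<^sup>+s. indicator B (s, z) \<partial>density R b) \<partial>density \<nu> c) =
          (\<integral>\<^sup>+z. c z * (\<integral>\<^sup>+s. indicator B (s, z) \<partial>density R b) \<partial>\<nu>)"
        using bc.M1.borel_measurable_nn_integral[of "\<lambda>z s. indicator B (s, z)" "density \<nu> c"]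
        by (intro nn_integral_density) simp_all
      also have "\<dots> = (\<integral>\<^sup>+z. c z * (\<integral>\<^sup>+s. b s * indicator B (s, z) \<partial>R) \<partial>\<nu>)"
        by (intro nn_integral_cong arg_cong2[where f="(*)"] refl nn_integral_density) measurable
      finally show ?thesis ..
    qed
    also have "\<dots> = emeasure (density R b \<Otimes>\<^sub>M density \<nu> c) B"
    proof -
      have "(\<lambda>(s, z). indicator B (s, z) :: ennreal) \<in> borel_measurable (density R b \<Otimes>\<^sub>M density \<nu> c)"
        by (simp cong: measurable_cong_sets sets_pair_measure_cong)
      from bc.nn_integral_snd[OF this] show ?thesis
        using B by (simp cong: sets_pair_measure_cong)
    qed
    finally show "emeasure (density P a) A * emeasure (density R b \<Otimes>\<^sub>M density \<nu> c) B =
        emeasure ?D (A \<times> B)" ..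
  qed
  then show ?thesis ..
qed

text \<open>P, Q and R are not normalised one by one; that M is a probability measure only gives the
  value 1 to the product of the three total masses.\<close>

lemma independent_tripleI_product:
  assumes "prob_space M"
    and a: "a \<in> measurable M A" and b: "b \<in> measurable M B" and c: "c \<in> measurable M C"
    and sets: "sets P = sets A" "sets Q = sets B" "sets R = sets C"
    and "sigma_finite_measure Q" "sigma_finite_measure R"
    and joint: "distr M (A \<Otimes>\<^sub>M (B \<Otimes>\<^sub>M C)) (\<lambda>\<omega>. (a \<omega>, b \<omega>, c \<omega>)) = P \<Otimes>\<^sub>M (Q \<Otimes>\<^sub>M R)"
  shows "independent_triple M A a B b C c"
proof -
  interpret prob_space M by fact
  interpret R: sigma_finite_measure R by fact
  interpret QR: pair_sigma_finite Q R using assms by (intro pair_sigma_finite.intro)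
  have sp: "space P = space A" "space Q = space B" "space R = space C"
    using sets sets_eq_imp_space_eq by blast+
  note [measurable] = a b c
  let ?E = "\<lambda>S V W. (a -` S \<inter> space M) \<inter> (b -` V \<inter> space M) \<inter> (c -` W \<inter> space M)"
  have rect: "emeasure M (?E S V W) = emeasure P S * (emeasure Q V * emeasure R W)"
    if [measurable]: "S \<in> sets A" "V \<in> sets B" "W \<in> sets C" for S V W
  proof -
    have "emeasure M (?E S V W) =
        emeasure (distr M (A \<Otimes>\<^sub>M (B \<Otimes>\<^sub>M C)) (\<lambda>\<omega>. (a \<omega>, b \<omega>, c \<omega>))) (S \<times> (V \<times> W))"
      by (subst emeasure_distr) (auto intro!: arg_cong[where f="emeasure M"])
    also have "\<dots> = emeasure P S * emeasure (Q \<Otimes>\<^sub>M R) (V \<times> W)"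
      unfolding joint using that sets by (intro QR.P.emeasure_pair_measure_Times) auto
    also have "emeasure (Q \<Otimes>\<^sub>M R) (V \<times> W) = emeasure Q V * emeasure R W"
      using that sets by (intro R.emeasure_pair_measure_Times) auto
    finally show ?thesis .
  qed
  let ?p = "emeasure P (space A)" and ?q = "emeasure Q (space B)" and ?r = "emeasure R (space C)"
  have full: "a -` space A \<inter> space M = space M" "b -` space B \<inter> space M = space M"
      "c -` space C \<inter> space M = space M"
    using measurable_space[OF a] measurable_space[OF b] measurable_space[OF c] by auto
  have one: "?p * (?q * ?r) = 1"
    using rect[OF sets.top sets.top sets.top] by (simp add: full emeasure_space_1)
  have prod: "prob (?E S V W) = prob (a -` S \<inter> space M) * prob (b -` V \<inter> space M) * prob (c -` W \<inter> space M)"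
    if S: "S \<in> sets A" and V: "V \<in> sets B" and W: "W \<in> sets C" for S V W
  proof -
    have "emeasure M (a -` S \<inter> space M) = emeasure P S * (?q * ?r)"
      using rect[OF S sets.top sets.top] by (simp add: full)
    moreover have "emeasure M (b -` V \<inter> space M) = ?p * (emeasure Q V * ?r)"
      using rect[OF sets.top V sets.top] by (simp add: full Int_absorb1)
    moreover have "emeasure M (c -` W \<inter> space M) = ?p * (?q * emeasure R W)"
      using rect[OF sets.top sets.top W] by (simp add: full Int_absorb1)
    \<comment> \<open>Each marginal carries the total masses of the other two factors; multiplied
      together these surplus masses give the square of their product, which is 1.\<close>
    ultimately have "emeasure M (a -` S \<inter> space M) * emeasure M (b -` V \<inter> space M) *
        emeasure M (c -` W \<inter> space M) =
        (?p * (?q * ?r)) * ((?p * (?q * ?r)) * (emeasure P S * (emeasure Q V * emeasure R W)))"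
      by (simp only: ac_simps)
    also have "\<dots> = emeasure M (?E S V W)" by (simp add: one rect[OF S V W])
    finally have "ennreal (prob (a -` S \<inter> space M)) * ennreal (prob (b -` V \<inter> space M)) *
        ennreal (prob (c -` W \<inter> space M)) = ennreal (prob (?E S V W))"
      by (simp only: emeasure_eq_measure)
    then show ?thesis by (simp add: ennreal_mult[symmetric])
  qed
  let ?F = "\<lambda>i. [{a -` S \<inter> space M | S. S \<in> sets A}, {b -` S \<inter> space M | S. S \<in> sets B},
      {c -` S \<inter> space M | S. S \<in> sets C}] ! i"
  have three: "{..<3::nat} = {0, 1, 2}" by auto
  have "indep_sets ?F {..<3}"
  proof (subst indep_sets_finite)
    show "{..<3::nat} \<noteq> {}" "finite {..<3::nat}" unfolding three by simp_all
    show "?F i \<subseteq> events" if "i \<in> {..<3}" for i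
      using that unfolding three by (auto intro: measurable_sets[OF a] measurable_sets[OF b] measurable_sets[OF c])
    show "space M \<in> ?F i" if "i \<in> {..<3}" for i
      using that full sets.top[of A] sets.top[of B] sets.top[of C] unfolding three
      by (elim insertE emptyE) (simp_all, blast+)
    show "\<forall>X\<in>Pi {..<3} ?F. prob (\<Inter>j\<in>{..<3}. X j) = (\<Prod>j\<in>{..<3}. prob (X j))"
    proof
      fix X assume X: "X \<in> Pi {..<3} ?F"
      obtain S where S: "S \<in> sets A" "X 0 = a -` S \<inter> space M" using Pi_mem[OF X, of 0] by auto
      obtain V where V: "V \<in> sets B" "X 1 = b -` V \<inter> space M" using Pi_mem[OF X, of 1] by auto
      obtain W where W: "W \<in> sets C" "X 2 = c -` W \<inter> space M" using Pi_mem[OF X, of 2] by auto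
      have "(\<Inter>j\<in>{..<3}. X j) = X 0 \<inter> X 1 \<inter> X 2" unfolding three by auto
      moreover have "(\<Prod>j\<in>{..<3}. prob (X j)) = prob (X 0) * prob (X 1) * prob (X 2)"
        unfolding three by (simp add: mult.assoc)
      ultimately show "prob (\<Inter>j\<in>{..<3}. X j) = (\<Prod>j\<in>{..<3}. prob (X j))"
        using prod[OF S(1) V(1) W(1)] S(2) V(2) W(2) by simp
    qed
  qed
  then show ?thesis using a b c by (simp add: independent_triple_def)
qed

section \<open>Double cosets and cross sections\<close>

text \<open>Equal isotropy makes the \<open>H\<close> part unique modulo \<open>H \<inter> K\<close>
  whichever representative occurs; disjointness of the double cosets makes the representative
  itself, and with it the \<open>L\<close> part modulo \<open>K\<close>, unique.\<close>

lemma (in group) double_coset_section: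
  assumes H: "subgroup H G" and K: "subgroup K G" and G': "G' \<subseteq> carrier G" "\<one> \<in> G'"
    and L: "L = G' <#> K"
    and cover: "carrier G = (\<Union>k\<in>G'. H <#> (k <# K))"
    and disj: "disjoint_family_on (\<lambda>k. H <#> (k <# K)) G'"
    and stab: "\<forall>k\<in>G'. \<forall>k'\<in>G'.
      stabilizer (G\<lparr>carrier := H\<rparr>) (\<lambda>h C. h <# C) (k <# K) =
      stabilizer (G\<lparr>carrier := H\<rparr>) (\<lambda>h C. h <# C) (k' <# K)"
  shows "K \<subseteq> L"
    and "g \<in> carrier G \<Longrightarrow> \<exists>h\<in>H. \<exists>l\<in>L. g = h \<otimes> l"
    and "\<lbrakk>h \<in> H; h' \<in> H; l \<in> L; l' \<in> L\<rbrakk> \<Longrightarrow>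
      (h \<otimes> l) <# K = (h' \<otimes> l') <# K \<longleftrightarrow> h <# (H \<inter> K) = h' <# (H \<inter> K) \<and> l <# K = l' <# K"
proof -
  have KG: "K \<subseteq> carrier G" by (rule subgroup.subset[OF K])
  have HG: "x \<in> carrier G" if "x \<in> H" for x by (rule subgroup.mem_carrier[OF H that])
  have HK: "subgroup (H \<inter> K) G" by (rule subgroups_Inter_pair[OF H K])
  show "K \<subseteq> L"
  proof
    fix k assume "k \<in> K"
    then have "k = \<one> \<otimes> k" using KG by auto
    then show "k \<in> L" using \<open>k \<in> K\<close> G'(2) unfolding L set_mult_def by blast
  qed
  {
    assume "g \<in> carrier G"
    then obtain k h c where khc: "k \<in> G'" "h \<in> H" "c \<in> K" "g = h \<otimes> (k \<otimes> c)"
      unfolding cover by (auto simp: set_mult_def l_coset_def)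
    then have "k \<otimes> c \<in> L" unfolding L set_mult_def by blast
    then show "\<exists>h\<in>H. \<exists>l\<in>L. g = h \<otimes> l" using khc by blast
  next
    assume h: "h \<in> H" "h' \<in> H" and l: "l \<in> L" "l' \<in> L"
    have repr: "\<exists>k\<in>G'. m <# K = k <# K \<and> m \<in> carrier G" if m: "m \<in> L" for m
    proof -
      obtain k c where kc: "k \<in> G'" "c \<in> K" "m = k \<otimes> c"
        using m unfolding L set_mult_def by auto
      then have "m \<in> k <# K" by (auto simp: l_coset_def)
      then have "k <# K = m <# K" using kc G'(1) K by (intro l_repr_independence) auto
      moreover have "m \<in> carrier G" using kc G'(1) KG by auto
      ultimately show ?thesis using kc(1) by auto
    qed
    obtain k where k: "k \<in> G'" "l <# K = k <# K" "l \<in> carrier G" using repr[OF l(1)] by auto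
    obtain k' where k': "k' \<in> G'" "l' <# K = k' <# K" "l' \<in> carrier G" using repr[OF l(2)] by auto
    have kG: "k \<in> carrier G" "k' \<in> carrier G" using k k' G'(1) by auto
    \<comment> \<open>The unit belongs to \<open>G'\<close>, so the common isotropy group is that of
      the coset \<open>K\<close>, namely \<open>H \<inter> K\<close>.\<close>
    have stab_iff: "a <# (k <# K) = k <# K \<longleftrightarrow> a \<in> K" if a: "a \<in> H" for a
    proof -
      have "a <# (k <# K) = k <# K \<longleftrightarrow> a <# (\<one> <# K) = \<one> <# K"
        using stab k(1) G'(2) a unfolding stabilizer_def set_eq_iff by auto
      also have "\<dots> \<longleftrightarrow> a <# K = K" by (simp add: lcos_mult_one[OF KG])
      also have "\<dots> \<longleftrightarrow> a \<in> K"
      proof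
        assume "a <# K = K"
        moreover have "a \<in> a <# K"
          using subgroup.one_closed[OF K] HG[OF a] by (force simp: l_coset_def)
        ultimately show "a \<in> K" by simp
      next
        assume "a \<in> K"
        then have "a \<in> \<one> <# K" by (simp add: lcos_mult_one[OF KG])
        from l_repr_independence[OF this one_closed K] show "a <# K = K"
          by (simp add: lcos_mult_one[OF KG])
      qed
      finally show ?thesis .
    qed
    have hl: "(h \<otimes> l) <# K = h <# (k <# K)" "(h' \<otimes> l') <# K = h' <# (k' <# K)"
      using lcos_m_assoc[OF KG] HG h k k' by metis+
    show "(h \<otimes> l) <# K = (h' \<otimes> l') <# K \<longleftrightarrow> h <# (H \<inter> K) = h' <# (H \<inter> K) \<and> l <# K = l' <# K"
    proof
      assume "(h \<otimes> l) <# K = (h' \<otimes> l') <# K"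
      then have eq: "h <# (k <# K) = h' <# (k' <# K)" using hl by simp
      have "k = k'"
      proof (rule ccontr)
        assume "k \<noteq> k'"
        have "k \<otimes> \<one> \<in> k <# K" using subgroup.one_closed[OF K] unfolding l_coset_def by blast
        then have "h \<otimes> (k \<otimes> \<one>) \<in> h <# (k <# K)" unfolding l_coset_def by blast
        moreover have "m <# C \<subseteq> H <#> C" if "m \<in> H" for m C
          using that by (auto simp: l_coset_def set_mult_def)
        ultimately have "h \<otimes> (k \<otimes> \<one>) \<in> (H <#> (k <# K)) \<inter> (H <#> (k' <# K))"
          using eq h by auto
        moreover have "(H <#> (k <# K)) \<inter> (H <#> (k' <# K)) = {}"
          by (rule disjoint_family_onD[OF disj k(1) k'(1) \<open>k \<noteq> k'\<close>])
        ultimately show False by simp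
      qed
      \<comment> \<open>With the same representative on both sides this element fixes
        \<open>k <# K\<close>, so \<open>stab_iff\<close> places it in
        \<open>H \<inter> K\<close>.\<close>
      let ?a = "inv h \<otimes> h'"
      have a: "?a \<in> H" using h H by (simp add: subgroup.m_closed subgroup.m_inv_closed)
      have kK: "k <# K \<subseteq> carrier G" using kG KG by (intro l_coset_subset_G)
      have "?a <# (k <# K) = inv h <# (h' <# (k <# K))"
        using HG h by (intro lcos_m_assoc[symmetric] kK) auto
      also have "\<dots> = inv h <# (h <# (k <# K))" using eq \<open>k = k'\<close> by simp
      also have "\<dots> = (inv h \<otimes> h) <# (k <# K)" using HG h by (intro lcos_m_assoc kK) auto
      also have "\<dots> = k <# K" using HG h by (simp add: lcos_mult_one[OF kK])
      finally have "?a \<in> H \<inter> K" using stab_iff[OF a] a by simp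
      moreover have "h' = h \<otimes> ?a" using HG h by (simp add: m_assoc[symmetric])
      ultimately have "h' \<in> h <# (H \<inter> K)" unfolding l_coset_def by blast
      then have "h <# (H \<inter> K) = h' <# (H \<inter> K)" using HG h HK by (intro l_repr_independence) auto
      then show "h <# (H \<inter> K) = h' <# (H \<inter> K) \<and> l <# K = l' <# K" using k k' \<open>k = k'\<close> by simp
    next
      assume eq: "h <# (H \<inter> K) = h' <# (H \<inter> K) \<and> l <# K = l' <# K"
      have "h' \<otimes> \<one> \<in> h' <# (H \<inter> K)"
        using subgroup.one_closed[OF HK] unfolding l_coset_def by blast
      then have "h' \<in> h <# (H \<inter> K)" using eq HG h by simp
      then obtain a where a: "a \<in> H" "a \<in> K" "h' = h \<otimes> a" unfolding l_coset_def by auto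
      have kK: "k <# K \<subseteq> carrier G" using kG KG by (intro l_coset_subset_G)
      have "h' <# (k' <# K) = h' <# (k <# K)" using eq k k' by simp
      also have "\<dots> = h <# (a <# (k <# K))"
        unfolding a(3) using HG h a by (intro lcos_m_assoc[symmetric] kK) auto
      also have "a <# (k <# K) = k <# K" using stab_iff[OF a(1)] a(2) by simp
      finally show "(h \<otimes> l) <# K = (h' \<otimes> l') <# K" using hl by simp
    qed
  }
qed

section \<open>Coordinates given by a global cross section\<close>

context group_action
begin

lemma global_cross_section_cases:
  assumes "global_cross_section G E \<phi> Z" "x \<in> E"
  obtains g z where "g \<in> carrier G" "z \<in> Z" "x = \<phi> g z"
proof -
  have "orbit G \<phi> x \<in> orbits G E \<phi>" using assms(2) by (auto simp: orbits_def)
  moreover have "\<forall>Q\<in>orbits G E \<phi>. \<exists>!z. z \<in> Q \<inter> Z"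
    using assms(1) unfolding global_cross_section_def cross_section_def by (elim conjE)
  ultimately obtain z where z: "z \<in> orbit G \<phi> x" "z \<in> Z" by (auto dest!: bspec ex1_implies_ex)
  then obtain g where g: "g \<in> carrier G" "\<phi> g x = z" by (auto simp: orbit_def)
  have "\<phi> (inv g) z = x" by (rule orbit_sym_aux[OF g(1) assms(2) g(2)])
  moreover have "inv g \<in> carrier G"
    using g(1) group_hom by (simp add: group_hom.axioms(1) group.inv_closed)
  ultimately show thesis using that[of "inv g" z] z(2) by simp
qed

text \<open>The element \<open>inv g' \<otimes> g\<close> carries z to z'. Thus both lie in one
  orbit and coincide, whereupon this element is in the common isotropy group.\<close>

lemma global_cross_section_unique:
  assumes Z: "global_cross_section G E \<phi> Z" and stab: "\<forall>z\<in>Z. stabilizer G \<phi> z = K"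
    and g: "g \<in> carrier G" "g' \<in> carrier G" and z: "z \<in> Z" "z' \<in> Z"
    and eq: "\<phi> g z = \<phi> g' z'"
  shows "z = z'" and "g <# K = g' <# K"
proof -
  interpret group G using group_hom by (rule group_hom.axioms(1))
  have zE: "z \<in> E" "z' \<in> E" using Z z unfolding global_cross_section_def cross_section_def by auto
  have z': "z' = \<phi> (inv g' \<otimes> g) z"
    using composition_rule[OF zE(1), of "inv g'" g] orbit_sym_aux[OF g(2) zE(2) eq[symmetric]] g
    by simp
  have "orbit G \<phi> z \<in> orbits G E \<phi>" using zE by (auto simp: orbits_def)
  moreover have "\<forall>Q\<in>orbits G E \<phi>. \<exists>!z. z \<in> Q \<inter> Z"
    using Z unfolding global_cross_section_def cross_section_def by (elim conjE)
  ultimately have "\<exists>!w. w \<in> orbit G \<phi> z \<inter> Z" by (rule bspec[rotated])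
  moreover have "z \<in> orbit G \<phi> z \<inter> Z" using orbit_refl[OF zE(1)] z by simp
  moreover have "z' \<in> orbit G \<phi> z \<inter> Z" using z' z g by (auto simp: orbit_def)
  ultimately show "z = z'" by blast
  have K: "subgroup K G" using stabilizer_subgroup[OF zE(1)] stab z by simp
  have "inv g' \<otimes> g \<in> stabilizer G \<phi> z" using z' \<open>z = z'\<close> g by (simp add: stabilizer_def)
  then have "inv g' \<otimes> g \<in> K" using stab z by simp
  moreover have "g = g' \<otimes> (inv g' \<otimes> g)" using g by (simp add: m_assoc[symmetric])
  ultimately have "g \<in> g' <# K" unfolding l_coset_def by blast
  then show "g <# K = g' <# K" using l_repr_independence[OF _ g(2) K] by simp
qed

lemma yz_coords_eq:
  assumes "global_cross_section G E \<phi> Z" "\<forall>z\<in>Z. stabilizer G \<phi> z = K"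
    and "g \<in> carrier G" "z \<in> Z"
  shows "yz_coords G \<phi> K Z (\<phi> g z) = (g <# K, z)"
  unfolding yz_coords_def
proof (rule the_equality)
  show "\<exists>g'\<in>carrier G. \<exists>z'\<in>Z. \<phi> g z = \<phi> g' z' \<and> (g <# K, z) = (g' <# K, z')"
    using assms by blast
  fix p assume "\<exists>g'\<in>carrier G. \<exists>z'\<in>Z. \<phi> g z = \<phi> g' z' \<and> p = (g' <# K, z')"
  then obtain g' z' where "g' \<in> carrier G" "z' \<in> Z" "\<phi> g z = \<phi> g' z'" "p = (g' <# K, z')"
    by blast
  then show "p = (g <# K, z)" using global_cross_section_unique[OF assms(1-3) _ assms(4)] by metis
qed

end

text \<open>The coordinates u and v of x factor through its y coordinate. Their measurability on X
  thus comes from the assumed measurability of (y, z) and from that of \<open>u_of\<close> and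
  \<open>v_of\<close>.\<close>

lemma (in coset_cross_section) uvz_coords_eq:
  assumes act: "group_action G E \<phi>"
    and Z: "global_cross_section G E \<phi> Z" "\<forall>z\<in>Z. stabilizer G \<phi> z = K" and x: "x \<in> E"
  shows "uvz_coords G \<phi> K H L Z x =
    (u_of (fst (yz_coords G \<phi> K Z x)), v_of (fst (yz_coords G \<phi> K Z x)), snd (yz_coords G \<phi> K Z x))"
proof -
  interpret group_action G E \<phi> by (rule act)
  obtain g z where gz: "g \<in> carrier G" "z \<in> Z" "x = \<phi> g z"
    by (rule global_cross_section_cases[OF Z(1) x])
  obtain h l where hl: "h \<in> H" "l \<in> L" "g = h \<otimes> l" using decomposition[OF gz(1)] by blast
  have "uvz_coords G \<phi> K H L Z x = (h <# (H \<inter> K), l <# K, z)"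
    unfolding uvz_coords_def
  proof (rule the_equality)
    show "\<exists>h'\<in>H. \<exists>l'\<in>L. \<exists>z'\<in>Z. x = \<phi> (h' \<otimes> l') z' \<and>
        (h <# (H \<inter> K), l <# K, z) = (h' <# (H \<inter> K), l' <# K, z')"
      using gz hl by blast
    fix p assume "\<exists>h'\<in>H. \<exists>l'\<in>L. \<exists>z'\<in>Z. x = \<phi> (h' \<otimes> l') z' \<and> p = (h' <# (H \<inter> K), l' <# K, z')"
    then obtain h' l' z' where p: "h' \<in> H" "l' \<in> L" "z' \<in> Z" "x = \<phi> (h' \<otimes> l') z'"
        "p = (h' <# (H \<inter> K), l' <# K, z')" by blast
    have hl': "h' \<otimes> l' \<in> carrier G" using p H_carrier L_carrier by simp
    have eq: "\<phi> g z = \<phi> (h' \<otimes> l') z'" using gz p by simp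
    have "z = z'" "(h \<otimes> l) <# K = (h' \<otimes> l') <# K"
      using global_cross_section_unique[OF Z gz(1) hl' gz(2) p(3) eq] hl(3) by auto
    then show "p = (h <# (H \<inter> K), l <# K, z)"
      using product_coset_eq_iff[OF hl(1) p(1) hl(2) p(2)] p(5) by simp
  qed
  then show ?thesis
    using yz_coords_eq[OF Z gz(1,2)] gz(3) hl by (simp add: u_of_eq v_of_eq)
qed

theorem theorem3p4:
  fixes G :: "('g, 'm) monoid_scheme"
    and TG :: "'g topology"
    and TX :: "'x topology"
    and \<phi> :: "'g \<Rightarrow> 'x \<Rightarrow> 'x"
    and Z :: "'x set"
    and G\<^sub>0 G' H L :: "'g set"
    and TY TU TV :: "'g set topology"
    and TZ :: "'x topology"
    and \<Lambda> \<nu>\<^sub>Z :: "'x measure"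
    and \<mu>\<^sub>G \<mu>\<^sub>L :: "'g measure"
    and \<mu>\<^sub>Y :: "'g set measure"
    and chi :: "'g \<Rightarrow> real"
    and f\<^sub>U f\<^sub>V :: "'g set \<Rightarrow> real"
    and f\<^sub>Z :: "'x \<Rightarrow> real"
    and M :: "'w measure"
    and X :: "'w \<Rightarrow> 'x"
  \<comment> \<open>the group, the space and the action\<close>
  assumes "topological_group G TG"
    and "second_countable TG" "locally_compact_space TG" "Hausdorff_space TG"
    and "locally_compact_space TX" "Hausdorff_space TX"
    and "group_action G (topspace TX) \<phi>"
    and "continuous_map (prod_topology TG TX) TX (\<lambda>(g, x). \<phi> g x)"
  \<comment> \<open>the global cross section and the coset space \<open>Y\<close>\<close>
    and "global_cross_section G (topspace TX) \<phi> Z"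
    and "\<forall>z\<in>Z. stabilizer G \<phi> z = G\<^sub>0"
    and "compactin TG G\<^sub>0"
    and "TY = coset_space G TG G\<^sub>0"
    and "TZ = subtopology TX Z"
    and "locally_compact_space TZ"
    and "bimeasurable (yz_coords G \<phi> G\<^sub>0 Z) (borel_of TX) (borel_of TY \<Otimes>\<^sub>M borel_of TZ)"
  \<comment> \<open>the subgroups \<open>H\<close> and \<open>L\<close>\<close>
    and "subgroup H G" "closedin TG H"
    and "subgroup L G" "closedin TG L"
    and "G' \<subseteq> carrier G" "\<one>\<^bsub>G\<^esub> \<in> G'"
    and "L = G' <#>\<^bsub>G\<^esub> G\<^sub>0"
    and "carrier G = (\<Union>k\<in>G'. H <#>\<^bsub>G\<^esub> (k <#\<^bsub>G\<^esub> G\<^sub>0))"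
    and "disjoint_family_on (\<lambda>k. H <#>\<^bsub>G\<^esub> (k <#\<^bsub>G\<^esub> G\<^sub>0)) G'"
    and "\<forall>k\<in>G'. \<forall>k'\<in>G'.
           stabilizer (G\<lparr>carrier := H\<rparr>) (\<lambda>h C. h <#\<^bsub>G\<^esub> C) (k <#\<^bsub>G\<^esub> G\<^sub>0) =
           stabilizer (G\<lparr>carrier := H\<rparr>) (\<lambda>h C. h <#\<^bsub>G\<^esub> C) (k' <#\<^bsub>G\<^esub> G\<^sub>0)"
    and "compactin TG (H \<inter> L)"
    and "TU = coset_space G (subtopology TG H) (H \<inter> G\<^sub>0)"
    and "TV = coset_space G (subtopology TG L) G\<^sub>0"
  \<comment> \<open>the measures\<close>
    and "continuous_map TG euclideanreal chi"
    and "\<forall>g\<in>carrier G. 0 < chi g"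
    and "\<forall>g\<in>carrier G. \<forall>g'\<in>carrier G. chi (g \<otimes>\<^bsub>G\<^esub> g') = chi g * chi g'"
    and "sets \<Lambda> = sets (borel_of TX)"
    and "\<forall>g\<in>carrier G. \<forall>B\<in>sets \<Lambda>. emeasure \<Lambda> (\<phi> g ` B) = ennreal (chi g) * emeasure \<Lambda> B"
    and "left_haar_measure G TG \<mu>\<^sub>G"
    and "\<mu>\<^sub>Y = distr \<mu>\<^sub>G (borel_of TY) (\<lambda>g. g <#\<^bsub>G\<^esub> G\<^sub>0)"
    and "prob_space \<nu>\<^sub>Z" "sets \<nu>\<^sub>Z = sets (borel_of TZ)"
    and "distr \<Lambda> (borel_of TY \<Otimes>\<^sub>M borel_of TZ) (yz_coords G \<phi> G\<^sub>0 Z) =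
           density \<mu>\<^sub>Y (\<lambda>y. ennreal (on_coset chi y)) \<Otimes>\<^sub>M \<nu>\<^sub>Z"
    and "left_haar_measure (G\<lparr>carrier := L\<rparr>) (subtopology TG L) \<mu>\<^sub>L"
  \<comment> \<open>the random element \<open>X\<close> and its distribution\<close>
    and "f\<^sub>U \<in> borel_measurable (borel_of TU)" "\<forall>u\<in>topspace TU. 0 \<le> f\<^sub>U u"
    and "f\<^sub>V \<in> borel_measurable (borel_of TV)" "\<forall>v\<in>topspace TV. 0 \<le> f\<^sub>V v"
    and "f\<^sub>Z \<in> borel_measurable (borel_of TZ)" "\<forall>z\<in>topspace TZ. 0 \<le> f\<^sub>Z z"
    and "prob_space M"
    and "X \<in> measurable M (borel_of TX)"
    and "distr M (borel_of TX) X =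
           extended_decomposable_distribution G \<phi> G\<^sub>0 H L Z \<Lambda> f\<^sub>U f\<^sub>V f\<^sub>Z"
  shows "independent_triple M
           (borel_of TU) (\<lambda>\<omega>. u_coord G \<phi> G\<^sub>0 H L Z (X \<omega>))
           (borel_of TV) (\<lambda>\<omega>. v_coord G \<phi> G\<^sub>0 H L Z (X \<omega>))
           (borel_of TZ) (\<lambda>\<omega>. z_coord G \<phi> G\<^sub>0 H L Z (X \<omega>)) \<and>
         (\<exists>\<mu>\<^sub>U \<mu>\<^sub>V.
           invariant_measure H (\<lambda>h C. h <#\<^bsub>G\<^esub> C) TU \<mu>\<^sub>U \<and>
           invariant_measure L (\<lambda>l C. l <#\<^bsub>G\<^esub> C) TV \<mu>\<^sub>V \<and>
           distr M (borel_of TU \<Otimes>\<^sub>M (borel_of TV \<Otimes>\<^sub>M borel_of TZ))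
             (\<lambda>\<omega>. (u_coord G \<phi> G\<^sub>0 H L Z (X \<omega>),
                   v_coord G \<phi> G\<^sub>0 H L Z (X \<omega>),
                   z_coord G \<phi> G\<^sub>0 H L Z (X \<omega>))) =
           density \<mu>\<^sub>U (\<lambda>u. ennreal (f\<^sub>U u * on_coset chi u)) \<Otimes>\<^sub>M
           (density \<mu>\<^sub>V (\<lambda>v. ennreal (f\<^sub>V v * on_coset chi v *
                on_coset (right_modulus G \<mu>\<^sub>G) v *
                inverse (on_coset (right_modulus (G\<lparr>carrier := L\<rparr>) \<mu>\<^sub>L) v))) \<Otimes>\<^sub>M
            density \<nu>\<^sub>Z (\<lambda>z. ennreal (f\<^sub>Z z))))"
proof -
  note sc = assms(2) and lc = assms(3) and hd = assms(4) and act = assms(7)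
    and cross = assms(9) and stab = assms(10) and cK = assms(11)
    and H = assms(16,17) and L = assms(18,19) and G' = assms(20,21)
    and chi_cont = assms(29) and chi_pos = assms(30)[rule_format] and chi_mult = assms(31)[rule_format]
    and sets_\<Lambda> = assms(32) and haar_G = assms(34) and \<mu>\<^sub>Y = assms(35)
    and sets_\<nu> = assms(37) and distr_\<Lambda> = assms(38) and haar_L = assms(39)
    and fU = assms(40) assms(41)[rule_format] and fV = assms(42) assms(43)[rule_format]
    and fZ = assms(44) assms(45)[rule_format] and X = assms(47) and distr_X = assms(48)
  interpret topological_group G TG by fact
  interpret act: group_action G "topspace TX" \<phi> by fact
  interpret \<nu>: prob_space \<nu>\<^sub>Z by fact
  have sp_\<nu>: "space \<nu>\<^sub>Z = topspace TX \<inter> Z" using sets_eq_imp_space_eq[OF sets_\<nu>] assms(13) by simp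
  \<comment> \<open>A probability space is nonempty, so Z has a point; its stabilizer is
    \<open>G\<^sub>0\<close>, which is how \<open>G\<^sub>0\<close> is seen to be a
    subgroup.\<close>
  then obtain z0 where z0: "z0 \<in> Z" "z0 \<in> topspace TX" using \<nu>.not_empty by auto
  have K: "subgroup G\<^sub>0 G" using act.stabilizer_subgroup[OF z0(2)] stab z0(1) by simp
  note dcs = double_coset_section[OF H(1) K G' assms(22-25)]
  interpret coset_cross_section G TG G\<^sub>0 H L
    by (intro coset_cross_section.intro lcsc_group.intro lcsc_group_axioms.intro
        coset_cross_section_axioms.intro topological_group_axioms sc lc hd K H L cK dcs)
  have TY: "TY = coset_space G TG G\<^sub>0" and TU: "TU = coset_space G (subtopology TG H) (H \<inter> G\<^sub>0)"
    and TV: "TV = coset_space G (subtopology TG L) G\<^sub>0"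
    by fact+
  let ?U = "borel_of TU" and ?V = "borel_of TV" and ?Y = "borel_of TY" and ?Z = "borel_of TZ"
  let ?uvz = "\<lambda>x. (u_coord G \<phi> G\<^sub>0 H L Z x, v_coord G \<phi> G\<^sub>0 H L Z x, z_coord G \<phi> G\<^sub>0 H L Z x)"
  let ?yz = "yz_coords G \<phi> G\<^sub>0 Z"
  let ?split = "\<lambda>(y, z). (u_of y, v_of y, z)"
  have yz [measurable]: "?yz \<in> measurable (borel_of TX) (?Y \<Otimes>\<^sub>M ?Z)"
    using assms(15) by (simp add: bimeasurable_def)
  have [measurable]: "u_of \<in> measurable ?Y ?U" "v_of \<in> measurable ?Y ?V"
    using measurable_u_of measurable_v_of by (simp_all only: TY TU TV)
  have uvz_eq: "?uvz x = ?split (?yz x)" if "x \<in> topspace TX" for x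
    using uvz_coords_eq[OF act cross stab that]
    by (simp add: u_coord_def v_coord_def z_coord_def case_prod_beta)
  have uvz [measurable]: "?uvz \<in> measurable (borel_of TX) (?U \<Otimes>\<^sub>M (?V \<Otimes>\<^sub>M ?Z))"
  proof -
    have "(\<lambda>x. ?split (?yz x)) \<in> measurable (borel_of TX) (?U \<Otimes>\<^sub>M (?V \<Otimes>\<^sub>M ?Z))" by measurable
    then show ?thesis by (subst measurable_cong[where g="\<lambda>x. ?split (?yz x)"]) (simp_all add: uvz_eq)
  qed

  \<comment> \<open>The multiplier on the three coset spaces\<close>
  have chi_K: "chi k = 1" if "k \<in> G\<^sub>0" for k
  proof -
    have "compactin euclideanreal (chi ` G\<^sub>0)" by (rule image_compactin[OF cK chi_cont])
    then have "bounded (chi ` G\<^sub>0)" by (simp add: compact_imp_bounded)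
    then obtain B where B: "\<And>x. x \<in> G\<^sub>0 \<Longrightarrow> \<bar>chi x\<bar> \<le> B"
      by (auto simp: bounded_iff)
    show ?thesis
    proof (rule bounded_multiplicative_eq_1[OF K _ _ _ that])
      show "chi x \<le> B" if "x \<in> G\<^sub>0" for x using B[OF that] by simp
    qed (use chi_pos chi_mult Y.K_subset in auto)
  qed
  have chi_mult_K: "chi (x \<otimes>\<^bsub>G\<^esub> k) = chi x" if "x \<in> carrier G" "k \<in> G\<^sub>0" for x k
    using that chi_mult chi_K Y.K_subset by auto
  have chi_Y: "on_coset chi (g <#\<^bsub>G\<^esub> G\<^sub>0) = chi g" if "g \<in> carrier G" for g
    using that chi_mult_K by (intro Y.on_coset_eq) auto
  have chi_U: "on_coset chi (h <#\<^bsub>G\<^esub> (H \<inter> G\<^sub>0)) = chi h" if "h \<in> H" for h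
    using that chi_mult_K H_carrier by (intro U.on_coset_eq) auto
  have chi_uv: "on_coset chi y = on_coset chi (u_of y) * on_coset chi (v_of y)"
    and chi_u_pos: "0 < on_coset chi (u_of y)" and chi_v_pos: "0 < on_coset chi (v_of y)"
    if y: "y \<in> topspace TY" for y
  proof -
    obtain h l where hl: "h \<in> H" "l \<in> L" "y = (h \<otimes>\<^bsub>G\<^esub> l) <#\<^bsub>G\<^esub> G\<^sub>0"
      by (rule topspace_TY_cases[OF y[unfolded TY]])
    have G: "h \<in> carrier G" "l \<in> carrier G" using hl H_carrier L_carrier by auto
    show "on_coset chi y = on_coset chi (u_of y) * on_coset chi (v_of y)"
      "0 < on_coset chi (u_of y)" "0 < on_coset chi (v_of y)"
      using hl G chi_pos by (simp_all add: u_of_eq v_of_eq chi_Y chi_U chi_mult del: Int_iff)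
  qed
  have chi_pos_U: "0 < on_coset chi C" if "C \<in> topspace TU" for C
    using that chi_U chi_pos H_carrier unfolding TU U.topspace_Q by auto
  have chi_pos_V: "0 < on_coset chi C" if "C \<in> topspace TV" for C
    using that chi_Y chi_pos L_carrier unfolding TV V.topspace_Q by auto
  have chi_meas [measurable]: "on_coset chi \<in> borel_measurable ?Y" "on_coset chi \<in> borel_measurable ?U"
      "on_coset chi \<in> borel_measurable ?V"
  proof -
    show "on_coset chi \<in> borel_measurable ?Y" unfolding TY
      by (intro measurable_borel_of_real Y.continuous_on_coset chi_cont chi_mult_K)
    show "on_coset chi \<in> borel_measurable ?U" unfolding TU
      using chi_mult_K H_carrier
      by (intro measurable_borel_of_real U.continuous_on_coset continuous_map_from_subtopology chi_cont) auto
    show "on_coset chi \<in> borel_measurable ?V" unfolding TV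
      using chi_mult_K L_carrier
      by (intro measurable_borel_of_real V.continuous_on_coset continuous_map_from_subtopology chi_cont) auto
  qed

  \<comment> \<open>Factorization of the measure on Y together with the multiplier\<close>
  obtain \<mu>\<^sub>U where inv_U: "invariant_measure H (\<lambda>h C. h <#\<^bsub>G\<^esub> C) TU \<mu>\<^sub>U" and sf_U: "sigma_finite_measure \<mu>\<^sub>U"
    and fac: "distr \<mu>\<^sub>Y (?U \<Otimes>\<^sub>M ?V) (\<lambda>y. (u_of y, v_of y)) =
      \<mu>\<^sub>U \<Otimes>\<^sub>M density (mu_V \<mu>\<^sub>L) (\<lambda>y. ennreal (weight \<mu>\<^sub>G \<mu>\<^sub>L y))"
    unfolding TU TV \<mu>\<^sub>Y TY by (rule distr_uv_eq_pair_measure[OF haar_G haar_L])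
  define \<mu>\<^sub>V where "\<mu>\<^sub>V = mu_V \<mu>\<^sub>L"
  let ?w = "weight \<mu>\<^sub>G \<mu>\<^sub>L"
  have weight_eq_modulus: "?w C = on_coset (right_modulus G \<mu>\<^sub>G) C *
      inverse (on_coset (right_modulus (G\<lparr>carrier := L\<rparr>) \<mu>\<^sub>L) C)" for C
    by (rule weight_def[OF haar_G haar_L])
  define W where "W = density \<mu>\<^sub>V (\<lambda>y. ennreal (?w y))"
  have inv_V: "invariant_measure L (\<lambda>l C. l <#\<^bsub>G\<^esub> C) TV \<mu>\<^sub>V"
    unfolding \<mu>\<^sub>V_def TV by (rule invariant_mu_V[OF haar_G haar_L])
  have sets_U: "sets \<mu>\<^sub>U = sets ?U" and sets_V: "sets \<mu>\<^sub>V = sets ?V"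
    using inv_U inv_V by (auto simp: invariant_measure_def)
  have sets_Y: "sets \<mu>\<^sub>Y = sets ?Y" by (simp add: \<mu>\<^sub>Y)
  have sets_W: "sets W = sets ?V" by (simp add: W_def sets_V)
  note [measurable_cong] = sets_U sets_V sets_Y sets_W sets_\<Lambda> sets_\<nu>
  note [measurable] = fU(1) fV(1) fZ(1) X
  have [measurable]: "?w \<in> borel_measurable ?V"
    unfolding TV by (rule weight_measurable[OF haar_G haar_L])
  interpret U: sigma_finite_measure \<mu>\<^sub>U by (rule sf_U)
  interpret V: sigma_finite_measure \<mu>\<^sub>V unfolding \<mu>\<^sub>V_def by (rule sigma_finite_mu_V[OF haar_G haar_L])
  interpret W: sigma_finite_measure W
    unfolding W_def by (subst V.sigma_finite_iff_density_finite) auto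
  interpret Y: sigma_finite_measure \<mu>\<^sub>Y
    using Y.invariant_measure_proj[OF haar_G] unfolding \<mu>\<^sub>Y TY invariant_measure_def
    by (intro Y.sigma_finite_borelQ) auto

  \<comment> \<open>The multiplier is absorbed into the measures on Y, U and V (the last one with
    the weight already included in \<open>W\<close>), so that only the factors f remain as
    densities.\<close>
  define N where "N = density \<mu>\<^sub>Y (\<lambda>y. ennreal (on_coset chi y))"
  define P where "P = density \<mu>\<^sub>U (\<lambda>C. ennreal (on_coset chi C))"
  define R where "R = density W (\<lambda>C. ennreal (on_coset chi C))"
  have sf: "sigma_finite_measure N" "sigma_finite_measure P" "sigma_finite_measure R"
    unfolding N_def P_def R_def
    by (auto simp: Y.sigma_finite_iff_density_finite U.sigma_finite_iff_density_finite
        W.sigma_finite_iff_density_finite)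
  have sets_N: "sets N = sets ?Y" and sets_P: "sets P = sets ?U" and sets_R: "sets R = sets ?V"
    by (simp_all add: N_def P_def R_def sets_Y sets_U sets_W)
  note [measurable_cong] = sets_N sets_P sets_R
  have uv: "distr N (P \<Otimes>\<^sub>M R) (\<lambda>y. (u_of y, v_of y)) = P \<Otimes>\<^sub>M R"
  proof -
    have "P \<Otimes>\<^sub>M R = density (\<mu>\<^sub>U \<Otimes>\<^sub>M W) (\<lambda>(C, D). ennreal (on_coset chi C) * ennreal (on_coset chi D))"
      unfolding P_def R_def
      by (rule pair_measure_density) (measurable, use sf(3) in \<open>simp_all add: R_def W.sigma_finite_measure_axioms\<close>)
    also have "\<mu>\<^sub>U \<Otimes>\<^sub>M W = distr \<mu>\<^sub>Y (?U \<Otimes>\<^sub>M ?V) (\<lambda>y. (u_of y, v_of y))"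
      by (simp add: fac W_def \<mu>\<^sub>V_def)
    \<comment> \<open>A density that is a function of (u, v) may be applied before taking the image;
      there it equals the multiplier at y, by \<open>chi_uv\<close>.\<close>
    also have "density \<dots> (\<lambda>(C, D). ennreal (on_coset chi C) * ennreal (on_coset chi D)) =
        distr (density \<mu>\<^sub>Y (\<lambda>y. (\<lambda>(C, D). ennreal (on_coset chi C) * ennreal (on_coset chi D)) (u_of y, v_of y)))
          (?U \<Otimes>\<^sub>M ?V) (\<lambda>y. (u_of y, v_of y))"
      by (rule density_distr) measurable
    also have "density \<mu>\<^sub>Y (\<lambda>y. (\<lambda>(C, D). ennreal (on_coset chi C) * ennreal (on_coset chi D)) (u_of y, v_of y)) = N"
      unfolding N_def
    proof (rule density_cong)
      show "AE y in \<mu>\<^sub>Y. (\<lambda>(C, D). ennreal (on_coset chi C) * ennreal (on_coset chi D)) (u_of y, v_of y) =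
          ennreal (on_coset chi y)"
      proof (rule AE_I2)
        fix y assume "y \<in> space \<mu>\<^sub>Y"
        then have y: "y \<in> topspace TY" using sets_eq_imp_space_eq[OF sets_Y] by simp
        show "(\<lambda>(C, D). ennreal (on_coset chi C) * ennreal (on_coset chi D)) (u_of y, v_of y) =
          ennreal (on_coset chi y)"
          using chi_uv[OF y] chi_u_pos[OF y] chi_v_pos[OF y] by (simp add: ennreal_mult)
      qed
    qed measurable
    also have "distr N (?U \<Otimes>\<^sub>M ?V) (\<lambda>y. (u_of y, v_of y)) = distr N (P \<Otimes>\<^sub>M R) (\<lambda>y. (u_of y, v_of y))"
      by (intro distr_cong refl sets_pair_measure_cong sets_P[symmetric] sets_R[symmetric])
    finally show ?thesis ..
  qed
  let ?F = "\<lambda>(y, z). ennreal (f\<^sub>U (u_of y)) * ennreal (f\<^sub>V (v_of y)) * ennreal (f\<^sub>Z z)"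
  have product: "distr (density (N \<Otimes>\<^sub>M \<nu>\<^sub>Z) ?F) (P \<Otimes>\<^sub>M (R \<Otimes>\<^sub>M \<nu>\<^sub>Z)) ?split =
      density P (\<lambda>C. ennreal (f\<^sub>U C)) \<Otimes>\<^sub>M
      (density R (\<lambda>C. ennreal (f\<^sub>V C)) \<Otimes>\<^sub>M density \<nu>\<^sub>Z (\<lambda>z. ennreal (f\<^sub>Z z)))"
    by (rule distr_density_product3[OF sf(1) \<nu>.sigma_finite_measure_axioms sf(2,3) _ _ uv]; (measurable | simp))

  \<comment> \<open>The law of X carried through (y, z) to (u, v, z)\<close>
  have "distr M (?U \<Otimes>\<^sub>M (?V \<Otimes>\<^sub>M ?Z)) (\<lambda>\<omega>. ?uvz (X \<omega>)) =
      distr (distr M (borel_of TX) X) (?U \<Otimes>\<^sub>M (?V \<Otimes>\<^sub>M ?Z)) ?uvz"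
    using distr_distr[OF uvz X] by (simp add: o_def)
  also have "distr M (borel_of TX) X = density \<Lambda> (\<lambda>x. ?F (?yz x))"
    unfolding distr_X extended_decomposable_distribution_def
  proof (rule density_cong)
    \<comment> \<open>The functions f are nonnegative only on their spaces, so splitting the product
      in \<open>ennreal\<close> needs the coordinates of x to lie there.\<close>
    have eq: "ennreal (f\<^sub>U (u_coord G \<phi> G\<^sub>0 H L Z x) * f\<^sub>V (v_coord G \<phi> G\<^sub>0 H L Z x) * f\<^sub>Z (z_coord G \<phi> G\<^sub>0 H L Z x)) =
        ?F (?yz x)" if x: "x \<in> topspace TX" for x
    proof -
      have "?uvz x \<in> space (?U \<Otimes>\<^sub>M (?V \<Otimes>\<^sub>M ?Z))" using measurable_space[OF uvz] x by simp
      then show ?thesis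
        using uvz_eq[OF x] fU(2) fV(2) fZ(2)
        by (simp add: space_pair_measure case_prod_beta ennreal_mult)
    qed
    show "AE x in \<Lambda>. ennreal (f\<^sub>U (u_coord G \<phi> G\<^sub>0 H L Z x) * f\<^sub>V (v_coord G \<phi> G\<^sub>0 H L Z x) * f\<^sub>Z (z_coord G \<phi> G\<^sub>0 H L Z x)) =
        ?F (?yz x)"
      by (rule AE_I2) (use eq sets_eq_imp_space_eq[OF sets_\<Lambda>] in simp)
    have F_meas: "(\<lambda>x. ?F (?yz x)) \<in> borel_measurable (borel_of TX)" by measurable
    then show "(\<lambda>x. ?F (?yz x)) \<in> borel_measurable \<Lambda>" by measurable
    have "(\<lambda>x. ennreal (f\<^sub>U (u_coord G \<phi> G\<^sub>0 H L Z x) * f\<^sub>V (v_coord G \<phi> G\<^sub>0 H L Z x) * f\<^sub>Z (z_coord G \<phi> G\<^sub>0 H L Z x)))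
        \<in> borel_measurable (borel_of TX)"
      using F_meas by (subst measurable_cong[where g="\<lambda>x. ?F (?yz x)"]) (simp_all add: eq)
    then show "(\<lambda>x. ennreal (f\<^sub>U (u_coord G \<phi> G\<^sub>0 H L Z x) * f\<^sub>V (v_coord G \<phi> G\<^sub>0 H L Z x) * f\<^sub>Z (z_coord G \<phi> G\<^sub>0 H L Z x)))
        \<in> borel_measurable \<Lambda>" by measurable
  qed
  also have "distr (density \<Lambda> (\<lambda>x. ?F (?yz x))) (?U \<Otimes>\<^sub>M (?V \<Otimes>\<^sub>M ?Z)) ?uvz =
      distr (density \<Lambda> (\<lambda>x. ?F (?yz x))) (?U \<Otimes>\<^sub>M (?V \<Otimes>\<^sub>M ?Z)) (?split \<circ> ?yz)"
    using sets_eq_imp_space_eq[OF sets_\<Lambda>] by (intro distr_cong refl) (simp add: uvz_eq)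
  also have "\<dots> = distr (distr (density \<Lambda> (\<lambda>x. ?F (?yz x))) (?Y \<Otimes>\<^sub>M ?Z) ?yz) (?U \<Otimes>\<^sub>M (?V \<Otimes>\<^sub>M ?Z)) ?split"
    by (rule distr_distr[symmetric]) measurable
  also have "distr (density \<Lambda> (\<lambda>x. ?F (?yz x))) (?Y \<Otimes>\<^sub>M ?Z) ?yz = density (distr \<Lambda> (?Y \<Otimes>\<^sub>M ?Z) ?yz) ?F"
    by (rule density_distr[symmetric]) measurable
  also have "distr \<Lambda> (?Y \<Otimes>\<^sub>M ?Z) ?yz = N \<Otimes>\<^sub>M \<nu>\<^sub>Z" using distr_\<Lambda> by (simp add: N_def)
  also have "distr (density (N \<Otimes>\<^sub>M \<nu>\<^sub>Z) ?F) (?U \<Otimes>\<^sub>M (?V \<Otimes>\<^sub>M ?Z)) ?split =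
      distr (density (N \<Otimes>\<^sub>M \<nu>\<^sub>Z) ?F) (P \<Otimes>\<^sub>M (R \<Otimes>\<^sub>M \<nu>\<^sub>Z)) ?split"
    by (intro distr_cong refl sets_pair_measure_cong) (simp_all add: sets_P sets_R sets_\<nu>)
  also note product
  also have "density P (\<lambda>C. ennreal (f\<^sub>U C)) = density \<mu>\<^sub>U (\<lambda>C. ennreal (f\<^sub>U C * on_coset chi C))"
    unfolding P_def
  proof (subst density_density_eq)
    show "density \<mu>\<^sub>U (\<lambda>C. ennreal (on_coset chi C) * ennreal (f\<^sub>U C)) =
        density \<mu>\<^sub>U (\<lambda>C. ennreal (f\<^sub>U C * on_coset chi C))"
    proof (rule density_cong)
      show "AE C in \<mu>\<^sub>U. ennreal (on_coset chi C) * ennreal (f\<^sub>U C) = ennreal (f\<^sub>U C * on_coset chi C)"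
        by (rule AE_I2) (use fU(2) chi_pos_U sets_eq_imp_space_eq[OF sets_U]
            in \<open>simp add: ennreal_mult less_imp_le mult.commute\<close>)
    qed measurable
  qed measurable
  also have "density R (\<lambda>C. ennreal (f\<^sub>V C)) = density \<mu>\<^sub>V (\<lambda>v. ennreal (f\<^sub>V v * on_coset chi v *
      on_coset (right_modulus G \<mu>\<^sub>G) v * inverse (on_coset (right_modulus (G\<lparr>carrier := L\<rparr>) \<mu>\<^sub>L) v)))"
  proof -
    have "density R (\<lambda>C. ennreal (f\<^sub>V C)) =
        density W (\<lambda>C. ennreal (on_coset chi C) * ennreal (f\<^sub>V C))"
      unfolding R_def by (rule density_density_eq) measurable
    also have "\<dots> = density \<mu>\<^sub>V (\<lambda>C. ennreal (?w C) * (ennreal (on_coset chi C) * ennreal (f\<^sub>V C)))"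
      unfolding W_def by (rule density_density_eq) measurable
    also have "\<dots> = density \<mu>\<^sub>V (\<lambda>C. ennreal (f\<^sub>V C * on_coset chi C * ?w C))"
    proof (rule density_cong)
      show "AE C in \<mu>\<^sub>V. ennreal (?w C) * (ennreal (on_coset chi C) * ennreal (f\<^sub>V C)) =
          ennreal (f\<^sub>V C * on_coset chi C * ?w C)"
      proof (rule AE_I2)
        fix C assume "C \<in> space \<mu>\<^sub>V"
        then have C: "C \<in> topspace TV" using sets_eq_imp_space_eq[OF sets_V] by simp
        then obtain l where "l \<in> L" "C = l <#\<^bsub>G\<^esub> G\<^sub>0" unfolding TV V.topspace_Q by auto
        then have "0 < ?w C" using weight_pos[OF haar_G haar_L] by simp
        then show "ennreal (?w C) * (ennreal (on_coset chi C) * ennreal (f\<^sub>V C)) =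
            ennreal (f\<^sub>V C * on_coset chi C * ?w C)"
          using fV(2)[OF C] chi_pos_V[OF C] by (simp add: ennreal_mult ac_simps)
      qed
    qed measurable
    finally show ?thesis
      by (simp only: weight_eq_modulus mult.assoc)
  qed
  finally have joint: "distr M (?U \<Otimes>\<^sub>M (?V \<Otimes>\<^sub>M ?Z)) (\<lambda>\<omega>. ?uvz (X \<omega>)) =
      density \<mu>\<^sub>U (\<lambda>u. ennreal (f\<^sub>U u * on_coset chi u)) \<Otimes>\<^sub>M
      (density \<mu>\<^sub>V (\<lambda>v. ennreal (f\<^sub>V v * on_coset chi v * on_coset (right_modulus G \<mu>\<^sub>G) v *
          inverse (on_coset (right_modulus (G\<lparr>carrier := L\<rparr>) \<mu>\<^sub>L) v))) \<Otimes>\<^sub>M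
       density \<nu>\<^sub>Z (\<lambda>z. ennreal (f\<^sub>Z z)))" .

  \<comment> \<open>Independence\<close>
  moreover have "independent_triple M ?U (\<lambda>\<omega>. u_coord G \<phi> G\<^sub>0 H L Z (X \<omega>))
      ?V (\<lambda>\<omega>. v_coord G \<phi> G\<^sub>0 H L Z (X \<omega>)) ?Z (\<lambda>\<omega>. z_coord G \<phi> G\<^sub>0 H L Z (X \<omega>))"
  proof (rule independent_tripleI_product[OF \<open>prob_space M\<close> _ _ _ _ _ _ _ _ joint])
    have uvzX: "(\<lambda>\<omega>. ?uvz (X \<omega>)) \<in> measurable M (?U \<Otimes>\<^sub>M (?V \<Otimes>\<^sub>M ?Z))"
      by (rule measurable_compose[OF X uvz])
    show "(\<lambda>\<omega>. u_coord G \<phi> G\<^sub>0 H L Z (X \<omega>)) \<in> measurable M ?U"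
      using measurable_compose[OF uvzX measurable_fst] by simp
    show "(\<lambda>\<omega>. v_coord G \<phi> G\<^sub>0 H L Z (X \<omega>)) \<in> measurable M ?V"
      using measurable_compose[OF measurable_compose[OF uvzX measurable_snd] measurable_fst] by simp
    show "(\<lambda>\<omega>. z_coord G \<phi> G\<^sub>0 H L Z (X \<omega>)) \<in> measurable M ?Z"
      using measurable_compose[OF measurable_compose[OF uvzX measurable_snd] measurable_snd] by simp
    \<comment> \<open>Measurability is known for \<open>weight\<close> as a whole;
      \<open>weight_eq_modulus\<close> converts it to the quotient of moduli displayed in the
      conclusion.\<close>
    have "(\<lambda>v. f\<^sub>V v * on_coset chi v * ?w v) \<in> borel_measurable ?V" by measurable
    then have [measurable]: "(\<lambda>v. f\<^sub>V v * on_coset chi v * on_coset (right_modulus G \<mu>\<^sub>G) v *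
          inverse (on_coset (right_modulus (G\<lparr>carrier := L\<rparr>) \<mu>\<^sub>L) v)) \<in> borel_measurable ?V"
      by (simp only: weight_eq_modulus mult.assoc)
    show "sigma_finite_measure (density \<mu>\<^sub>V (\<lambda>v. ennreal (f\<^sub>V v * on_coset chi v *
        on_coset (right_modulus G \<mu>\<^sub>G) v * inverse (on_coset (right_modulus (G\<lparr>carrier := L\<rparr>) \<mu>\<^sub>L) v))))"
      by (subst V.sigma_finite_iff_density_finite) auto
    show "sigma_finite_measure (density \<nu>\<^sub>Z (\<lambda>z. ennreal (f\<^sub>Z z)))"
      by (subst \<nu>.sigma_finite_iff_density_finite) auto
  qed (simp_all add: sets_U sets_V sets_\<nu>)
  ultimately show ?thesis using inv_U inv_V by blast
qed

end
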